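(* Let $M\ge1$ be a (finite) integer and let $K$ be a real, continuous and isotropic kernel on $S^\infty\times S^M$, with isotropic part $f:[-1,1]^2\to\mathbb{R}$. Then $K$ is positive definite on $S^\infty\times S^M$ if and only if there exist real numbers $\check f_{k,l}^{M}\ge0$, $k,l\in\mathbb{Z}_+$, with $\sum_{k,l=0}^\infty \check f_{k,l}^{M}<\infty$ such that $$f(t,s)=\sum_{k,l=0}^\infty \check f_{k,l}^{M}\,t^kR_l^M(s),\qquad t,s\in[-1,1].$$
   Context: $\mathbb{Z}_+=\{0,1,2,\ldots\}$. $S^M$ is the unit sphere in $\mathbb{R}^{M+1}$ and $S^\infty$ is the unit sphere of the real Hilbert space $\ell^2$, each endowed with its geodesic distance; $\cdot$ denotes the inner product. A kernel $K$ on $S^\infty\times S^M$ is isotropic if $K((x,z),(y,w))=f(x\cdot y,z\cdot w)$ for all $x,y\in S^\infty$, $z,w\in S^M$, for some function $f:[-1,1]^2\to\mathbb{R}$, called the isotropic part of $K$. A kernel $K$ on a nonempty set $X$ is positive definite if $\sum_{\mu,\nu=1}^n c_\mu c_\nu K(x_\mu,x_\nu)\ge 0$ for all $n\ge1$, all distinct $x_1,\ldots,x_n\in X$ and all real $c_1,\ldots,c_n$. $P_l^M$ is the Gegenbauer polynomial of degree $l$ with parameter $(M-1)/2$ (usual notation $C_l^{(M-1)/2}$); for $M=1$, $P_l^1$ is the Chebyshev polynomial $T_l$. $R_l^M=P_l^M/P_l^M(1)$. Convention: $t^0=1$ for all $t$. *)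

theory Defs
  imports "HOL-Analysis.Analysis" "HOL-Computational_Algebra.Polynomial"
begin

section \<open>The real Hilbert space of square-summable sequences\<close>

typedef ell2 = "{x :: nat \<Rightarrow> real. summable (\<lambda>i. (x i)\<^sup>2)}"
  morphisms ell2_nth Abs_ell2
  by (rule exI[of _ "\<lambda>_. 0"]) simp

setup_lifting type_definition_ell2

lemma summable_mult_of_squares:
  fixes x y :: "nat \<Rightarrow> real"
  assumes "summable (\<lambda>i. (x i)\<^sup>2)" "summable (\<lambda>i. (y i)\<^sup>2)"
  shows "summable (\<lambda>i. x i * y i)"
proof (rule summable_comparison_test')
  show "summable (\<lambda>i. (x i)\<^sup>2 + (y i)\<^sup>2)"
    using assms by (rule summable_add)
  fix i :: nat
  have "2 * (\<bar>x i\<bar> * \<bar>y i\<bar>) \<le> (x i)\<^sup>2 + (y i)\<^sup>2"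
    using sum_squares_bound[of "\<bar>x i\<bar>" "\<bar>y i\<bar>"] by simp
  moreover have "0 \<le> \<bar>x i\<bar> * \<bar>y i\<bar>"
    by simp
  ultimately show "norm (x i * y i) \<le> (x i)\<^sup>2 + (y i)\<^sup>2"
    unfolding real_norm_def abs_mult by linarith
qed

lemma summable_add_squares:
  fixes x y :: "nat \<Rightarrow> real"
  assumes "summable (\<lambda>i. (x i)\<^sup>2)" "summable (\<lambda>i. (y i)\<^sup>2)"
  shows "summable (\<lambda>i. (x i + y i)\<^sup>2)"
proof -
  have "summable (\<lambda>i. (x i)\<^sup>2 + (y i)\<^sup>2 + 2 * (x i * y i))"
    by (intro summable_add summable_mult summable_mult_of_squares assms)
  then show ?thesis
    by (simp add: power2_sum mult.assoc)
qed

lemma summable_diff_squares: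
  fixes x y :: "nat \<Rightarrow> real"
  assumes "summable (\<lambda>i. (x i)\<^sup>2)" "summable (\<lambda>i. (y i)\<^sup>2)"
  shows "summable (\<lambda>i. (x i - y i)\<^sup>2)"
  using summable_add_squares[of x "\<lambda>i. - y i"] assms by simp

lemma ell2_summable_squares: "summable (\<lambda>i. (ell2_nth x i)\<^sup>2)"
  using ell2_nth[of x] by simp

lemma ell2_summable_mult: "summable (\<lambda>i. ell2_nth x i * ell2_nth y i)"
  by (intro summable_mult_of_squares ell2_summable_squares)

instantiation ell2 :: real_inner
begin

lift_definition zero_ell2 :: ell2 is "\<lambda>_. 0" by simp

lift_definition plus_ell2 :: "ell2 \<Rightarrow> ell2 \<Rightarrow> ell2" is "\<lambda>x y i. x i + y i"
  by (rule summable_add_squares)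

lift_definition minus_ell2 :: "ell2 \<Rightarrow> ell2 \<Rightarrow> ell2" is "\<lambda>x y i. x i - y i"
  by (rule summable_diff_squares)

lift_definition uminus_ell2 :: "ell2 \<Rightarrow> ell2" is "\<lambda>x i. - x i" by simp

lift_definition scaleR_ell2 :: "real \<Rightarrow> ell2 \<Rightarrow> ell2" is "\<lambda>c x i. c * x i"
  by (simp add: power_mult_distrib summable_mult)

definition inner_ell2 :: "ell2 \<Rightarrow> ell2 \<Rightarrow> real" where
  "inner_ell2 x y = (\<Sum>i. ell2_nth x i * ell2_nth y i)"

definition norm_ell2 :: "ell2 \<Rightarrow> real" where
  "norm_ell2 x = sqrt (inner x x)"

definition sgn_ell2 :: "ell2 \<Rightarrow> ell2" where
  "sgn_ell2 x = inverse (norm x) *\<^sub>R x"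

definition dist_ell2 :: "ell2 \<Rightarrow> ell2 \<Rightarrow> real" where
  "dist_ell2 x y = norm (x - y)"

definition uniformity_ell2 :: "(ell2 \<times> ell2) filter" where
  "uniformity_ell2 = (INF e\<in>{0<..}. principal {(x, y). dist x y < e})"

definition open_ell2 :: "ell2 set \<Rightarrow> bool" where
  "open_ell2 U \<longleftrightarrow> (\<forall>x\<in>U. eventually (\<lambda>(x', y). x' = x \<longrightarrow> y \<in> U) uniformity)"

instance
proof
  fix x y z :: ell2 and a b :: real and U :: "ell2 set"
  show "x + y + z = x + (y + z)" "x + y = y + x" "0 + x = x" "- x + x = 0" "x - y = x + - y"
    by (transfer; simp add: fun_eq_iff)+
  show "a *\<^sub>R (x + y) = a *\<^sub>R x + a *\<^sub>R y" "(a + b) *\<^sub>R x = a *\<^sub>R x + b *\<^sub>R x"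
    "a *\<^sub>R b *\<^sub>R x = (a * b) *\<^sub>R x" "1 *\<^sub>R x = x"
    by (transfer; simp add: algebra_simps)+
  show "dist x y = norm (x - y)" "norm x = sqrt (x \<bullet> x)" "sgn x = inverse (norm x) *\<^sub>R x"
    "uniformity = (INF e\<in>{0<..}. principal {(x :: ell2, y). dist x y < e})"
    "open U = (\<forall>x\<in>U. \<forall>\<^sub>F (x', y) in uniformity. x' = x \<longrightarrow> y \<in> U)"
    by (fact dist_ell2_def norm_ell2_def sgn_ell2_def uniformity_ell2_def open_ell2_def)+
  show "x \<bullet> y = y \<bullet> x"
    by (simp add: inner_ell2_def mult.commute)
  show "(x + y) \<bullet> z = x \<bullet> z + y \<bullet> z"
    unfolding inner_ell2_def plus_ell2.rep_eq distrib_right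
    by (rule suminf_add[symmetric]) (rule ell2_summable_mult)+
  show "(a *\<^sub>R x) \<bullet> y = a * (x \<bullet> y)"
    unfolding inner_ell2_def scaleR_ell2.rep_eq mult.assoc
    by (rule suminf_mult) (rule ell2_summable_mult)
  show "0 \<le> x \<bullet> x"
    unfolding inner_ell2_def by (rule suminf_nonneg) (auto intro: ell2_summable_mult)
  have "x \<bullet> x = 0 \<longleftrightarrow> (\<forall>i. ell2_nth x i * ell2_nth x i = 0)"
    unfolding inner_ell2_def by (rule suminf_eq_zero_iff) (auto intro: ell2_summable_mult)
  also have "\<dots> \<longleftrightarrow> x = 0"
    by (transfer; auto)
  finally show "x \<bullet> x = 0 \<longleftrightarrow> x = 0" .
qed

end


section \<open>Unit spheres with the geodesic distance\<close>

abbreviation unit_sphere :: "'a::real_inner set" where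
  "unit_sphere \<equiv> sphere 0 1"

text \<open>
  Off the unit sphere the value 0 is irrelevant; it only serves to make \<^const>\<open>arccos\<close> be applied
  to arguments in $[-1,1]$, so that the locale \<^locale>\<open>Metric_space\<close> can be instantiated.
\<close>

definition geodesic_dist :: "'a::real_inner \<Rightarrow> 'a \<Rightarrow> real" where
  "geodesic_dist x y = (if x \<in> unit_sphere \<and> y \<in> unit_sphere then arccos (x \<bullet> y) else 0)"

abbreviation sphere_topology :: "'a::real_inner topology" where
  "sphere_topology \<equiv> Metric_space.mtopology unit_sphere geodesic_dist"

lemma unit_sphere_inner_bounds:
  fixes x y :: "'a::real_inner"
  assumes "x \<in> unit_sphere" "y \<in> unit_sphere"
  shows "- 1 \<le> x \<bullet> y" "x \<bullet> y \<le> 1"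
  using Cauchy_Schwarz_ineq2[of x y] assms by auto

lemma geodesic_dist_triangle:
  fixes x y z :: "'a::real_inner"
  assumes "x \<in> unit_sphere" "y \<in> unit_sphere" "z \<in> unit_sphere"
  shows "geodesic_dist x z \<le> geodesic_dist x y + geodesic_dist y z"
proof -
  define a where "a = arccos (x \<bullet> y)"
  define b where "b = arccos (y \<bullet> z)"
  note xy = unit_sphere_inner_bounds[OF assms(1,2)]
  note yz = unit_sphere_inner_bounds[OF assms(2,3)]
  note xz = unit_sphere_inner_bounds[OF assms(1,3)]
  have ab: "0 \<le> a" "0 \<le> b"
    unfolding a_def b_def using xy yz by (auto intro: arccos_lbound)
  have self: "x \<bullet> x = 1" "y \<bullet> y = 1" "z \<bullet> z = 1"
    using assms by (auto simp: dot_square_norm)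
  have "arccos (x \<bullet> z) \<le> a + b"
  proof (cases "a + b \<le> pi")
    case True
    define u where "u = x - (x \<bullet> y) *\<^sub>R y"
    define v where "v = z - (y \<bullet> z) *\<^sub>R y"
    have nu: "norm u = sqrt (1 - (x \<bullet> y)\<^sup>2)"
      unfolding u_def norm_eq_sqrt_inner
      by (simp add: inner_diff inner_commute self power2_eq_square algebra_simps)
    have nv: "norm v = sqrt (1 - (y \<bullet> z)\<^sup>2)"
      unfolding v_def norm_eq_sqrt_inner
      by (simp add: inner_diff inner_commute self power2_eq_square algebra_simps)
    have uv: "u \<bullet> v = x \<bullet> z - (x \<bullet> y) * (y \<bullet> z)"
      unfolding u_def v_def
      by (simp add: inner_diff inner_commute self power2_eq_square algebra_simps)
    have "cos (a + b) = (x \<bullet> y) * (y \<bullet> z) - norm u * norm v"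
      unfolding cos_add a_def b_def nu nv using xy yz by (simp add: sin_arccos)
    also have "\<dots> \<le> x \<bullet> z"
      using Cauchy_Schwarz_ineq2[of u v] uv by linarith
    finally have "arccos (x \<bullet> z) \<le> arccos (cos (a + b))"
      using xz by (intro arccos_le_arccos) auto
    then show ?thesis
      using True ab by (simp add: arccos_cos)
  next
    case False
    then show ?thesis
      using arccos_ubound[OF xz] by linarith
  qed
  then show ?thesis
    using assms by (simp add: geodesic_dist_def a_def b_def)
qed

lemma norm_diff_unit_sphere:
  fixes x y :: "'a::real_inner"
  assumes "x \<in> unit_sphere" "y \<in> unit_sphere"
  shows "(norm (x - y))\<^sup>2 = 2 - 2 * (x \<bullet> y)"
proof -
  have "x \<bullet> x = 1" "y \<bullet> y = 1"
    using assms by (auto simp: dot_square_norm)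
  then show ?thesis
    unfolding power2_norm_eq_inner by (simp add: inner_diff inner_commute)
qed

interpretation sphere_metric: Metric_space "unit_sphere :: 'a::real_inner set" geodesic_dist
proof
  fix x y z :: 'a
  show "0 \<le> geodesic_dist x y"
    unfolding geodesic_dist_def using unit_sphere_inner_bounds[of x y]
    by (auto intro: arccos_lbound simp del: mem_sphere_0)
  show "geodesic_dist x y = geodesic_dist y x"
    by (simp add: geodesic_dist_def inner_commute)
  show "geodesic_dist x y = 0 \<longleftrightarrow> x = y" if xy: "x \<in> unit_sphere" "y \<in> unit_sphere"
  proof -
    have "geodesic_dist x y = 0 \<longleftrightarrow> x \<bullet> y = 1"
      unfolding geodesic_dist_def
      using xy unit_sphere_inner_bounds[OF xy] cos_arccos[of "x \<bullet> y"]
      by (metis arccos_1 cos_zero)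
    also have "\<dots> \<longleftrightarrow> (norm (x - y))\<^sup>2 = 0"
      unfolding norm_diff_unit_sphere[OF xy] by auto
    finally show ?thesis
      by simp
  qed
qed (rule geodesic_dist_triangle)

lemma dist_unit_sphere:
  fixes x y :: "'a::real_inner"
  assumes "x \<in> unit_sphere" "y \<in> unit_sphere"
  shows "(dist x y)\<^sup>2 = 2 - 2 * cos (geodesic_dist x y)"
proof -
  have "(dist x y)\<^sup>2 = 2 - 2 * (x \<bullet> y)"
    unfolding dist_norm by (rule norm_diff_unit_sphere[OF assms])
  then show ?thesis
    using assms unit_sphere_inner_bounds[OF assms] by (simp add: geodesic_dist_def)
qed

text \<open>The geodesic distance and the norm induce the same topology on the unit sphere.\<close>

lemma sphere_topology_eq: "sphere_topology = top_of_set (unit_sphere :: 'a::real_inner set)"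
proof -
  have "openin sphere_topology U \<longleftrightarrow> openin (top_of_set unit_sphere) U" for U :: "'a set"
  proof
    assume U: "openin sphere_topology U"
    show "openin (top_of_set unit_sphere) U"
      unfolding openin_euclidean_subtopology_iff
    proof (intro conjI ballI)
      show "U \<subseteq> unit_sphere"
        using U sphere_metric.openin_mtopology by blast
      fix x assume x: "x \<in> U"
      then obtain r where r: "r > 0" "sphere_metric.mball x r \<subseteq> U"
        using U sphere_metric.openin_mtopology by blast
      define q where "q = min r pi"
      have q: "0 < q" "q \<le> pi" "q \<le> r"
        using r by (auto simp: q_def)
      have cq: "cos q < 1"
        using q cos_monotone_0_pi[of 0 q] by simp
      show "\<exists>e>0. \<forall>y\<in>unit_sphere. dist y x < e \<longrightarrow> y \<in> U"
      proof (intro exI[of _ "sqrt (2 - 2 * cos q)"] conjI ballI impI)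
        show "0 < sqrt (2 - 2 * cos q)"
          using cq by simp
        fix y :: 'a assume y: "y \<in> unit_sphere" "dist y x < sqrt (2 - 2 * cos q)"
        have xS: "x \<in> unit_sphere"
          using x \<open>U \<subseteq> unit_sphere\<close> by blast
        have "(dist x y)\<^sup>2 < 2 - 2 * cos q"
          using y(2) cq by (metis dist_commute real_sqrt_less_iff real_sqrt_abs abs_of_nonneg zero_le_dist)
        then have "cos q < cos (geodesic_dist x y)"
          using dist_unit_sphere[OF xS y(1)] by linarith
        moreover have "geodesic_dist x y \<le> pi"
          using xS y(1) unit_sphere_inner_bounds[OF xS y(1)]
          by (simp add: geodesic_dist_def arccos_ubound)
        ultimately have "geodesic_dist x y < q"
          using q cos_mono_less_eq[of q "geodesic_dist x y"] sphere_metric.nonneg[of x y] by linarith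
        then show "y \<in> U"
          using r(2) xS y(1) q by (auto simp: sphere_metric.in_mball)
      qed
    qed
  next
    assume U: "openin (top_of_set unit_sphere) U"
    show "openin sphere_topology U"
      unfolding sphere_metric.openin_mtopology
    proof (intro conjI allI impI)
      show S: "U \<subseteq> unit_sphere"
        using U openin_euclidean_subtopology_iff by blast
      fix x assume x: "x \<in> U"
      then obtain e where e: "e > 0" "\<And>y. y \<in> unit_sphere \<Longrightarrow> dist y x < e \<Longrightarrow> y \<in> U"
        using U unfolding openin_euclidean_subtopology_iff by blast
      have "sphere_metric.mball x e \<subseteq> U"
      proof
        fix y assume "y \<in> sphere_metric.mball x e"
        then have y: "x \<in> unit_sphere" "y \<in> unit_sphere" "geodesic_dist x y < e"
          by (auto simp: sphere_metric.in_mball)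
        have "1 - cos (geodesic_dist x y) = 2 * (sin (geodesic_dist x y / 2))\<^sup>2"
          using cos_double_sin[of "geodesic_dist x y / 2"] by simp
        moreover have "(sin (geodesic_dist x y / 2))\<^sup>2 \<le> (geodesic_dist x y / 2)\<^sup>2"
          using abs_sin_x_le_abs_x[of "geodesic_dist x y / 2"] by (simp only: abs_le_square_iff)
        ultimately have "(dist x y)\<^sup>2 \<le> (geodesic_dist x y)\<^sup>2"
          unfolding dist_unit_sphere[OF y(1,2)] by (simp add: power_divide)
        then have "dist x y \<le> geodesic_dist x y"
          using power2_le_imp_le sphere_metric.nonneg by blast
        then show "y \<in> U"
          using e(2)[OF y(2)] y(3) by (simp add: dist_commute)
      qed
      then show "\<exists>r>0. sphere_metric.mball x r \<subseteq> U"
        using e(1) by blast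
    qed
  qed
  then show ?thesis
    by (simp add: topology_eq)
qed


section \<open>Kernels\<close>

definition pos_def_kernel :: "'a set \<Rightarrow> ('a \<Rightarrow> 'a \<Rightarrow> real) \<Rightarrow> bool" where
  "pos_def_kernel X K \<longleftrightarrow>
     (\<forall>n\<ge>1. \<forall>(x :: nat \<Rightarrow> 'a) (c :: nat \<Rightarrow> real).
        x \<in> {1..n} \<rightarrow> X \<longrightarrow> inj_on x {1..n} \<longrightarrow>
        (\<Sum>\<mu>=1..n. \<Sum>\<nu>=1..n. c \<mu> * c \<nu> * K (x \<mu>) (x \<nu>)) \<ge> 0)"

definition continuous_kernel :: "'a topology \<Rightarrow> ('a \<Rightarrow> 'a \<Rightarrow> real) \<Rightarrow> bool" where
  "continuous_kernel T K \<longleftrightarrow>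
     continuous_map (prod_topology T T) euclideanreal (\<lambda>(p, q). K p q)"

text \<open>The values of \<open>f\<close> outside $[-1,1]^2$ are irrelevant.\<close>

definition has_isotropic_part ::
    "('a::real_inner \<times> 'b::real_inner \<Rightarrow> 'a \<times> 'b \<Rightarrow> real) \<Rightarrow> (real \<Rightarrow> real \<Rightarrow> real) \<Rightarrow> bool" where
  "has_isotropic_part K f \<longleftrightarrow>
     (\<forall>x\<in>unit_sphere. \<forall>y\<in>unit_sphere. \<forall>z\<in>unit_sphere. \<forall>w\<in>unit_sphere.
        K (x, z) (y, w) = f (x \<bullet> y) (z \<bullet> w))"


section \<open>Gegenbauer polynomials\<close>

text \<open>
  Standard three-term recurrences
  $n C_n^\lambda(x) = 2x(n+\lambda-1) C_{n-1}^\lambda(x) - (n+2\lambda-2) C_{n-2}^\lambda(x)$ and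
  $T_n(x) = 2x\,T_{n-1}(x) - T_{n-2}(x)$.
\<close>

fun gegenbauer :: "real \<Rightarrow> nat \<Rightarrow> real poly" where
  "gegenbauer a 0 = 1"
| "gegenbauer a (Suc 0) = [:0, 2 * a:]"
| "gegenbauer a (Suc (Suc n)) =
     smult (1 / (real n + 2))
       (smult (2 * (real n + 1 + a)) ([:0, 1:] * gegenbauer a (Suc n))
        - smult (real n + 2 * a) (gegenbauer a n))"

fun chebyshev_T :: "nat \<Rightarrow> real poly" where
  "chebyshev_T 0 = 1"
| "chebyshev_T (Suc 0) = [:0, 1:]"
| "chebyshev_T (Suc (Suc n)) = [:0, 2:] * chebyshev_T (Suc n) - chebyshev_T n"

text \<open>For $M = 1$ the Gegenbauer parameter is 0 and the recurrence degenerates.\<close>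

definition sphere_poly :: "nat \<Rightarrow> nat \<Rightarrow> real poly" where
  "sphere_poly M l = (if M = 1 then chebyshev_T l else gegenbauer ((real M - 1) / 2) l)"

definition normalized_sphere_poly :: "nat \<Rightarrow> nat \<Rightarrow> real \<Rightarrow> real" where
  "normalized_sphere_poly M l s = poly (sphere_poly M l) s / poly (sphere_poly M l) 1"

lemma chebyshev_T_cos: "poly (chebyshev_T n) (cos t) = cos (real n * t)"
proof (induction n rule: chebyshev_T.induct)
  case (3 n)
  have "cos (real (Suc (Suc n)) * t) + cos (real n * t) = 2 * cos t * cos (real (Suc n) * t)"
    using cos_add[of "real (Suc n) * t" t] cos_diff[of "real (Suc n) * t" t]
    by (simp add: algebra_simps)
  then show ?case
    using 3 by simp
qed simp_all

lemma gegenbauer_1: "poly (gegenbauer a n) 1 = pochhammer (2 * a) n / fact n"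
proof (induction a n rule: gegenbauer.induct)
  case (3 a n)
  define P where "P = pochhammer (2 * a) n"
  have "poly (gegenbauer a (Suc (Suc n))) 1 =
      (2 * (real n + 1 + a) * (P * (2 * a + real n) / ((real n + 1) * fact n))
        - (real n + 2 * a) * (P / fact n)) / (real n + 2)"
    unfolding gegenbauer.simps poly_smult poly_diff poly_mult 3
    by (simp add: P_def pochhammer_Suc add.commute)
  also have "\<dots> = P * (2 * a + real n) * (2 * a + real n + 1) / ((real n + 2) * (real n + 1) * fact n)"
  proof -
    have "real n + 1 \<noteq> 0" "real n + 2 \<noteq> 0" by linarith+
    then show ?thesis
      by (simp add: divide_simps) (simp add: algebra_simps)
  qed
  also have "\<dots> = pochhammer (2 * a) (Suc (Suc n)) / fact (Suc (Suc n))"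
    by (simp add: P_def pochhammer_Suc algebra_simps)
  finally show ?case .
qed (simp_all)

lemma sphere_poly_1_pos:
  assumes "M \<ge> 1"
  shows "poly (sphere_poly M l) 1 > 0"
proof (cases "M = 1")
  case True
  then show ?thesis
    using chebyshev_T_cos[of l 0] by (simp add: sphere_poly_def)
next
  case False
  with assms have "real M - 1 > 0"
    by simp
  then show ?thesis
    using False by (simp add: sphere_poly_def gegenbauer_1 pochhammer_pos)
qed

end

theory Submission
  imports Defs "HOL-Library.Diagonal_Subsequence"
begin

text \<open>
  Write $R_l$ for the normalised Gegenbauer polynomials, $\sigma$ for the rotation-invariant
  probability measure on $S^M$ and $L(h)$ for the mean of $h(u \cdot e)$ over $u \in S^M$, where $e$
  is a fixed pole.

  Everything that is needed about $R_l$ follows from the integration by parts formula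
  $L((1 - s^2) h') = M\,L(s h)$ (lemma \<open>stein\<close>). Together with the differential equation of $R_l$,
  which is extracted from the three-term recurrence, it makes the $R_l$ orthogonal for $L$.
  Convolution on the sphere with a zonal function, that is, with a function of $u \cdot z$, is a
  symmetric operator on polynomials which does not raise degrees, so orthogonal polynomials are its
  eigenvectors; this is the Funk-Hecke formula (\<open>funk_hecke\<close>). The special case
  $\int R_l(u \cdot z) R_l(u \cdot w)\,d\sigma(u) = L(R_l^2) R_l(z \cdot w)$ exhibits
  $R_l(z \cdot w)$ as a Gram kernel.

  Sufficiency is then a product of two Gram kernels, term by term: $(x \cdot y)^k R_l(z \cdot w)$ is
  positive definite (\<open>gram_power_zonal_nonneg\<close>).

  For necessity, expand $f(t, \cdot)$ in the $R_l$. The coefficient $f_l(x \cdot y)$ is up to a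
  positive factor the double integral of
  $f(x \cdot y, z \cdot u) R_l(z \cdot e) R_l(u \cdot e)$, hence is positive definite on $S^\infty$
  (\<open>zcoeff_pos_def\<close>). By Schoenberg's theorem on the Hilbert sphere
  (\<open>schoenberg_hilbert_sphere\<close>) it is a power series with nonnegative summable coefficients. That
  theorem has a short probabilistic proof. For independent signs $\varepsilon_1, \dots, \varepsilon_N$
  of mean $t$, the expectation of $g((\varepsilon_1 + \dots + \varepsilon_N)/N)$ is a Bernstein
  polynomial of $g$, so it tends to $g(t)$. It is also a polynomial in $t$ whose coefficients are
  sums of Fourier coefficients on the cube $\{-1,1\}^N$ of a function which is positive definite,
  because the vertices divided by $\sqrt N$ lie on the sphere.

  It remains to resum. The polynomials $(1 + s)^n$, normalised by $L$, form an approximate identity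
  (\<open>peak_concentrates\<close>, again by integration by parts). Convolving $f(t, \cdot)$ with them
  multiplies $f_l(t)$ by factors in $[0,1]$ which tend to 1. At $t = s = 1$ this bounds
  $\sum_l f_l(1)$, and since $|f_l(t)| \le f_l(1)$, dominated convergence gives
  $f(t,s) = \sum_l f_l(t) R_l(s)$.
\<close>

section \<open>The rotation-invariant probability measure on the sphere\<close>

lemma nn_integral_lborel_translate:
  fixes f :: "'a::euclidean_space \<Rightarrow> ennreal"
  assumes [measurable]: "f \<in> borel_measurable borel"
  shows "(\<integral>\<^sup>+x. f (c + x) \<partial>lborel) = (\<integral>\<^sup>+x. f x \<partial>lborel)"
proof -
  have "(\<integral>\<^sup>+x. f x \<partial>lborel) = (\<integral>\<^sup>+x. f x \<partial>distr lborel borel ((+) c))"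
    by (simp add: lborel_distr_plus)
  also have "\<dots> = (\<integral>\<^sup>+x. f (c + x) \<partial>lborel)"
    by (rule nn_integral_distr) auto
  finally show ?thesis by simp
qed

lemma orthogonal_transformation_borel_measurable:
  fixes Q :: "'a::euclidean_space \<Rightarrow> 'a"
  assumes "orthogonal_transformation Q"
  shows "Q \<in> borel_measurable borel"
  using assms
  by (intro borel_measurable_continuous_onI linear_continuous_on linear_conv_bounded_linear[THEN iffD1])
     (simp add: orthogonal_transformation_linear)

text \<open>
  The uniqueness argument for translation-invariant measures, in the special case at hand: evaluate the
  double integral of $1_A(Qx)\,1_B(Qx - y)$ over $x$ and $y$ in both orders, with $B$ the unit ball.
  One order gives the measure of $Q^{-1}A$ times that of $B$; after the shift $x \mapsto x + Q^{-1}y$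
  the other gives the measure of $A$ times that of $Q^{-1}B = B$.
\<close>

lemma lborel_distr_orthogonal:
  fixes Q :: "'a::euclidean_space \<Rightarrow> 'a"
  assumes Q: "orthogonal_transformation Q"
  shows "distr lborel borel Q = lborel"
proof (rule measure_eqI)
  note [measurable] = orthogonal_transformation_borel_measurable[OF Q]
  obtain Q' where Q': "\<And>y. Q (Q' y) = y"
    using orthogonal_transformation_surj[OF Q] by (metis surjD)
  have Q_add: "Q (x + y) = Q x + Q y" for x y
    using Q by (simp add: orthogonal_transformation_linear linear_add)
  fix A assume "A \<in> sets (distr lborel borel Q)"
  then have [measurable]: "A \<in> sets borel" by simp
  define B where "B = (ball 0 1 :: 'a set)"
  have [measurable]: "B \<in> sets borel" by (simp add: B_def)
  have B: "emeasure lborel B \<noteq> 0" "emeasure lborel B \<noteq> \<infinity>"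
    using content_ball_pos[of 1 "0::'a"] emeasure_lborel_ball_finite[of "0::'a" 1]
    by (auto simp: B_def emeasure_eq_ennreal_measure top.not_eq_extremum)
  have "emeasure (distr lborel borel Q) A * emeasure lborel B
      = (\<integral>\<^sup>+x. indicator A (Q x) * (\<integral>\<^sup>+y. indicator B y \<partial>lborel) \<partial>lborel)"
  proof -
    have "emeasure (distr lborel borel Q) A = (\<integral>\<^sup>+x. indicator A x \<partial>distr lborel borel Q)"
      by simp
    also have "\<dots> = (\<integral>\<^sup>+x. indicator A (Q x) \<partial>lborel)"
      by (rule nn_integral_distr) auto
    finally show ?thesis by (simp add: nn_integral_multc)
  qed
  also have "\<dots> = (\<integral>\<^sup>+x. (\<integral>\<^sup>+y. indicator A (Q x) * indicator B (Q x - y) \<partial>lborel) \<partial>lborel)"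
  proof (rule nn_integral_cong)
    fix x :: 'a
    have "(\<integral>\<^sup>+y. indicator B y \<partial>lborel) = (\<integral>\<^sup>+y. indicator B (- Q x + y) \<partial>lborel)"
      by (rule nn_integral_lborel_translate[symmetric]) simp
    also have "\<dots> = (\<integral>\<^sup>+y. indicator B (Q x - y) \<partial>lborel)"
      by (rule nn_integral_cong) (simp add: B_def indicator_def norm_minus_commute)
    finally show "indicator A (Q x) * (\<integral>\<^sup>+y. indicator B y \<partial>lborel)
        = (\<integral>\<^sup>+y. indicator A (Q x) * indicator B (Q x - y) \<partial>lborel)"
      by (simp add: nn_integral_cmult)
  qed
  also have "\<dots> = (\<integral>\<^sup>+y. (\<integral>\<^sup>+x. indicator A (Q x) * indicator B (Q x - y) \<partial>lborel) \<partial>lborel)"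
    by (rule lborel_pair.Fubini') simp
  also have "\<dots> = (\<integral>\<^sup>+y. (\<integral>\<^sup>+x. indicator A (Q x + y) * indicator B (Q x) \<partial>lborel) \<partial>lborel)"
  proof (rule nn_integral_cong)
    fix y :: 'a
    show "(\<integral>\<^sup>+x. indicator A (Q x) * indicator B (Q x - y) \<partial>lborel)
        = (\<integral>\<^sup>+x. indicator A (Q x + y) * indicator B (Q x) \<partial>lborel)"
      using nn_integral_lborel_translate[of "\<lambda>x. indicator A (Q x) * indicator B (Q x - y)" "Q' y"]
      by (simp add: Q_add Q' add.commute)
  qed
  also have "\<dots> = (\<integral>\<^sup>+x. (\<integral>\<^sup>+y. indicator A (Q x + y) * indicator B (Q x) \<partial>lborel) \<partial>lborel)"
    by (rule lborel_pair.Fubini') simp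
  also have "\<dots> = (\<integral>\<^sup>+x. emeasure lborel A * indicator B x \<partial>lborel)"
  proof (rule nn_integral_cong)
    fix x :: 'a
    have "(\<integral>\<^sup>+y. indicator A (Q x + y) \<partial>lborel) = emeasure lborel A"
      using nn_integral_lborel_translate[of "indicator A" "Q x"] by simp
    moreover have "indicator B (Q x) = (indicator B x :: ennreal)"
      using Q by (simp add: B_def indicator_def orthogonal_transformation_norm)
    ultimately show "(\<integral>\<^sup>+y. indicator A (Q x + y) * indicator B (Q x) \<partial>lborel)
        = emeasure lborel A * indicator B x"
      by (simp add: nn_integral_multc)
  qed
  also have "\<dots> = emeasure lborel A * emeasure lborel B"
    by (simp add: nn_integral_cmult)
  finally show "emeasure (distr lborel borel Q) A = emeasure lborel A"
    using B by (simp add: mult.commute[of _ "emeasure lborel B"] ennreal_mult_cancel_left)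
qed simp

text \<open>
  The value at the origin is a unit vector, so that every value lies on the sphere.
\<close>

definition to_sphere :: "'a::euclidean_space \<Rightarrow> 'a" where
  "to_sphere x = (if x = 0 then SOME b. b \<in> Basis else sgn x)"

lemma norm_to_sphere [simp]: "norm (to_sphere x) = 1"
proof -
  have "(SOME b::'a. b \<in> Basis) \<in> Basis" by (rule some_in_eq[THEN iffD2]) simp
  then show ?thesis by (auto simp: to_sphere_def norm_sgn)
qed

lemma to_sphere_measurable [measurable]:
  "(to_sphere :: 'a::euclidean_space \<Rightarrow> 'a) \<in> borel_measurable borel"
  unfolding to_sphere_def[abs_def] sgn_div_norm by measurable

lemma tendsto_to_sphere:
  fixes X :: "nat \<Rightarrow> 'a::euclidean_space"
  assumes "X \<longlonglongrightarrow> x" "norm x = 1"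
  shows "(\<lambda>n. to_sphere (X n)) \<longlonglongrightarrow> x"
proof -
  have "x \<noteq> 0" using assms(2) by auto
  have "(\<lambda>n. sgn (X n)) \<longlonglongrightarrow> sgn x"
    using assms(1) \<open>x \<noteq> 0\<close> by (rule tendsto_sgn)
  moreover have "sgn x = x" using assms(2) by (simp add: sgn_div_norm)
  moreover have "\<forall>\<^sub>F n in sequentially. sgn (X n) = to_sphere (X n)"
    using tendsto_imp_eventually_ne[OF assms(1) \<open>x \<noteq> 0\<close>]
    by eventually_elim (simp add: to_sphere_def)
  ultimately show ?thesis
    using tendsto_cong[of "\<lambda>n. sgn (X n)" "\<lambda>n. to_sphere (X n)" sequentially x] by simp
qed

lemma indicator_unit_ball_measurable [measurable]:
  "(indicator (ball 0 1) :: 'a::euclidean_space \<Rightarrow> real) \<in> borel_measurable borel"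
  by (rule borel_measurable_indicator) simp

text \<open>
  The uniform distribution of the unit ball, projected radially to the sphere, as a measure on the
  whole space.
\<close>

definition sphere_measure :: "'a::euclidean_space measure" where
  "sphere_measure =
     distr (density lborel (\<lambda>x. ennreal (indicator (ball 0 1) x / measure lborel (ball 0 1 :: 'a set))))
       borel to_sphere"

lemma sets_sphere_measure [measurable_cong, simp]: "sets sphere_measure = sets borel"
  by (simp add: sphere_measure_def)

lemma space_sphere_measure [simp]: "space sphere_measure = UNIV"
  by (simp add: sphere_measure_def)

lemma emeasure_sphere_measure_UNIV: "emeasure (sphere_measure :: 'a::euclidean_space measure) UNIV = 1"
proof -
  let ?B = "ball 0 1 :: 'a set"
  have pos: "measure lborel ?B > 0"
    using content_ball_pos[of 1 "0::'a"] by simp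
  have "emeasure (sphere_measure :: 'a measure) UNIV
      = (\<integral>\<^sup>+x. ennreal (indicator ?B x / measure lborel ?B) \<partial>lborel)"
    unfolding sphere_measure_def by (subst emeasure_distr, simp, simp, subst emeasure_density) simp_all
  also have "\<dots> = (\<integral>\<^sup>+x. ennreal (1 / measure lborel ?B) * indicator ?B x \<partial>lborel)"
    by (rule nn_integral_cong) (auto simp: indicator_def)
  also have "\<dots> = ennreal (1 / measure lborel ?B) * emeasure lborel ?B"
    by (rule nn_integral_cmult_indicator) simp
  also have "\<dots> = ennreal (1 / measure lborel ?B) * ennreal (measure lborel ?B)"
    using emeasure_lborel_ball_finite[of "0::'a" 1]
    by (subst emeasure_eq_ennreal_measure) (auto simp: top.not_eq_extremum)
  also have "\<dots> = 1"
    using pos by (simp flip: ennreal_mult')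
  finally show ?thesis .
qed

interpretation sphere_measure: finite_measure "sphere_measure :: 'a::euclidean_space measure"
  by standard (simp add: emeasure_sphere_measure_UNIV)

lemma measure_sphere_measure_UNIV [simp]: "measure (sphere_measure :: 'a::euclidean_space measure) UNIV = 1"
  by (simp add: measure_def emeasure_sphere_measure_UNIV)

interpretation sphere_pair: pair_sigma_finite
  "sphere_measure :: 'a::euclidean_space measure" "sphere_measure :: 'a measure"
  by standard

lemma AE_sphere_measure: "AE u in sphere_measure. norm u = 1"
  unfolding sphere_measure_def by (subst AE_distr_iff) auto

lemma sphere_integral_eq:
  fixes g :: "'a::euclidean_space \<Rightarrow> real"
  assumes [measurable]: "g \<in> borel_measurable borel"
  shows "(\<integral>u. g u \<partial>sphere_measure) =
     (\<integral>x. indicator (ball 0 1) x / measure lborel (ball 0 1 :: 'a set) * g (to_sphere x) \<partial>lborel)"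
  unfolding sphere_measure_def
  by (subst integral_distr, simp, simp, subst integral_density) simp_all

text \<open>
  An orthogonal map preserves Lebesgue measure and the ball, and it commutes with the radial
  projection away from the origin.
\<close>

lemma sphere_integral_orthogonal:
  fixes g :: "'a::euclidean_space \<Rightarrow> real" and Q :: "'a \<Rightarrow> 'a"
  assumes Q: "orthogonal_transformation Q" and [measurable]: "g \<in> borel_measurable borel"
  shows "(\<integral>u. g (Q u) \<partial>sphere_measure) = (\<integral>u. g u \<partial>sphere_measure)"
proof -
  note [measurable] = orthogonal_transformation_borel_measurable[OF Q]
  define h where "h x = indicator (ball 0 1) x / measure lborel (ball 0 1 :: 'a set) * g (to_sphere x)" for x
  have [measurable]: "h \<in> borel_measurable borel" by (simp add: h_def[abs_def])
  have "(\<integral>u. g (Q u) \<partial>sphere_measure) =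
     (\<integral>x. indicator (ball 0 1) x / measure lborel (ball 0 1 :: 'a set) * g (Q (to_sphere x)) \<partial>lborel)"
    by (rule sphere_integral_eq) simp
  also have "\<dots> = (\<integral>x. h (Q x) \<partial>lborel)"
  proof (rule integral_cong_AE)
    show "AE x in lborel. indicator (ball 0 1) x / measure lborel (ball 0 1 :: 'a set) * g (Q (to_sphere x)) = h (Q x)"
      using AE_lborel_singleton[of "0::'a"]
    proof eventually_elim
      case (elim x)
      then have "Q x \<noteq> 0"
        using orthogonal_transformation_norm[OF Q, of x] by auto
      then have "Q (to_sphere x) = to_sphere (Q x)"
        using elim Q
        by (simp add: to_sphere_def sgn_div_norm orthogonal_transformation_norm orthogonal_transformation_scaleR)
      moreover have "indicator (ball 0 1) x = (indicator (ball 0 1) (Q x) :: real)"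
        using orthogonal_transformation_norm[OF Q, of x] by (simp add: indicator_def)
      ultimately show ?case by (simp add: h_def)
    qed
  qed simp_all
  also have "\<dots> = (\<integral>x. h x \<partial>distr lborel borel Q)"
    by (rule integral_distr[symmetric]) auto
  also have "\<dots> = (\<integral>u. g u \<partial>sphere_measure)"
    by (simp add: lborel_distr_orthogonal[OF Q] sphere_integral_eq h_def)
  finally show ?thesis .
qed

lemma sphere_integrable_bounded:
  fixes g :: "'a::euclidean_space \<Rightarrow> real"
  assumes "g \<in> borel_measurable borel" "\<And>u. norm u = 1 \<Longrightarrow> \<bar>g u\<bar> \<le> B"
  shows "integrable sphere_measure g"
proof (rule sphere_measure.integrable_const_bound[of _ B])
  show "AE u in sphere_measure. norm (g u) \<le> B"
    using AE_sphere_measure by eventually_elim (use assms(2) in auto)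
qed (use assms(1) in \<open>simp add: measurable_def\<close>)

lemma sphere_integrable_continuous:
  fixes g :: "'a::euclidean_space \<Rightarrow> real"
  assumes "continuous_on UNIV g"
  shows "integrable sphere_measure g"
proof -
  have "compact (g ` sphere 0 1)"
    using assms by (intro compact_continuous_image) (auto intro: continuous_on_subset)
  then obtain B where "\<And>u. u \<in> sphere 0 1 \<Longrightarrow> \<bar>g u\<bar> \<le> B"
    using compact_imp_bounded[THEN bounded_iff[THEN iffD1]] by fastforce
  then show ?thesis
    using assms by (intro sphere_integrable_bounded[of g B]) (auto intro: borel_measurable_continuous_onI)
qed

definition reflect :: "'a::real_inner \<Rightarrow> 'a \<Rightarrow> 'a" where
  "reflect v x = x - (2 * (x \<bullet> v) / (v \<bullet> v)) *\<^sub>R v"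

lemma orthogonal_transformation_reflect:
  "orthogonal_transformation (reflect v :: 'a::euclidean_space \<Rightarrow> 'a)"
proof (cases "v = 0")
  case True
  then show ?thesis by (simp add: reflect_def[abs_def])
next
  case False
  have "reflect v x \<bullet> reflect v y = x \<bullet> y" for x y
    using False
    by (simp add: reflect_def inner_diff_left inner_diff_right inner_commute[of v y])
  moreover have "linear (reflect v)"
    by (rule linearI)
       (simp_all add: reflect_def inner_add_left algebra_simps add_divide_distrib)
  ultimately show ?thesis by (simp add: orthogonal_transformation_def)
qed

lemma reflect_fixes: "x \<bullet> v = 0 \<Longrightarrow> reflect v x = x"
  by (simp add: reflect_def)

lemma reflect_swap:
  assumes "norm a = norm b" shows "reflect (a - b) a = b"
proof (cases "a = b")
  case False
  have "a \<bullet> a = b \<bullet> b" using assms by (simp add: dot_square_norm)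
  then have "(a - b) \<bullet> (a - b) = 2 * (a \<bullet> (a - b))"
    by (simp add: inner_diff_left inner_diff_right inner_commute)
  moreover have "(a - b) \<bullet> (a - b) \<noteq> 0" using False by simp
  ultimately have "2 * (a \<bullet> (a - b)) / ((a - b) \<bullet> (a - b)) = 1" by (metis divide_self)
  then have "reflect (a - b) a = a - 1 *\<^sub>R (a - b)" by (simp only: reflect_def)
  then show ?thesis by simp
qed (simp add: reflect_def)

text \<open>
  Two reflections suffice: the first maps \<open>z\<close> to \<open>z'\<close>, and the second moves the
  image of \<open>w\<close> to \<open>w'\<close> and fixes \<open>z'\<close>, because both points have the same inner product with
  \<open>z'\<close>.
\<close>

lemma orthogonal_transformation_exists_pair:
  fixes z w z' w' :: "'a::euclidean_space"
  assumes "norm z = norm z'" "norm w = norm w'" "z \<bullet> w = z' \<bullet> w'"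
  obtains Q where "orthogonal_transformation Q" "Q z = z'" "Q w = w'"
proof -
  define w1 where "w1 = reflect (z - z') w"
  have z: "reflect (z - z') z = z'"
    by (rule reflect_swap[OF assms(1)])
  have "norm w1 = norm w'"
    using orthogonal_transformation_norm[OF orthogonal_transformation_reflect, of "z - z'" w] assms(2)
    by (simp add: w1_def)
  then have w: "reflect (w1 - w') w1 = w'"
    by (rule reflect_swap)
  have "z' \<bullet> w1 = z \<bullet> w"
    using orthogonal_transformation_reflect[of "z - z'"] z
    unfolding orthogonal_transformation_def w1_def by metis
  then have "reflect (w1 - w') z' = z'"
    using assms(3) by (intro reflect_fixes) (simp add: inner_diff_right)
  then show ?thesis
    using z w orthogonal_transformation_compose[OF orthogonal_transformation_reflect orthogonal_transformation_reflect]
    by (intro that[of "reflect (w1 - w') \<circ> reflect (z - z')"]) (auto simp: w1_def)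
qed

text \<open>
  Integrals that involve two directions depend only on the lengths and the angle of these directions.
  All uses of rotation invariance go through this form.
\<close>

lemma sphere_integral_pair_invariant:
  fixes z w z' w' :: "'a::euclidean_space" and g :: "real \<Rightarrow> real \<Rightarrow> real"
  assumes g: "continuous_on UNIV (\<lambda>p. g (fst p) (snd p))"
    and "norm z = norm z'" "norm w = norm w'" "z \<bullet> w = z' \<bullet> w'"
  shows "(\<integral>u. g (u \<bullet> z) (u \<bullet> w) \<partial>sphere_measure) = (\<integral>u. g (u \<bullet> z') (u \<bullet> w') \<partial>sphere_measure)"
proof -
  obtain Q where Q: "orthogonal_transformation Q" "Q z = z'" "Q w = w'"
    using assms(2-4) by (rule orthogonal_transformation_exists_pair)
  have inner: "Q u \<bullet> z' = u \<bullet> z" "Q u \<bullet> w' = u \<bullet> w" for u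
    using Q by (auto simp: orthogonal_transformation_def)
  have "continuous_on UNIV (\<lambda>u. g (u \<bullet> z') (u \<bullet> w'))"
    using continuous_on_compose2[OF g, of UNIV "\<lambda>u. (u \<bullet> z', u \<bullet> w')"]
    by (simp add: continuous_intros)
  then have "(\<lambda>u. g (u \<bullet> z') (u \<bullet> w')) \<in> borel_measurable borel"
    by (rule borel_measurable_continuous_onI)
  from sphere_integral_orthogonal[OF Q(1) this] show ?thesis
    by (simp add: inner)
qed

lemma sphere_pair_integrable_continuous:
  fixes g :: "'a::euclidean_space \<times> 'a \<Rightarrow> real"
  assumes g: "continuous_on UNIV g"
  shows "integrable (sphere_measure \<Otimes>\<^sub>M sphere_measure) g"
proof -
  interpret P: finite_measure "sphere_measure \<Otimes>\<^sub>M sphere_measure :: ('a \<times> 'a) measure"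
    by (rule finite_measure_pair_measure) (rule sphere_measure.finite_measure_axioms)+
  have "compact (g ` (sphere 0 1 \<times> sphere 0 1))"
    using g by (intro compact_continuous_image compact_Times) (auto intro: continuous_on_subset)
  then obtain B where B: "\<And>u. u \<in> sphere 0 1 \<times> sphere 0 1 \<Longrightarrow> \<bar>g u\<bar> \<le> B"
    using compact_imp_bounded[THEN bounded_iff[THEN iffD1]] by fastforce
  have sets: "sets (sphere_measure \<Otimes>\<^sub>M sphere_measure :: ('a \<times> 'a) measure) = sets borel"
    by (subst borel_prod[symmetric]) (intro sets_pair_measure_cong; simp)
  have meas: "g \<in> borel_measurable (sphere_measure \<Otimes>\<^sub>M sphere_measure)"
    using borel_measurable_continuous_onI[OF g] measurable_cong_sets[OF sets refl] by blast
  have "AE p in (sphere_measure \<Otimes>\<^sub>M sphere_measure :: ('a \<times> 'a) measure). norm (fst p) = 1 \<and> norm (snd p) = 1"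
  proof (rule sphere_pair.AE_pair_measure)
    show "{p \<in> space (sphere_measure \<Otimes>\<^sub>M sphere_measure :: ('a \<times> 'a) measure). norm (fst p) = 1 \<and> norm (snd p) = 1}
       \<in> sets (sphere_measure \<Otimes>\<^sub>M sphere_measure)"
      by measurable
    show "AE x in sphere_measure. AE y in sphere_measure. norm (fst (x::'a, y::'a)) = 1 \<and> norm (snd (x, y)) = 1"
      using AE_sphere_measure
    proof eventually_elim
      case (elim x)
      show ?case using AE_sphere_measure by eventually_elim (simp add: elim)
    qed
  qed
  then have "AE p in sphere_measure \<Otimes>\<^sub>M sphere_measure. norm (g p) \<le> B"
    by eventually_elim (use B in auto)
  then show ?thesis
    by (rule P.integrable_const_bound) (rule meas)
qed

lemma sphere_Fubini:
  fixes g :: "'a::euclidean_space \<Rightarrow> 'a \<Rightarrow> real"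
  assumes g: "continuous_on UNIV (\<lambda>p. g (fst p) (snd p))"
  shows "(\<integral>w. (\<integral>u. g u w \<partial>sphere_measure) \<partial>sphere_measure) = (\<integral>u. (\<integral>w. g u w \<partial>sphere_measure) \<partial>sphere_measure)"
  by (rule sphere_pair.Fubini_integral)
     (use sphere_pair_integrable_continuous[OF g] in \<open>simp add: case_prod_unfold\<close>)

lemma simple_function_integral_comp:
  fixes G :: "'a::euclidean_space \<Rightarrow> 'a" and h :: "'a \<Rightarrow> real"
  assumes G: "simple_function sphere_measure G"
  shows "(\<integral>u. h (G u) \<partial>sphere_measure) = (\<Sum>p\<in>range G. h p * measure sphere_measure (G -` {p}))"
proof -
  have fin: "finite (range G)" using simple_functionD(1)[OF G] by simp
  have sets: "G -` {p} \<in> sets sphere_measure" for p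
    using simple_functionD(2)[OF G, of "{p}"] by simp
  have "h (G u) = (\<Sum>p\<in>range G. h p * indicator (G -` {p}) u)" for u
  proof -
    have "(\<Sum>p\<in>range G. h p * indicator (G -` {p}) u) = (\<Sum>p\<in>range G. if p = G u then h p else 0)"
      by (rule sum.cong) (auto simp: indicator_def)
    then show ?thesis using fin by simp
  qed
  then have "(\<integral>u. h (G u) \<partial>sphere_measure) = (\<Sum>p\<in>range G. \<integral>u. h p * indicator (G -` {p}) u \<partial>sphere_measure)"
    by (simp only:)
       (intro Bochner_Integration.integral_sum integrable_mult_right integrable_real_indicator sets
          sphere_measure.emeasure_finite[unfolded less_top[symmetric]]; simp add: less_top[symmetric])
  then show ?thesis using sets by simp
qed

text \<open>
  Replacing both variables by the same simple function with values on the sphere turns the double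
  integral into a finite quadratic form, whose weights are the measures of the level sets. Simple
  functions that converge to the identity give the claim by dominated convergence, first in the inner
  and then in the outer variable.
\<close>

lemma sphere_double_integral_nonneg:
  fixes \<Phi> :: "'a::euclidean_space \<Rightarrow> 'a \<Rightarrow> real"
  assumes cont: "continuous_on UNIV (\<lambda>p. \<Phi> (fst p) (snd p))"
    and pos: "\<And>P d. finite P \<Longrightarrow> P \<subseteq> sphere 0 1 \<Longrightarrow> 0 \<le> (\<Sum>p\<in>P. \<Sum>q\<in>P. d p * d q * \<Phi> p q)"
  shows "0 \<le> (\<integral>z. (\<integral>u. \<Phi> z u \<partial>sphere_measure) \<partial>sphere_measure)"
proof -
  obtain F :: "nat \<Rightarrow> 'a \<Rightarrow> 'a" where F: "\<And>i. simple_function sphere_measure (F i)" "\<And>u. (\<lambda>i. F i u) \<longlonglongrightarrow> u"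
    using borel_measurable_implies_sequence_metric[of "\<lambda>u. u" "sphere_measure :: 'a measure" 0]
    by (auto simp: measurable_def)
  define G where "G i u = to_sphere (F i u)" for i u
  have G: "simple_function sphere_measure (G i)" for i
    using simple_function_compose[OF F(1)[of i], of to_sphere] by (simp add: G_def[abs_def] o_def)
  have G_norm: "norm (G i u) = 1" for i u by (simp add: G_def)
  have G_lim: "(\<lambda>i. G i u) \<longlonglongrightarrow> u" if "norm u = 1" for u
    unfolding G_def using F(2) that by (rule tendsto_to_sphere)
  have [measurable]: "G i \<in> borel_measurable borel" for i
    using borel_measurable_simple_function[OF G[of i]] by (simp add: measurable_def)
  have "compact ((\<lambda>p. \<Phi> (fst p) (snd p)) ` (sphere 0 1 \<times> sphere 0 1))"
    using cont by (intro compact_continuous_image compact_Times) (auto intro: continuous_on_subset)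
  then obtain B where B: "\<And>p. p \<in> sphere 0 1 \<times> sphere 0 1 \<Longrightarrow> \<bar>\<Phi> (fst p) (snd p)\<bar> \<le> B"
    using compact_imp_bounded[THEN bounded_iff[THEN iffD1]] by fastforce
  have bound: "\<bar>\<Phi> z u\<bar> \<le> B" if "norm z = 1" "norm u = 1" for z u
    using B[of "(z, u)"] that by simp
  have sets: "sets (sphere_measure \<Otimes>\<^sub>M sphere_measure :: ('a \<times> 'a) measure) = sets borel"
    by (subst borel_prod[symmetric]) (intro sets_pair_measure_cong; simp)
  have [measurable]: "(\<lambda>p. \<Phi> (fst p) (snd p)) \<in> borel_measurable (borel \<Otimes>\<^sub>M borel)"
    using borel_measurable_continuous_onI[OF cont] by (simp add: borel_prod)
  have inner_bound: "\<bar>\<integral>u. h u \<partial>sphere_measure\<bar> \<le> B" if "h \<in> borel_measurable borel" "\<And>u. norm u = 1 \<Longrightarrow> \<bar>h u\<bar> \<le> B" for h :: "'a \<Rightarrow> real"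
  proof -
    have "\<bar>\<integral>u. h u \<partial>sphere_measure\<bar> \<le> (\<integral>u. \<bar>h u\<bar> \<partial>sphere_measure)"
      by (rule integral_abs_bound)
    also have "\<dots> \<le> (\<integral>u. B \<partial>(sphere_measure :: 'a measure))"
    proof (rule integral_mono_AE)
      show "AE u in sphere_measure. \<bar>h u\<bar> \<le> B"
        using AE_sphere_measure by eventually_elim (rule that(2))
    qed (use that in \<open>auto intro!: integrable_abs sphere_integrable_bounded[of h B]\<close>)
    finally show ?thesis by simp
  qed
  have meas1: "(\<lambda>u. \<Phi> z (G i u)) \<in> borel_measurable borel" for z i
    using measurable_compose[of "\<lambda>u. (z, G i u)" borel "borel \<Otimes>\<^sub>M borel" "\<lambda>p. \<Phi> (fst p) (snd p)" borel] by simp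
  have meas2: "(\<lambda>u. \<Phi> z u) \<in> borel_measurable borel" for z
    using measurable_compose[of "\<lambda>u. (z, u)" borel "borel \<Otimes>\<^sub>M borel" "\<lambda>p. \<Phi> (fst p) (snd p)" borel] by simp
  define J where "J i z = (\<integral>u. \<Phi> (G i z) (G i u) \<partial>sphere_measure)" for i z
  have J: "J i z = (\<Sum>q\<in>range (G i). \<Phi> (G i z) q * measure sphere_measure (G i -` {q}))" for i z
    unfolding J_def by (rule simple_function_integral_comp[OF G])
  have J_meas: "J i \<in> borel_measurable borel" for i
  proof -
    have "(\<lambda>z. \<Phi> (G i z) q) \<in> borel_measurable borel" for q
      using measurable_compose[of "\<lambda>z. (G i z, q)" borel "borel \<Otimes>\<^sub>M borel" "\<lambda>p. \<Phi> (fst p) (snd p)" borel] by simp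
    then show ?thesis unfolding J[abs_def] by measurable
  qed
  have inner_lim: "(\<lambda>i. J i z) \<longlonglongrightarrow> (\<integral>u. \<Phi> z u \<partial>sphere_measure)" if z: "norm z = 1" for z
    unfolding J_def
  proof (rule integral_dominated_convergence[where w = "\<lambda>_. B"])
    show "AE u in sphere_measure. (\<lambda>i. \<Phi> (G i z) (G i u)) \<longlonglongrightarrow> \<Phi> z u"
      using AE_sphere_measure
    proof eventually_elim
      case (elim u)
      have "isCont (\<lambda>p. \<Phi> (fst p) (snd p)) (z, u)"
        using cont by (simp add: continuous_on_eq_continuous_at)
      then show ?case
        using isCont_tendsto_compose[OF _ tendsto_Pair[OF G_lim[OF z] G_lim[OF elim]]] by fastforce
    qed
    show "AE u in sphere_measure. norm (\<Phi> (G i z) (G i u)) \<le> B" for i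
      by (simp add: bound G_norm)
  qed (use meas1 meas2 in \<open>simp_all add: measurable_def\<close>)
  have outer: "(\<lambda>i. \<integral>z. J i z \<partial>sphere_measure) \<longlonglongrightarrow> (\<integral>z. (\<integral>u. \<Phi> z u \<partial>sphere_measure) \<partial>sphere_measure)"
  proof (rule integral_dominated_convergence[where w = "\<lambda>_. B"])
    show "AE z in sphere_measure. (\<lambda>i. J i z) \<longlonglongrightarrow> (\<integral>u. \<Phi> z u \<partial>sphere_measure)"
      using AE_sphere_measure by eventually_elim (rule inner_lim)
    show "AE z in sphere_measure. norm (J i z) \<le> B" for i
      unfolding J_def by (simp add: inner_bound[OF meas1] bound G_norm)
    have "(\<lambda>(z, u). \<Phi> z u) \<in> borel_measurable (sphere_measure \<Otimes>\<^sub>M sphere_measure)"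
      using borel_measurable_continuous_onI[OF cont] measurable_cong_sets[OF sets refl]
      by (auto simp: case_prod_unfold)
    then show "(\<lambda>z. \<integral>u. \<Phi> z u \<partial>sphere_measure) \<in> borel_measurable sphere_measure"
      by (rule sphere_measure.borel_measurable_lebesgue_integral)
    show "J i \<in> borel_measurable sphere_measure" for i
      using J_meas by (simp add: measurable_def)
  qed simp
  have "0 \<le> (\<integral>z. J i z \<partial>sphere_measure)" for i
  proof -
    let ?R = "range (G i)" and ?m = "\<lambda>p. measure sphere_measure (G i -` {p})"
    have "(\<integral>z. J i z \<partial>sphere_measure) = (\<Sum>p\<in>?R. (\<Sum>q\<in>?R. \<Phi> p q * ?m q) * ?m p)"
      unfolding J using simple_function_integral_comp[OF G[of i], of "\<lambda>p. \<Sum>q\<in>?R. \<Phi> p q * ?m q"] by simp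
    also have "\<dots> = (\<Sum>p\<in>?R. \<Sum>q\<in>?R. ?m p * ?m q * \<Phi> p q)"
      by (simp add: sum_distrib_left mult_ac)
    also have "\<dots> \<ge> 0"
      using simple_functionD(1)[OF G[of i]] by (intro pos) (auto simp: G_norm)
    finally show ?thesis .
  qed
  then show ?thesis
    by (intro LIMSEQ_le_const[OF outer]) auto
qed

section \<open>Normalised Gegenbauer polynomials\<close>

definition zonal_poly :: "nat \<Rightarrow> nat \<Rightarrow> real poly" where
  "zonal_poly M l = smult (1 / poly (sphere_poly M l) 1) (sphere_poly M l)"

lemma poly_zonal_poly: "poly (zonal_poly M l) s = normalized_sphere_poly M l s"
  by (simp add: zonal_poly_def normalized_sphere_poly_def)

lemma zonal_poly_1: "M \<ge> 1 \<Longrightarrow> poly (zonal_poly M l) 1 = 1"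
  using sphere_poly_1_pos[of M l] by (simp add: zonal_poly_def)

lemma zonal_poly_0 [simp]: "zonal_poly M 0 = 1"
  by (simp add: zonal_poly_def sphere_poly_def)

lemma zonal_poly_Suc_0:
  assumes "M \<ge> 1" shows "zonal_poly M (Suc 0) = [:0, 1:]"
proof (cases "M = 1")
  case False
  with assms have "real M - 1 > 0" by simp
  then show ?thesis using False by (simp add: zonal_poly_def sphere_poly_def)
qed (simp add: zonal_poly_def sphere_poly_def)

text \<open>
  After normalisation at 1 the Chebyshev and the Gegenbauer recurrences become instances of a single
  one, which no longer degenerates at $M = 1$.
\<close>

lemma zonal_poly_rec:
  assumes M: "M \<ge> 1"
  shows "smult (real n + real M) (zonal_poly M (Suc (Suc n))) =
    smult (2 * real n + real M + 1) ([:0, 1:] * zonal_poly M (Suc n)) - smult (real n + 1) (zonal_poly M n)"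
proof (cases "M = 1")
  case True
  have "poly (chebyshev_T k) 1 = 1" for k
    using chebyshev_T_cos[of k 0] by simp
  then have "zonal_poly M k = chebyshev_T k" for k
    by (simp add: True zonal_poly_def sphere_poly_def)
  then show ?thesis
    by (simp add: True smult_diff_right algebra_simps)
next
  case False
  define a where "a = (real M - 1) / 2"
  with False M have a: "a > 0" "real M = 2 * a + 1" by simp_all
  define C where "C k = gegenbauer a k" for k
  define c where "c k = poly (C k) 1" for k
  have c_pos: "c k > 0" for k
    using sphere_poly_1_pos[OF M, of k] False by (simp add: c_def C_def sphere_poly_def a_def)
  have Z: "C k = smult (c k) (zonal_poly M k)" for k
    using c_pos[of k] False by (simp add: c_def C_def sphere_poly_def a_def zonal_poly_def)
  have c_Suc: "c (Suc k) = c k * (2 * a + real k) / (real k + 1)" for k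
    by (simp add: c_def C_def gegenbauer_1 pochhammer_Suc field_simps)
  have c1: "c n = c (Suc n) * (real n + 1) / (2 * a + real n)"
    using a(1) add_pos_nonneg[of "2 * a" "real n"] add_pos_nonneg[of 1 "real n"]
    by (simp add: c_Suc add.commute)
  have c2: "c (Suc (Suc n)) = c (Suc n) * (2 * a + real n + 1) / (real n + 2)"
    by (simp add: c_Suc[of "Suc n"] add_ac)
  show ?thesis
  proof (rule poly_ext)
    fix x :: real
    let ?z = "\<lambda>k. poly (zonal_poly M k) x"
    have "poly (C (Suc (Suc n))) x =
       (2 * (real n + 1 + a) * (x * poly (C (Suc n)) x) - (real n + 2 * a) * poly (C n) x) / (real n + 2)"
      by (simp add: C_def)
    then have "c (Suc (Suc n)) * ?z (Suc (Suc n)) * (real n + 2) =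
       2 * (real n + 1 + a) * (x * (c (Suc n) * ?z (Suc n))) - (real n + 2 * a) * (c n * ?z n)"
      by (simp add: Z field_simps)
    also have "\<dots> = c (Suc n) * (2 * (real n + 1 + a) * (x * ?z (Suc n)) - (real n + 1) * ?z n)"
      using a(1) by (simp add: c1 field_simps)
    also have "c (Suc (Suc n)) * ?z (Suc (Suc n)) * (real n + 2) = c (Suc n) * ((2 * a + real n + 1) * ?z (Suc (Suc n)))"
      by (simp add: c2)
    finally have "(2 * a + real n + 1) * ?z (Suc (Suc n)) =
        2 * (real n + 1 + a) * (x * ?z (Suc n)) - (real n + 1) * ?z n"
      using c_pos[of "Suc n"] by simp
    then show "poly (smult (real n + real M) (zonal_poly M (Suc (Suc n)))) x =
      poly (smult (2 * real n + real M + 1) ([:0, 1:] * zonal_poly M (Suc n)) - smult (real n + 1) (zonal_poly M n)) x"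
      by (simp add: a(2) algebra_simps)
  qed
qed

lemma zonal_poly_rec_eval:
  assumes "M \<ge> 1"
  shows "(real n + real M) * poly (zonal_poly M (Suc (Suc n))) x =
    (2 * real n + real M + 1) * (x * poly (zonal_poly M (Suc n)) x) - (real n + 1) * poly (zonal_poly M n) x"
  using arg_cong[OF zonal_poly_rec[OF assms, of n], of "\<lambda>p. poly p x"] by simp

lemma zonal_poly_rec_pderiv:
  assumes "M \<ge> 1"
  shows "(real n + real M) * poly (pderiv (zonal_poly M (Suc (Suc n)))) x =
    (2 * real n + real M + 1) * (poly (zonal_poly M (Suc n)) x + x * poly (pderiv (zonal_poly M (Suc n))) x)
    - (real n + 1) * poly (pderiv (zonal_poly M n)) x"
  using arg_cong[OF zonal_poly_rec[OF assms, of n], of "\<lambda>p. poly (pderiv p) x"]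
  by (simp add: pderiv_smult pderiv_diff pderiv_mult pderiv_pCons algebra_simps)

text \<open>
  Proved by induction together with the companion formula that lowers the degree; the two are
  equivalent by the recurrence.
\<close>

lemma zonal_poly_pderiv_raise:
  assumes M: "M \<ge> 1"
  shows "(1 - x\<^sup>2) * poly (pderiv (zonal_poly M n)) x =
     (real n + real M - 1) * (x * poly (zonal_poly M n) x - poly (zonal_poly M (Suc n)) x)"
proof (induction n rule: induct_nat_012)
  case 0
  show ?case by (simp add: zonal_poly_Suc_0[OF M])
next
  case 1
  show ?case
    using zonal_poly_rec_eval[OF M, of 0 x]
    by (simp add: zonal_poly_Suc_0[OF M] pderiv_pCons power2_eq_square algebra_simps)
next
  case (ge2 n)
  let ?z = "\<lambda>k. poly (zonal_poly M k) x" and ?d = "\<lambda>k. poly (pderiv (zonal_poly M k)) x"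
  have pos: "real n + real M > 0" "real n + real M + 1 > 0" using M by auto
  note r0 = zonal_poly_rec_eval[OF M, of n x]
  note r1 = zonal_poly_rec_eval[OF M, of "Suc n" x]
  have lower: "(1 - x\<^sup>2) * ?d (Suc n) = (real n + 1) * (?z n - x * ?z (Suc n))"
    using ge2(2) r0 by (simp add: algebra_simps power2_eq_square)
  have "(real n + real M) * ((1 - x\<^sup>2) * ?d (Suc (Suc n)))
     = (2 * real n + real M + 1) * ((1 - x\<^sup>2) * ?z (Suc n) + x * ((1 - x\<^sup>2) * ?d (Suc n)))
       - (real n + 1) * ((1 - x\<^sup>2) * ?d n)"
    using arg_cong[OF zonal_poly_rec_pderiv[OF M, of n x], of "\<lambda>y. (1 - x\<^sup>2) * y"]
    by (simp add: algebra_simps)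
  also have "\<dots> = (real n + real M) * ((real n + 2) * (?z (Suc n) - x * ?z (Suc (Suc n))))"
  proof -
    have "(real n + real M) * ((real n + 2) * (?z (Suc n) - x * ?z (Suc (Suc n))))
      = (real n + 2) * ((real n + real M) * ?z (Suc n) - x * ((real n + real M) * ?z (Suc (Suc n))))"
      by (simp add: algebra_simps)
    then show ?thesis
      unfolding lower ge2(1) r0 by (simp add: algebra_simps power2_eq_square)
  qed
  finally have "(1 - x\<^sup>2) * ?d (Suc (Suc n)) = (real n + 2) * (?z (Suc n) - x * ?z (Suc (Suc n)))"
    using pos by simp
  then show ?case
    using r1 by (simp add: algebra_simps)
qed

lemma zonal_poly_pderiv_lower:
  assumes M: "M \<ge> 1"
  shows "(1 - x\<^sup>2) * poly (pderiv (zonal_poly M (Suc n))) x =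
     (real n + 1) * (poly (zonal_poly M n) x - x * poly (zonal_poly M (Suc n)) x)"
  using zonal_poly_pderiv_raise[OF M, of x "Suc n"] zonal_poly_rec_eval[OF M, of n x]
  by (simp add: algebra_simps)

text \<open>
  The differential operator $(1 - s^2)\,\partial^2 - M s\,\partial$, which is the Laplacian of the sphere
  on functions of $s = u \cdot e$.
\<close>

definition gegenbauer_op :: "nat \<Rightarrow> real poly \<Rightarrow> real poly" where
  "gegenbauer_op M p = [:1, 0, -1:] * pderiv (pderiv p) - smult (real M) ([:0, 1:] * pderiv p)"

text \<open>
  Differentiating the lowering formula and inserting the raising formula gives the differential
  equation multiplied by $1 - s^2$; that factor can be cancelled in the ring of polynomials.
\<close>

lemma gegenbauer_op_zonal_poly:
  assumes M: "M \<ge> 1"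
  shows "gegenbauer_op M (zonal_poly M n) = smult (- (real n * (real n + real M - 1))) (zonal_poly M n)"
proof (cases n)
  case 0
  then show ?thesis by (simp add: gegenbauer_op_def)
next
  case (Suc m)
  let ?Z = "zonal_poly M" and ?q = "[:1, 0, -1:] :: real poly"
  have low: "?q * pderiv (?Z (Suc m)) = smult (real m + 1) (?Z m - [:0, 1:] * ?Z (Suc m))"
    by (rule poly_ext) (use zonal_poly_pderiv_lower[OF M, of _ m] in \<open>simp add: power2_eq_square algebra_simps\<close>)
  \<comment> \<open>Both sides are compared after multiplication by $1 - x^2$, where the first-order formulas apply.\<close>
  have "?q * gegenbauer_op M (?Z (Suc m)) =
      ?q * smult (- (real (Suc m) * (real (Suc m) + real M - 1))) (?Z (Suc m))"
  proof (rule poly_ext)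
    fix x :: real
    let ?z = "\<lambda>k. poly (?Z k) x" and ?d = "\<lambda>k. poly (pderiv (?Z k)) x"
    let ?dd = "poly (pderiv (pderiv (?Z (Suc m)))) x"
    have "(1 - x\<^sup>2) * ?dd - 2 * x * ?d (Suc m) = (real m + 1) * (?d m - ?z (Suc m) - x * ?d (Suc m))"
      using arg_cong[OF low, of "\<lambda>p. poly (pderiv p) x"]
      unfolding pderiv_mult pderiv_smult pderiv_diff
      by (simp add: pderiv_pCons power2_eq_square algebra_simps)
    then have 1: "(1 - x\<^sup>2) * ((1 - x\<^sup>2) * ?dd) = 2 * x * ((1 - x\<^sup>2) * ?d (Suc m)) +
       (real m + 1) * ((1 - x\<^sup>2) * ?d m - (1 - x\<^sup>2) * ?z (Suc m) - x * ((1 - x\<^sup>2) * ?d (Suc m)))"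
      by algebra
    have 2: "(1 - x\<^sup>2) * ?d m = (real m + real M - 1) * (x * ?z m - ?z (Suc m))"
      by (rule zonal_poly_pderiv_raise[OF M])
    have 3: "(1 - x\<^sup>2) * ?d (Suc m) = (real m + 1) * (?z m - x * ?z (Suc m))"
      by (rule zonal_poly_pderiv_lower[OF M])
    have "(1 - x\<^sup>2) * ((1 - x\<^sup>2) * ?dd - real M * x * ?d (Suc m)) =
       (1 - x\<^sup>2) * (- ((real m + 1) * (real m + real M)) * ?z (Suc m))"
      using 1 2 3 by algebra
    then show "poly (?q * gegenbauer_op M (?Z (Suc m))) x =
      poly (?q * smult (- (real (Suc m) * (real (Suc m) + real M - 1))) (?Z (Suc m))) x"
      by (simp add: gegenbauer_op_def power2_eq_square algebra_simps)
  qed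
  then show ?thesis
    unfolding Suc by (subst (asm) mult_cancel_left) simp
qed

text \<open>
  Solved for $s R_{l+1}$, the recurrence has nonnegative coefficients. Hence multiplication by $s$
  preserves nonnegative combinations of the $R_l$.
\<close>

lemma monom_eq_sum_zonal_poly:
  assumes M: "M \<ge> 1"
  shows "\<exists>c. (\<forall>l. c l \<ge> 0) \<and> monom 1 n = (\<Sum>l\<le>n. smult (c l) (zonal_poly M l))"
proof (induction n)
  case 0
  show ?case by (rule exI[of _ "\<lambda>_. 1"]) simp
next
  case (Suc n)
  then obtain c where c: "\<And>l. c l \<ge> 0" "monom 1 n = (\<Sum>l\<le>n. smult (c l) (zonal_poly M l))"
    by blast
  let ?Z = "zonal_poly M"
  define \<alpha> where "\<alpha> l = (real l + real M) / (2 * real l + real M + 1)" for l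
  define \<beta> where "\<beta> l = (real l + 1) / (2 * real l + real M + 1)" for l
  have step: "[:0, 1:] * ?Z (Suc l) = smult (\<alpha> l) (?Z (Suc (Suc l))) + smult (\<beta> l) (?Z l)" for l
  proof (rule poly_ext)
    fix x :: real
    have "2 * real l + real M + 1 > 0" by (simp add: add_nonneg_pos)
    moreover have "X = A / D * u + B / D * v" if "D * X = A * u + B * v" "D > 0" for A B D X u v :: real
      using that by (simp add: field_simps)
    moreover have "(2 * real l + real M + 1) * (x * poly (?Z (Suc l)) x) =
        (real l + real M) * poly (?Z (Suc (Suc l))) x + (real l + 1) * poly (?Z l) x"
      using zonal_poly_rec_eval[OF M, of l x] by simp
    ultimately show "poly ([:0, 1:] * ?Z (Suc l)) x = poly (smult (\<alpha> l) (?Z (Suc (Suc l))) + smult (\<beta> l) (?Z l)) x"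
      by (simp add: \<alpha>_def \<beta>_def)
  qed
  have nonneg: "\<alpha> l \<ge> 0" "\<beta> l \<ge> 0" for l
    using M by (simp_all add: \<alpha>_def \<beta>_def)
  \<comment> \<open>The nonnegative combinations of the first polynomials form a convex cone.\<close>
  define comb where "comb p \<longleftrightarrow> (\<exists>d. (\<forall>l. d l \<ge> 0) \<and> p = (\<Sum>l\<le>Suc n. smult (d l) (?Z l)))" for p
  have zero: "comb 0" unfolding comb_def by (rule exI[of _ "\<lambda>_. 0"]) simp
  have add: "comb (p + q)" if "comb p" "comb q" for p q
  proof -
    from that obtain d e where "\<forall>l. d l \<ge> 0" "p = (\<Sum>l\<le>Suc n. smult (d l) (?Z l))"
      "\<forall>l. e l \<ge> 0" "q = (\<Sum>l\<le>Suc n. smult (e l) (?Z l))"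
      unfolding comb_def by blast
    then show ?thesis unfolding comb_def
      by (intro exI[of _ "\<lambda>l. d l + e l"]) (simp add: smult_add_left sum.distrib del: sum.atMost_Suc)
  qed
  have base: "comb (smult a (?Z k))" if "a \<ge> 0" "k \<le> Suc n" for a k
    unfolding comb_def using that by (intro exI[of _ "\<lambda>l. if l = k then a else 0"])
      (simp add: if_distrib[of "\<lambda>a. smult a _"] sum.delta cong: if_cong del: sum.atMost_Suc)
  have summand: "comb (smult (c l) ([:0, 1:] * ?Z l))" if "l \<le> n" for l
  proof (cases l)
    case 0
    then show ?thesis
      using base[of "c 0" "Suc 0"] c(1) by (simp add: zonal_poly_Suc_0[OF M] del: sum.atMost_Suc)
  next
    case (Suc k)
    have "smult (c l) ([:0, 1:] * ?Z l) = smult (c l * \<alpha> k) (?Z (Suc l)) + smult (c l * \<beta> k) (?Z k)"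
      unfolding Suc step by (simp add: smult_add_right)
    moreover have "comb (smult (c l * \<alpha> k) (?Z (Suc l)))" "comb (smult (c l * \<beta> k) (?Z k))"
      using that c(1) nonneg[of k] by (intro base mult_nonneg_nonneg; simp add: Suc)+
    ultimately show ?thesis using add by simp
  qed
  have "comb (\<Sum>l\<in>A. smult (c l) ([:0, 1:] * ?Z l))" if "finite A" "A \<subseteq> {..n}" for A
    using that
  proof (induction rule: finite_induct)
    case empty
    show ?case using zero by (simp only: sum.empty)
  next
    case (insert l A)
    then have "comb (smult (c l) ([:0, 1:] * ?Z l))" "comb (\<Sum>l\<in>A. smult (c l) ([:0, 1:] * ?Z l))"
      using summand by simp_all
    then show ?case
      unfolding sum.insert[OF insert.hyps] by (rule add)
  qed
  from this[of "{..n}"] have "comb (\<Sum>l\<le>n. smult (c l) ([:0, 1:] * ?Z l))" by blast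
  also have "(\<Sum>l\<le>n. smult (c l) ([:0, 1:] * ?Z l)) = [:0, 1:] * monom 1 n"
    by (simp add: c(2) sum_distrib_left mult_smult_right del: mult_pCons_left)
  also have "\<dots> = monom 1 (Suc n)"
    by (simp add: monom_Suc)
  finally show ?case by (simp only: comb_def)
qed

lemma poly_eq_sum_zonal_poly:
  assumes M: "M \<ge> 1" and p: "degree p \<le> n"
  shows "\<exists>c. p = (\<Sum>l\<le>n. smult (c l) (zonal_poly M l))"
proof -
  let ?Z = "zonal_poly M"
  have "\<exists>c. monom 1 i = (\<Sum>l\<le>n. smult (c l) (?Z l))" if "i \<le> n" for i
  proof -
    obtain c where "monom 1 i = (\<Sum>l\<le>i. smult (c l) (?Z l))"
      using monom_eq_sum_zonal_poly[OF M] by blast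
    also have "\<dots> = (\<Sum>l\<le>n. smult (if l \<le> i then c l else 0) (?Z l))"
      using that by (intro sum.mono_neutral_cong_left) auto
    finally show ?thesis by (rule exI[where x = "\<lambda>l. if l \<le> i then c l else 0"])
  qed
  then obtain c where c: "\<And>i. i \<le> n \<Longrightarrow> monom 1 i = (\<Sum>l\<le>n. smult (c i l) (?Z l))"
    by metis
  have "p = (\<Sum>i\<le>n. smult (coeff p i) (monom 1 i))"
    using poly_as_sum_of_monoms'[OF p] by (simp add: smult_monom)
  also have "\<dots> = (\<Sum>i\<le>n. smult (coeff p i) (\<Sum>l\<le>n. smult (c i l) (?Z l)))"
    by (rule sum.cong) (simp_all add: c)
  also have "\<dots> = (\<Sum>l\<le>n. smult (\<Sum>i\<le>n. coeff p i * c i l) (?Z l))"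
    by (rule poly_ext)
       (simp add: poly_sum sum_distrib_left sum_distrib_right mult.assoc, rule sum.swap)
  finally show ?thesis by (rule exI[where x = "\<lambda>l. \<Sum>i\<le>n. coeff p i * c i l"])
qed

lemma degree_zonal_poly: "M \<ge> 1 \<Longrightarrow> degree (zonal_poly M l) \<le> l"
proof -
  have "degree (chebyshev_T l) \<le> l"
  proof (induction l rule: chebyshev_T.induct)
    case (3 n)
    have "degree ([:0, 2:] * chebyshev_T (Suc n)) \<le> 1 + Suc n"
      using 3 by (intro order.trans[OF degree_mult_le] add_mono) auto
    then show ?case using 3 by (auto intro!: degree_diff_le)
  qed auto
  moreover have "degree (gegenbauer a l) \<le> l" for a
  proof (induction a l rule: gegenbauer.induct)
    case (3 a n)
    have "degree ([:0, 1:] * gegenbauer a (Suc n)) \<le> 1 + Suc n"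
      using 3 by (intro order.trans[OF degree_mult_le] add_mono) auto
    then show ?case using 3
      by (auto intro!: degree_diff_le order.trans[OF degree_smult_le] simp del: mult_pCons_left)
  qed auto
  ultimately show ?thesis
    unfolding zonal_poly_def sphere_poly_def by (auto intro: order.trans[OF degree_smult_le])
qed

section \<open>Orthogonality for the mean of zonal functions\<close>

text \<open>
  The point of the great circle through the orthonormal vectors \<open>p\<close> and \<open>q\<close> whose inner product
  with \<open>p\<close> is \<open>s\<close>.
\<close>

definition arc :: "'a::real_inner \<Rightarrow> 'a \<Rightarrow> real \<Rightarrow> 'a" where
  "arc p q s = s *\<^sub>R p + sqrt (1 - s\<^sup>2) *\<^sub>R q"

lemma inner_arc: "norm p = 1 \<Longrightarrow> p \<bullet> q = 0 \<Longrightarrow> p \<bullet> arc p q s = s"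
  by (simp add: arc_def inner_add_right dot_square_norm)

lemma norm_arc:
  assumes "norm p = 1" "norm q = 1" "p \<bullet> q = 0" "s \<in> {-1..1}"
  shows "norm (arc p q s) = 1"
proof -
  have "s\<^sup>2 \<le> 1" using assms(4) by (simp add: abs_square_le_1 abs_le_iff)
  moreover have "q \<bullet> p = 0" using assms(3) by (simp add: inner_commute)
  ultimately show ?thesis
    using assms(1-3)
    by (simp add: norm_eq_1 arc_def inner_add_left inner_add_right power2_eq_square[symmetric])
qed

lemma continuous_arc: "continuous_on A (arc p q)"
  unfolding arc_def by (intro continuous_intros)

text \<open>
  The ambient space has dimension $M + 1$, and two distinct basis vectors serve as pole and as a
  reference direction on the equator.
\<close>

locale zonal_sphere =
  fixes M :: nat and north east :: "'a::euclidean_space"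
  assumes M: "M \<ge> 1" and DIM: "DIM('a) = M + 1"
    and north: "north \<in> Basis" and east: "east \<in> Basis" and north_neq_east: "north \<noteq> east"
begin

lemma frame [simp]: "norm north = 1" "norm east = 1" "north \<bullet> north = 1" "east \<bullet> east = 1"
  "north \<bullet> east = 0" "east \<bullet> north = 0"
  using north east north_neq_east by (auto simp: inner_not_same_Basis)

abbreviation meridian :: "real \<Rightarrow> 'a" where
  "meridian \<equiv> arc north east"

lemma north_meridian [simp]: "north \<bullet> meridian s = s"
  by (rule inner_arc) simp_all

lemma norm_meridian [simp]: "s \<in> {-1..1} \<Longrightarrow> norm (meridian s) = 1"
  by (rule norm_arc) simp_all

abbreviation Z :: "nat \<Rightarrow> real poly" where "Z \<equiv> zonal_poly M"

definition zmean :: "(real \<Rightarrow> real) \<Rightarrow> real" where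
  "zmean F = (\<integral>u. F (u \<bullet> north) \<partial>sphere_measure)"

lemma continuous_zonal:
  "continuous_on UNIV F \<Longrightarrow> continuous_on A (\<lambda>u::'a. F (u \<bullet> z))" for F :: "real \<Rightarrow> real"
  by (rule continuous_on_compose2[of UNIV F]) (auto intro: continuous_intros)

lemma integrable_zonal:
  "continuous_on UNIV F \<Longrightarrow> integrable sphere_measure (\<lambda>u::'a. F (u \<bullet> z))" for F :: "real \<Rightarrow> real"
  by (intro sphere_integrable_continuous continuous_zonal)

lemma zmean_eq:
  fixes F :: "real \<Rightarrow> real" and z :: 'a
  assumes "continuous_on UNIV F" "norm z = 1"
  shows "(\<integral>u. F (u \<bullet> z) \<partial>sphere_measure) = zmean F"
  unfolding zmean_def
  by (rule sphere_integral_pair_invariant[of "\<lambda>a b. F a" z north 0 0])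
     (use assms in \<open>auto intro!: continuous_on_compose2[OF assms(1)] continuous_intros\<close>)

lemma zmean_add: "continuous_on UNIV F \<Longrightarrow> continuous_on UNIV G \<Longrightarrow> zmean (\<lambda>s. F s + G s) = zmean F + zmean G"
  unfolding zmean_def by (intro Bochner_Integration.integral_add integrable_zonal)

lemma zmean_mult: "zmean (\<lambda>s. c * F s) = c * zmean F"
  unfolding zmean_def by simp

lemma AE_inner_bounds: "norm z = 1 \<Longrightarrow> AE u in sphere_measure. u \<bullet> z \<in> {-1..1}" for z :: 'a
  using AE_sphere_measure
proof eventually_elim
  case (elim u)
  then show ?case using Cauchy_Schwarz_ineq2[of u z] by auto
qed

lemma zmean_mono:
  assumes "continuous_on UNIV F" "continuous_on UNIV G" "\<And>s. s \<in> {-1..1} \<Longrightarrow> F s \<le> G s"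
  shows "zmean F \<le> zmean G"
  unfolding zmean_def
proof (rule integral_mono_AE)
  show "AE u in sphere_measure. F (u \<bullet> north) \<le> G (u \<bullet> north)"
    using AE_inner_bounds[OF frame(1)] by eventually_elim (rule assms(3))
qed (intro integrable_zonal assms)+

definition pmean :: "real poly \<Rightarrow> real" where "pmean p = zmean (poly p)"

lemma continuous_poly: "continuous_on UNIV (poly p)" for p :: "real poly"
  by (intro continuous_intros)

lemma pmean_add: "pmean (p + q) = pmean p + pmean q"
proof -
  have "poly (p + q) = (\<lambda>s. poly p s + poly q s)" by auto
  then show ?thesis by (simp add: pmean_def zmean_add continuous_poly)
qed

lemma pmean_smult: "pmean (smult c p) = c * pmean p"
proof -
  have "poly (smult c p) = (\<lambda>s. c * poly p s)" by auto
  then show ?thesis by (simp add: pmean_def zmean_mult)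
qed

lemma pmean_minus: "pmean (- p) = - pmean p"
  using pmean_smult[of "-1" p] by simp

lemma pmean_diff: "pmean (p - q) = pmean p - pmean q"
  using pmean_add[of p "- q"] by (simp add: pmean_minus)

lemma pmean_0 [simp]: "pmean 0 = 0"
  using pmean_smult[of 0 0] by simp

lemma pmean_sum: "pmean (\<Sum>i\<in>I. p i) = (\<Sum>i\<in>I. pmean (p i))"
proof (induction I rule: infinite_finite_induct)
  case (insert i I) then show ?case by (simp add: pmean_add)
qed simp_all

lemma pmean_1 [simp]: "pmean 1 = 1"
  by (simp add: pmean_def zmean_def)

lemma pmean_monom_odd: assumes "odd n" shows "pmean (monom 1 n) = 0"
proof -
  have "(\<integral>u. (u \<bullet> north) ^ n \<partial>sphere_measure) = (\<integral>u. (u \<bullet> - north) ^ n \<partial>sphere_measure)"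
    by (rule sphere_integral_pair_invariant[of "\<lambda>a b. a ^ n" north "- north" 0 0]) (auto intro!: continuous_intros)
  then show ?thesis using assms by (simp add: pmean_def zmean_def poly_monom)
qed

text \<open>
  By rotation invariance $\int (u \cdot e + x\,u \cdot b)^{2k}\,d\sigma(u) = (1 + x^2)^k m_{2k}$, where
  $m_{2k}$ is the moment on the right-hand side of the claim. The claim compares the coefficients of
  $x^2$.
\<close>

lemma mixed_moment:
  assumes "k \<ge> 1" and b: "b \<in> Basis" "b \<noteq> north"
  shows "(2 * real k - 1) * (\<integral>u. (u \<bullet> b)\<^sup>2 * (u \<bullet> north) ^ (2 * k - 2) \<partial>sphere_measure) = pmean (monom 1 (2 * k))"
proof -
  have orth: "norm b = 1" "b \<bullet> b = 1" "b \<bullet> north = 0" "north \<bullet> b = 0"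
    using b north by (auto simp: inner_not_same_Basis)
  define n where "n = 2 * k"
  define c where "c i = real (n choose i) * (\<integral>u. (u \<bullet> b) ^ i * (u \<bullet> north) ^ (n - i) \<partial>sphere_measure)" for i
  have "(\<Sum>i\<le>n. monom (c i) i) = smult (pmean (monom 1 n)) ([:1, 0, 1:] ^ k)"
  proof (rule poly_ext)
    fix x :: real
    define w where "w = north + x *\<^sub>R b"
    have w: "norm w ^ 2 = 1 + x\<^sup>2"
      unfolding power2_norm_eq_inner w_def
      by (simp add: inner_add_left inner_add_right orth power2_eq_square)
    have "(\<integral>u. (u \<bullet> w) ^ n \<partial>sphere_measure) = (\<integral>u. (u \<bullet> (norm w *\<^sub>R north)) ^ n \<partial>sphere_measure)"
      by (rule sphere_integral_pair_invariant[of "\<lambda>a b. a ^ n" w _ 0 0]) (auto intro!: continuous_intros)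
    also have "\<dots> = norm w ^ n * pmean (monom 1 n)"
      by (simp add: pmean_def zmean_def poly_monom power_mult_distrib)
    also have "norm w ^ n = (1 + x\<^sup>2) ^ k"
      by (simp add: n_def power_mult w)
    finally have 1: "(\<integral>u. (u \<bullet> w) ^ n \<partial>sphere_measure) = (1 + x\<^sup>2) ^ k * pmean (monom 1 n)" .
    have "(u \<bullet> w) ^ n = (\<Sum>i\<le>n. real (n choose i) * x ^ i * ((u \<bullet> b) ^ i * (u \<bullet> north) ^ (n - i)))" for u
    proof -
      have "u \<bullet> w = x * (u \<bullet> b) + u \<bullet> north" by (simp add: w_def inner_add_right)
      then show ?thesis
        by (simp add: binomial_ring power_mult_distrib mult_ac)
    qed
    then have "(\<integral>u. (u \<bullet> w) ^ n \<partial>sphere_measure) =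
       (\<Sum>i\<le>n. (\<integral>u. real (n choose i) * x ^ i * ((u \<bullet> b) ^ i * (u \<bullet> north) ^ (n - i)) \<partial>sphere_measure))"
      by (simp only:) (intro Bochner_Integration.integral_sum sphere_integrable_continuous continuous_intros)
    also have "\<dots> = (\<Sum>i\<le>n. c i * x ^ i)"
      by (simp add: c_def mult_ac)
    finally have 2: "(\<integral>u. (u \<bullet> w) ^ n \<partial>sphere_measure) = (\<Sum>i\<le>n. c i * x ^ i)" .
    show "poly (\<Sum>i\<le>n. monom (c i) i) x = poly (smult (pmean (monom 1 n)) ([:1, 0, 1:] ^ k)) x"
      using 1 2 by (simp add: poly_sum poly_monom power2_eq_square mult.commute)
  qed
  then have "coeff (\<Sum>i\<le>n. monom (c i) i) 2 = pmean (monom 1 n) * coeff ([:1, 0, 1:] ^ k) 2"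
    by simp
  moreover have "coeff (\<Sum>i\<le>n. monom (c i) i) 2 = c 2"
    using assms(1) by (simp add: coeff_sum n_def)
  moreover have "coeff ([:1, 0, 1:] ^ k :: real poly) 2 = real k"
  proof -
    have "coeff ([:1, 0, 1:] ^ k :: real poly) 0 = 1 \<and> coeff ([:1, 0, 1:] ^ k :: real poly) 2 = real k"
      by (induction k) (simp_all add: coeff_mult numeral_2_eq_2)
    then show ?thesis ..
  qed
  moreover have "real (n choose 2) = real k * (2 * real k - 1)"
  proof -
    have "n choose 2 = k * (2 * k - 1)"
      by (simp add: choose_two n_def)
    then show ?thesis using assms(1) by (simp add: of_nat_diff)
  qed
  ultimately have "real k * ((2 * real k - 1) * (\<integral>u. (u \<bullet> b)\<^sup>2 * (u \<bullet> north) ^ (n - 2) \<partial>sphere_measure)) =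
     real k * pmean (monom 1 n)"
    by (simp only: c_def mult_ac)
  then show ?thesis
    using assms(1) unfolding n_def by simp
qed

text \<open>
  Sum the mixed moments over all basis vectors $b \ne e$, of which there are $M$, and use
  $\sum_b (u \cdot b)^2 = 1 - (u \cdot e)^2$ on the sphere. For even \<open>j\<close> both sides vanish by symmetry.
\<close>

lemma stein_monom:
  "real j * (pmean (monom 1 (j - 1)) - pmean (monom 1 (j + 1))) = real M * pmean (monom 1 (j + 1))"
proof (cases "odd j")
  case False
  then show ?thesis
    by (cases "j = 0") (simp_all add: pmean_monom_odd)
next
  case True
  then obtain k' where "j = 2 * k' + 1" by (rule oddE)
  \<comment> \<open>Write $j + 1 = 2k$, so that the moments involved are those of orders $2k - 2$ and $2k$.\<close>
  then obtain k where k: "j = 2 * k - 1" "k \<ge> 1" by (intro that[of "Suc k'"]) auto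
  have "real M * pmean (monom 1 (2 * k)) = (\<Sum>b\<in>Basis - {north}. pmean (monom 1 (2 * k)))"
    using DIM north by simp
  also have "\<dots> = (\<Sum>b\<in>Basis - {north}. (2 * real k - 1) * (\<integral>u. (u \<bullet> b)\<^sup>2 * (u \<bullet> north) ^ (2 * k - 2) \<partial>sphere_measure))"
    using k by (intro sum.cong) (auto simp: mixed_moment)
  also have "\<dots> = (2 * real k - 1) * (\<integral>u. (\<Sum>b\<in>Basis - {north}. (u \<bullet> b)\<^sup>2 * (u \<bullet> north) ^ (2 * k - 2)) \<partial>sphere_measure)"
    by (subst Bochner_Integration.integral_sum)
       (auto simp: sum_distrib_left intro!: sphere_integrable_continuous continuous_intros)
  also have "(\<integral>u. (\<Sum>b\<in>Basis - {north}. (u \<bullet> b)\<^sup>2 * (u \<bullet> north) ^ (2 * k - 2)) \<partial>sphere_measure)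
     = (\<integral>u. (u \<bullet> north) ^ (2 * k - 2) - (u \<bullet> north) ^ (2 * k) \<partial>sphere_measure)"
  proof (rule integral_cong_AE)
    show "AE u in sphere_measure. (\<Sum>b\<in>Basis - {north}. (u \<bullet> b)\<^sup>2 * (u \<bullet> north) ^ (2 * k - 2))
       = (u \<bullet> north) ^ (2 * k - 2) - (u \<bullet> north) ^ (2 * k)"
      using AE_sphere_measure
    proof eventually_elim
      case (elim u)
      have "(u \<bullet> north)\<^sup>2 + (\<Sum>b\<in>Basis - {north}. (u \<bullet> b)\<^sup>2) = (\<Sum>b\<in>Basis. (u \<bullet> b)\<^sup>2)"
        using north by (simp add: sum.remove)
      also have "\<dots> = 1"
        using elim by (simp add: norm_eq_1 euclidean_inner[of u u] power2_eq_square)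
      finally have "(\<Sum>b\<in>Basis - {north}. (u \<bullet> b)\<^sup>2) = 1 - (u \<bullet> north)\<^sup>2" by simp
      moreover have "(u \<bullet> north) ^ (2 * k) = (u \<bullet> north)\<^sup>2 * (u \<bullet> north) ^ (2 * k - 2)"
        using k by (metis le_add_diff_inverse mult_le_mono2 nat_mult_1_right power_add)
      ultimately show ?case
        by (simp add: left_diff_distrib flip: sum_distrib_right)
    qed
  qed (auto intro!: borel_measurable_continuous_onI continuous_intros)
  also have "\<dots> = pmean (monom 1 (2 * k - 2)) - pmean (monom 1 (2 * k))"
    unfolding pmean_def zmean_def poly_monom mult_1
    by (intro Bochner_Integration.integral_diff sphere_integrable_continuous continuous_intros)
  finally have "real M * pmean (monom 1 (2 * k)) = (2 * real k - 1) * (pmean (monom 1 (2 * k - 2)) - pmean (monom 1 (2 * k)))" .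
  moreover have "j - 1 = 2 * k - 2" "j + 1 = 2 * k" "real j = 2 * real k - 1"
    using k by auto
  ultimately show ?thesis by presburger
qed

text \<open>
  Integration by parts for the density proportional to $(1 - s^2)^{(M-2)/2}$ on $[-1,1]$, obtained here
  from the moments without computing that density.
\<close>

lemma stein: "pmean ([:1, 0, -1:] * pderiv h) = real M * pmean ([:0, 1:] * h)"
proof -
  have h: "h = (\<Sum>j\<le>degree h. smult (coeff h j) (monom 1 j))"
    using poly_as_sum_of_monoms[of h] by (simp add: smult_monom)
  have "[:1, 0, -1:] * pderiv h = (\<Sum>j\<le>degree h. smult (coeff h j * real j) (monom 1 (j - 1) - monom 1 (j + 1)))"
  proof (rule poly_ext)
    fix x
    have "poly (pderiv h) x = (\<Sum>j\<le>degree h. coeff h j * (real j * x ^ (j - 1)))"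
      by (subst h) (simp add: higher_pderiv_sum[of 1, simplified] pderiv_smult pderiv_monom poly_sum poly_monom)
    moreover have "(1 - x * x) * (real j * x ^ (j - 1)) = real j * (x ^ (j - 1) - x ^ (j + 1))" for j
      by (cases j) (simp_all add: algebra_simps)
    then have "(1 - x * x) * (coeff h j * (real j * x ^ (j - 1))) = coeff h j * real j * (x ^ (j - 1) - x ^ (j + 1))" for j
      by (metis mult.assoc mult.left_commute)
    moreover have "poly ([:1, 0, -1:] * pderiv h) x = (1 - x * x) * poly (pderiv h) x"
      by (simp add: algebra_simps)
    ultimately show "poly ([:1, 0, -1:] * pderiv h) x =
       poly (\<Sum>j\<le>degree h. smult (coeff h j * real j) (monom 1 (j - 1) - monom 1 (j + 1))) x"
      by (simp only: sum_distrib_left) (simp add: poly_sum poly_monom)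
  qed
  then have "pmean ([:1, 0, -1:] * pderiv h) =
      (\<Sum>j\<le>degree h. coeff h j * (real j * (pmean (monom 1 (j - 1)) - pmean (monom 1 (j + 1)))))"
    by (simp only: pmean_sum pmean_smult pmean_diff mult.assoc)
  also have "\<dots> = real M * (\<Sum>j\<le>degree h. coeff h j * pmean (monom 1 (j + 1)))"
    by (simp only: stein_monom sum_distrib_left mult_ac)
  also have "(\<Sum>j\<le>degree h. coeff h j * pmean (monom 1 (j + 1))) = pmean (\<Sum>j\<le>degree h. smult (coeff h j) (monom 1 (j + 1)))"
    by (simp only: pmean_sum pmean_smult)
  also have "(\<Sum>j\<le>degree h. smult (coeff h j) (monom 1 (j + 1))) = [:0, 1:] * h"
    by (rule poly_ext, subst (2) h) (simp add: poly_sum poly_monom sum_distrib_left mult_ac)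
  finally show ?thesis .
qed

text \<open>
  Apply integration by parts to $p' q$: both sides equal $-L((1 - s^2)\,p' q')$.
\<close>

lemma gegenbauer_op_symmetric: "pmean (q * gegenbauer_op M p) = pmean (p * gegenbauer_op M q)"
proof -
  have "pmean (q * gegenbauer_op M p) = - pmean ([:1, 0, -1:] * pderiv p * pderiv q)" for p q
  proof -
    have "q * gegenbauer_op M p = [:1, 0, -1:] * pderiv (pderiv p * q)
        - smult (real M) ([:0, 1:] * (pderiv p * q)) - [:1, 0, -1:] * pderiv p * pderiv q"
      by (rule poly_ext) (simp add: gegenbauer_op_def pderiv_mult algebra_simps)
    then show ?thesis by (simp only: pmean_diff pmean_smult stein)
  qed
  moreover have "[:1, 0, -1:] * pderiv p * pderiv q = [:1, 0, -1:] * pderiv q * pderiv p"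
    by (simp only: mult_ac)
  ultimately show ?thesis by metis
qed

text \<open>
  Eigenvectors of a symmetric operator for distinct eigenvalues; the numbers $n(n + M - 1)$ are strictly
  increasing in $n$ because $M \ge 1$.
\<close>

lemma zonal_poly_orthogonal: assumes "m \<noteq> n" shows "pmean (Z m * Z n) = 0"
proof -
  define ev where "ev n = real n * (real n + real M - 1)" for n
  have "ev n * pmean (Z m * Z n) = ev m * pmean (Z m * Z n)"
    using gegenbauer_op_symmetric[of "Z m" "Z n"]
    by (simp add: gegenbauer_op_zonal_poly[OF M] ev_def[symmetric] pmean_smult pmean_minus mult.commute[of "Z n"])
  moreover have "ev n \<noteq> ev m"
  proof -
    have "ev n - ev m = (real n - real m) * (real n + real m + real M - 1)"
      by (simp add: ev_def algebra_simps)
    moreover have "real n + real m + real M - 1 \<noteq> 0" using M assms by auto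
    ultimately show ?thesis using assms by auto
  qed
  ultimately show ?thesis by auto
qed

definition energy :: "nat \<Rightarrow> real" where "energy l = pmean (Z l * Z l)"

text \<open>
  Multiplying the recurrence by $R_n$ and by $R_{n+2}$ and taking means expresses consecutive energies
  through each other with positive factors.
\<close>

lemma energy_pos: "energy l > 0"
proof -
  have raise: "(2 * real n + real M + 1) * pmean ([:0, 1:] * Z (Suc n) * Z n) = (real n + 1) * energy n" for n
  proof -
    have "smult (2 * real n + real M + 1) ([:0, 1:] * Z (Suc n) * Z n)
        = smult (real n + real M) (Z (Suc (Suc n)) * Z n) + smult (real n + 1) (Z n * Z n)"
    proof (rule poly_ext, goal_cases)
      case (1 x)
      show ?case
        using arg_cong[OF zonal_poly_rec_eval[OF M, of n x], of "\<lambda>y. y * poly (Z n) x"]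
        by (simp add: algebra_simps)
    qed
    from arg_cong[OF this, of pmean] show ?thesis
      by (simp add: pmean_smult pmean_add zonal_poly_orthogonal energy_def del: mult_pCons_left)
  qed
  have lower: "(2 * real n + real M + 1) * pmean ([:0, 1:] * Z (Suc n) * Z (Suc (Suc n)))
      = (real n + real M) * energy (Suc (Suc n))" for n
  proof -
    have "smult (2 * real n + real M + 1) ([:0, 1:] * Z (Suc n) * Z (Suc (Suc n)))
        = smult (real n + real M) (Z (Suc (Suc n)) * Z (Suc (Suc n))) + smult (real n + 1) (Z n * Z (Suc (Suc n)))"
    proof (rule poly_ext, goal_cases)
      case (1 x)
      show ?case
        using arg_cong[OF zonal_poly_rec_eval[OF M, of n x], of "\<lambda>y. y * poly (Z (Suc (Suc n))) x"]
        by (simp add: algebra_simps)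
    qed
    from arg_cong[OF this, of pmean] show ?thesis
      by (simp add: pmean_smult pmean_add zonal_poly_orthogonal energy_def del: mult_pCons_left)
  qed
  have pos: "2 * real n + real M + 1 > 0" "real n + real M > 0" for n
    using M by (auto intro: add_nonneg_pos)
  have mixed: "pmean ([:0, 1:] * Z (Suc n) * Z n) > 0" if "energy n > 0" for n
    using raise[of n] that pos[of n] by (metis add_nonneg_pos mult_pos_pos of_nat_0_le_iff zero_less_mult_pos zero_less_one)
  show ?thesis
  proof (induction l)
    case 0
    then show ?case by (simp add: energy_def)
  next
    case (Suc l)
    note m = mixed[OF Suc]
    show ?case
    proof (cases l)
      case 0
      then show ?thesis using m by (simp add: energy_def zonal_poly_Suc_0[OF M])
    next
      case (Suc n)
      have "[:0, 1:] * Z (Suc l) * Z l = [:0, 1:] * Z (Suc n) * Z (Suc (Suc n))"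
        unfolding Suc by (simp only: mult_ac)
      then have "(real n + real M) * energy (Suc l) > 0"
        using m lower[of n] pos(1)[of n] Suc by (metis mult_pos_pos)
      then show ?thesis using pos(2)[of n] zero_less_mult_pos by blast
    qed
  qed
qed

section \<open>Convolution with zonal functions\<close>

lemma continuous_pair_kernel:
  fixes z w :: 'a and F q :: "real \<Rightarrow> real"
  assumes "continuous_on UNIV F" "continuous_on UNIV q"
  shows "continuous_on A (\<lambda>u. F (u \<bullet> z) * q (u \<bullet> w))"
  by (intro continuous_on_mult continuous_zonal assms)

lemma zonal_convolution_eq:
  fixes z w z' w' :: 'a and F q :: "real \<Rightarrow> real"
  assumes F: "continuous_on UNIV F" and q: "continuous_on UNIV q"
    and "norm z = norm z'" "norm w = norm w'" "z \<bullet> w = z' \<bullet> w'"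
  shows "(\<integral>u. F (u \<bullet> z) * q (u \<bullet> w) \<partial>sphere_measure) = (\<integral>u. F (u \<bullet> z') * q (u \<bullet> w') \<partial>sphere_measure)"
  by (rule sphere_integral_pair_invariant[of "\<lambda>a b. F a * q b"])
     (use assms in \<open>auto intro!: continuous_on_compose2[OF F] continuous_on_compose2[OF q] continuous_intros\<close>)

text \<open>
  Move \<open>z\<close> and \<open>w\<close> to the pole $e$ and to $s e + \sqrt{1 - s^2}\,e'$ on a meridian and expand
  $(u \cdot w)^j$. The terms with odd powers of $u \cdot e'$ vanish by reflection, so only even powers of
  $\sqrt{1 - s^2}$ remain and the result is a polynomial in $s$ of degree at most $j$.
\<close>

lemma zonal_convolution_monom:
  assumes F: "continuous_on UNIV F"
  shows "\<exists>r. degree r \<le> j \<and>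
    (\<forall>z w::'a. norm z = 1 \<longrightarrow> norm w = 1 \<longrightarrow> (\<integral>u. F (u \<bullet> z) * (u \<bullet> w) ^ j \<partial>sphere_measure) = poly r (z \<bullet> w))"
proof -
  define m where "m i = (\<integral>u. F (u \<bullet> north) * ((u \<bullet> east) ^ i * (u \<bullet> north) ^ (j - i)) \<partial>sphere_measure)" for i
  have cont: "continuous_on UNIV (\<lambda>u. F (u \<bullet> north) * ((u \<bullet> east) ^ i * (u \<bullet> north) ^ k))" for i k
    by (intro continuous_intros continuous_zonal F)
  have odd: "m i = 0" if "odd i" for i
  proof -
    have "m i = (\<integral>u. F (u \<bullet> north) * ((u \<bullet> - east) ^ i * (u \<bullet> north) ^ (j - i)) \<partial>sphere_measure)"
      unfolding m_def
      by (rule sphere_integral_pair_invariant[of "\<lambda>a b. F a * (b ^ i * a ^ (j - i))"])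
         (auto intro!: continuous_on_compose2[OF F] continuous_intros)
    also have "\<dots> = - m i"
      using that by (simp add: m_def)
    finally show ?thesis by simp
  qed
  define r where "r = (\<Sum>i\<le>j. smult (real (j choose i) * m i) (monom 1 (j - i) * [:1, 0, -1:] ^ (i div 2)))"
  have "degree r \<le> j"
    unfolding r_def
  proof (rule degree_sum_le)
    fix i assume "i \<in> {..j}"
    have "degree ([:1, 0, -1:] ^ (i div 2) :: real poly) \<le> 2 * (i div 2)"
      by (rule order.trans[OF degree_power_le]) simp
    then have "degree (monom (1::real) (j - i) * [:1, 0, -1:] ^ (i div 2)) \<le> (j - i) + 2 * (i div 2)"
      by (intro order.trans[OF degree_mult_le] add_mono degree_monom_le)
    also have "\<dots> \<le> j" using \<open>i \<in> {..j}\<close> by auto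
    finally show "degree (smult (real (j choose i) * m i) (monom 1 (j - i) * [:1, 0, -1:] ^ (i div 2))) \<le> j"
      by (intro order.trans[OF degree_smult_le])
  qed simp
  moreover have "(\<integral>u. F (u \<bullet> z) * (u \<bullet> w) ^ j \<partial>sphere_measure) = poly r (z \<bullet> w)"
    if z: "norm z = 1" and w: "norm w = 1" for z w :: 'a
  proof -
    define s where "s = z \<bullet> w"
    have s: "s \<in> {-1..1}" using Cauchy_Schwarz_ineq2[of z w] z w by (auto simp: s_def)
    then have "s\<^sup>2 \<le> 1" by (simp add: abs_square_le_1 abs_le_iff)
    define t where "t = sqrt (1 - s\<^sup>2)"
    have t2: "t\<^sup>2 = 1 - s\<^sup>2" using \<open>s\<^sup>2 \<le> 1\<close> by (simp add: t_def)
    have "(\<integral>u. F (u \<bullet> z) * (u \<bullet> w) ^ j \<partial>sphere_measure)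
       = (\<integral>u. F (u \<bullet> north) * (u \<bullet> meridian s) ^ j \<partial>sphere_measure)"
      by (rule zonal_convolution_eq[of F "\<lambda>x. x ^ j"])
         (use z w s F in \<open>auto simp: s_def intro!: continuous_intros\<close>)
    also have "\<dots> = (\<integral>u. (\<Sum>i\<le>j. real (j choose i) * t ^ i * s ^ (j - i) *
        (F (u \<bullet> north) * ((u \<bullet> east) ^ i * (u \<bullet> north) ^ (j - i)))) \<partial>sphere_measure)"
    proof (rule Bochner_Integration.integral_cong)
      fix u :: 'a
      have "u \<bullet> meridian s = t * (u \<bullet> east) + s * (u \<bullet> north)"
        by (simp add: arc_def t_def inner_add_right)
      then show "F (u \<bullet> north) * (u \<bullet> meridian s) ^ j = (\<Sum>i\<le>j. real (j choose i) * t ^ i * s ^ (j - i) *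
        (F (u \<bullet> north) * ((u \<bullet> east) ^ i * (u \<bullet> north) ^ (j - i))))"
        by (simp add: binomial_ring power_mult_distrib sum_distrib_left mult_ac)
    qed simp
    also have "\<dots> = (\<Sum>i\<le>j. real (j choose i) * t ^ i * s ^ (j - i) * m i)"
      by (subst Bochner_Integration.integral_sum)
         (auto simp: m_def intro!: integrable_mult_right sphere_integrable_continuous cont)
    also have "\<dots> = (\<Sum>i\<le>j. real (j choose i) * m i * (s ^ (j - i) * (1 - s\<^sup>2) ^ (i div 2)))"
    proof (rule sum.cong)
      fix i
      show "real (j choose i) * t ^ i * s ^ (j - i) * m i = real (j choose i) * m i * (s ^ (j - i) * (1 - s\<^sup>2) ^ (i div 2))"
      proof (cases "odd i")
        case False
        then have "t ^ i = (1 - s\<^sup>2) ^ (i div 2)"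
          using t2 by (metis dvd_mult_div_cancel power_mult)
        then show ?thesis by (simp add: mult_ac)
      qed (simp add: odd)
    qed simp
    also have "\<dots> = poly r s"
      by (simp add: r_def poly_sum poly_monom power2_eq_square)
    finally show ?thesis by (simp add: s_def)
  qed
  ultimately show ?thesis by blast
qed

lemma zonal_convolution_poly:
  assumes F: "continuous_on UNIV F" and p: "degree p \<le> n"
  obtains r where "degree r \<le> n"
    "\<And>z w::'a. norm z = 1 \<Longrightarrow> norm w = 1 \<Longrightarrow> (\<integral>u. F (u \<bullet> z) * poly p (u \<bullet> w) \<partial>sphere_measure) = poly r (z \<bullet> w)"
proof -
  obtain r where r: "\<And>j. degree (r j) \<le> j"
    "\<And>j (z::'a) w. norm z = 1 \<Longrightarrow> norm w = 1 \<Longrightarrow> (\<integral>u. F (u \<bullet> z) * (u \<bullet> w) ^ j \<partial>sphere_measure) = poly (r j) (z \<bullet> w)"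
    using zonal_convolution_monom[OF F] by metis
  show thesis
  proof (rule that[of "\<Sum>j\<le>n. smult (coeff p j) (r j)"])
    show "degree (\<Sum>j\<le>n. smult (coeff p j) (r j)) \<le> n"
      by (rule degree_sum_le) (auto intro!: order.trans[OF degree_smult_le] order.trans[OF r(1)])
    fix z w :: 'a assume zw: "norm z = 1" "norm w = 1"
    have "poly p x = (\<Sum>j\<le>n. coeff p j * x ^ j)" for x
      by (subst poly_as_sum_of_monoms'[OF p, symmetric]) (simp add: poly_sum poly_monom)
    then have "(\<integral>u. F (u \<bullet> z) * poly p (u \<bullet> w) \<partial>sphere_measure)
       = (\<integral>u. (\<Sum>j\<le>n. coeff p j * (F (u \<bullet> z) * (u \<bullet> w) ^ j)) \<partial>sphere_measure)"
      by (simp add: sum_distrib_left mult_ac)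
    also have "\<dots> = (\<Sum>j\<le>n. coeff p j * poly (r j) (z \<bullet> w))"
      by (subst Bochner_Integration.integral_sum)
         (auto simp: r(2)[OF zw] intro!: integrable_mult_right sphere_integrable_continuous continuous_intros continuous_zonal F)
    finally show "(\<integral>u. F (u \<bullet> z) * poly p (u \<bullet> w) \<partial>sphere_measure) = poly (\<Sum>j\<le>n. smult (coeff p j) (r j)) (z \<bullet> w)"
      by (simp add: poly_sum)
  qed
qed

text \<open>
  Exchange the order of integration; the inner integral of $q(w \cdot u)\,r(w \cdot e)$ is symmetric in
  $q$ and $r$, since by rotation invariance $u$ and $e$ can be interchanged.
\<close>

lemma zonal_convolution_selfadjoint:
  fixes F q r :: "real \<Rightarrow> real"
  assumes F: "continuous_on UNIV F" and q: "continuous_on UNIV q" and r: "continuous_on UNIV r"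
  shows "(\<integral>w. (\<integral>u. F (u \<bullet> north) * q (u \<bullet> w) \<partial>sphere_measure) * r (w \<bullet> north) \<partial>sphere_measure)
       = (\<integral>w. (\<integral>u. F (u \<bullet> north) * r (u \<bullet> w) \<partial>sphere_measure) * q (w \<bullet> north) \<partial>sphere_measure)"
proof -
  have *: "(\<integral>w. (\<integral>u. F (u \<bullet> north) * q (u \<bullet> w) \<partial>sphere_measure) * r (w \<bullet> north) \<partial>sphere_measure)
     = (\<integral>u. F (u \<bullet> north) * (\<integral>w. q (w \<bullet> u) * r (w \<bullet> north) \<partial>sphere_measure) \<partial>sphere_measure)"
    if q: "continuous_on UNIV q" and r: "continuous_on UNIV r" for q r :: "real \<Rightarrow> real"
  proof -
    have "(\<integral>w. (\<integral>u. F (u \<bullet> north) * q (u \<bullet> w) * r (w \<bullet> north) \<partial>sphere_measure) \<partial>sphere_measure)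
       = (\<integral>u. (\<integral>w. F (u \<bullet> north) * q (u \<bullet> w) * r (w \<bullet> north) \<partial>sphere_measure) \<partial>sphere_measure)"
      by (rule sphere_Fubini)
         (intro continuous_on_mult continuous_on_compose2[OF F] continuous_on_compose2[OF q] continuous_on_compose2[OF r];
          auto intro!: continuous_intros)
    moreover have "(\<integral>w. F (u \<bullet> north) * q (u \<bullet> w) * r (w \<bullet> north) \<partial>sphere_measure)
        = F (u \<bullet> north) * (\<integral>w. q (w \<bullet> u) * r (w \<bullet> north) \<partial>sphere_measure)" for u
      by (simp add: mult.assoc inner_commute[of u])
    ultimately show ?thesis by simp
  qed
  have "(\<integral>u. F (u \<bullet> north) * (\<integral>w. q (w \<bullet> u) * r (w \<bullet> north) \<partial>sphere_measure) \<partial>sphere_measure)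
      = (\<integral>u. F (u \<bullet> north) * (\<integral>w. r (w \<bullet> u) * q (w \<bullet> north) \<partial>sphere_measure) \<partial>sphere_measure)"
  proof (rule integral_cong_AE)
    have meas: "(\<lambda>u. F (u \<bullet> north) * (\<integral>w. q (w \<bullet> u) * r (w \<bullet> north) \<partial>sphere_measure)) \<in> borel_measurable sphere_measure"
      if q: "continuous_on UNIV q" and r: "continuous_on UNIV r" for q r :: "real \<Rightarrow> real"
    proof -
      have [measurable]: "F \<in> borel_measurable borel" "q \<in> borel_measurable borel" "r \<in> borel_measurable borel"
        using F q r by (auto intro: borel_measurable_continuous_onI)
      show ?thesis by measurable
    qed
    show "(\<lambda>u. F (u \<bullet> north) * (\<integral>w. q (w \<bullet> u) * r (w \<bullet> north) \<partial>sphere_measure)) \<in> borel_measurable sphere_measure"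
      "(\<lambda>u. F (u \<bullet> north) * (\<integral>w. r (w \<bullet> u) * q (w \<bullet> north) \<partial>sphere_measure)) \<in> borel_measurable sphere_measure"
      by (intro meas q r)+
    show "AE u in sphere_measure. F (u \<bullet> north) * (\<integral>w. q (w \<bullet> u) * r (w \<bullet> north) \<partial>sphere_measure) =
        F (u \<bullet> north) * (\<integral>w. r (w \<bullet> u) * q (w \<bullet> north) \<partial>sphere_measure)"
      using AE_sphere_measure
    proof eventually_elim
      case (elim u)
      have "(\<integral>w. q (w \<bullet> u) * r (w \<bullet> north) \<partial>sphere_measure) = (\<integral>w. q (w \<bullet> north) * r (w \<bullet> u) \<partial>sphere_measure)"
        by (rule zonal_convolution_eq[OF q r]) (simp_all add: elim inner_commute)
      then show ?case by (simp add: mult.commute)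
    qed
  qed
  then show ?thesis
    by (simp only: *[OF q r] *[OF r q])
qed

text \<open>
  Convolution with \<open>F\<close> maps $R_l$ to a polynomial of degree at most $l$. By symmetry its mean against
  $R_m$ with $m < l$ is the mean of $R_l$ against a polynomial of degree at most $m$, which is zero. So
  the image is a multiple of $R_l$, and evaluation at 1 gives the factor.
\<close>

theorem funk_hecke:
  fixes z w :: 'a
  assumes F: "continuous_on UNIV F" and "norm z = 1" "norm w = 1"
  shows "(\<integral>u. F (u \<bullet> z) * poly (Z l) (u \<bullet> w) \<partial>sphere_measure)
       = zmean (\<lambda>s. F s * poly (Z l) s) * poly (Z l) (z \<bullet> w)"
proof -
  obtain \<psi> where \<psi>: "degree (\<psi> m) \<le> m"
    "norm z = 1 \<Longrightarrow> norm w = 1 \<Longrightarrow> (\<integral>u. F (u \<bullet> z) * poly (Z m) (u \<bullet> w) \<partial>sphere_measure) = poly (\<psi> m) (z \<bullet> w)"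
    for m and z w :: 'a
  proof -
    have "\<exists>r. degree r \<le> m \<and> (\<forall>z w::'a. norm z = 1 \<longrightarrow> norm w = 1 \<longrightarrow>
       (\<integral>u. F (u \<bullet> z) * poly (Z m) (u \<bullet> w) \<partial>sphere_measure) = poly r (z \<bullet> w))" for m
      using zonal_convolution_poly[OF F degree_zonal_poly[OF M, of m]] by metis
    then show ?thesis using that by metis
  qed
  \<comment> \<open>Convolution with \<open>F\<close> is symmetric for the mean.\<close>
  have adjoint: "pmean (\<psi> m * Z k) = pmean (\<psi> k * Z m)" for m k
  proof -
    have *: "pmean (\<psi> m * Z k) = (\<integral>w. (\<integral>u. F (u \<bullet> north) * poly (Z m) (u \<bullet> w) \<partial>sphere_measure) * poly (Z k) (w \<bullet> north) \<partial>sphere_measure)"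
      for m k
      unfolding pmean_def zmean_def
    proof (rule integral_cong_AE)
      have [measurable]: "F \<in> borel_measurable borel" "poly p \<in> borel_measurable borel" for p :: "real poly"
        using F continuous_poly by (auto intro: borel_measurable_continuous_onI)
      show "(\<lambda>w. (\<integral>u. F (u \<bullet> north) * poly (Z m) (u \<bullet> w) \<partial>sphere_measure) * poly (Z k) (w \<bullet> north)) \<in> borel_measurable sphere_measure"
        "(\<lambda>u. poly (\<psi> m * Z k) (u \<bullet> north)) \<in> borel_measurable sphere_measure"
        by measurable
      show "AE w in sphere_measure. poly (\<psi> m * Z k) (w \<bullet> north) =
         (\<integral>u. F (u \<bullet> north) * poly (Z m) (u \<bullet> w) \<partial>sphere_measure) * poly (Z k) (w \<bullet> north)"
        using AE_sphere_measure by eventually_elim (subst \<psi>(2), simp_all add: inner_commute)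
    qed
    show ?thesis
      unfolding * by (rule zonal_convolution_selfadjoint[OF F continuous_poly continuous_poly])
  qed
  have expand: "\<exists>c. \<psi> m = (\<Sum>k\<le>m. smult (c k) (Z k))" for m
    by (rule poly_eq_sum_zonal_poly[OF M \<psi>(1)])
  have inner: "pmean ((\<Sum>k\<le>m. smult (c k) (Z k)) * Z j) = (if j \<le> m then c j * energy j else 0)" for c j m
  proof -
    have "pmean ((\<Sum>k\<le>m. smult (c k) (Z k)) * Z j) = (\<Sum>k\<le>m. c k * pmean (Z k * Z j))"
      by (simp add: sum_distrib_right pmean_sum pmean_smult)
    also have "\<dots> = (\<Sum>k\<le>m. if k = j then c j * energy j else 0)"
      by (rule sum.cong) (auto simp: zonal_poly_orthogonal energy_def)
    finally show ?thesis by simp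
  qed
  obtain c where c: "\<psi> l = (\<Sum>k\<le>l. smult (c k) (Z k))" using expand by blast
  have "c m = 0" if "m < l" for m
  proof -
    obtain d where "\<psi> m = (\<Sum>k\<le>m. smult (d k) (Z k))" using expand by blast
    then have "pmean (\<psi> m * Z l) = 0" using that by (simp only: inner) simp
    moreover have "pmean (\<psi> l * Z m) = c m * energy m" using that by (simp only: inner c) simp
    ultimately show ?thesis using adjoint[of l m] energy_pos[of m] by simp
  qed
  then have "(\<Sum>k\<le>l. smult (c k) (Z k)) = (\<Sum>k\<le>l. if k = l then smult (c l) (Z l) else 0)"
    by (intro sum.cong) auto
  then have \<psi>_l: "\<psi> l = smult (c l) (Z l)" by (simp add: c)
  have "zmean (\<lambda>s. F s * poly (Z l) s) = poly (\<psi> l) 1"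
    using \<psi>(2)[of north north l] by (simp add: zmean_def)
  then have "c l = zmean (\<lambda>s. F s * poly (Z l) s)"
    by (simp add: \<psi>_l zonal_poly_1[OF M])
  then show ?thesis
    using \<psi>(2)[OF assms(2,3)] by (simp add: \<psi>_l)
qed

corollary reproducing:
  fixes z w :: 'a
  assumes "norm z = 1" "norm w = 1"
  shows "(\<integral>u. poly (Z l) (u \<bullet> z) * poly (Z l) (u \<bullet> w) \<partial>sphere_measure) = energy l * poly (Z l) (z \<bullet> w)"
proof -
  have "poly (Z l * Z l) = (\<lambda>s. poly (Z l) s * poly (Z l) s)" by auto
  then show ?thesis
    using funk_hecke[OF continuous_poly assms, of "Z l" l] by (simp add: energy_def pmean_def)
qed

text \<open>
  The kernel $R_l(z \cdot w)$ is positive definite with diagonal 1: apply $2|ab| \le a^2 + b^2$ under the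
  reproducing integral.
\<close>

lemma abs_zonal_poly_le_1:
  assumes "s \<in> {-1..1}" shows "\<bar>poly (Z l) s\<bar> \<le> 1"
proof -
  let ?z = "\<lambda>x. poly (Z l) x" and ?w = "meridian s"
  have int: "integrable sphere_measure (\<lambda>u. ?z (u \<bullet> z) * ?z (u \<bullet> w))" for z w :: 'a
    by (intro sphere_integrable_continuous continuous_pair_kernel continuous_poly)
  have "energy l * \<bar>?z s\<bar> = \<bar>\<integral>u. ?z (u \<bullet> north) * ?z (u \<bullet> ?w) \<partial>sphere_measure\<bar>"
    using reproducing[of north ?w l] assms energy_pos[of l] by (simp add: abs_mult)
  also have "\<dots> \<le> (\<integral>u. \<bar>?z (u \<bullet> north) * ?z (u \<bullet> ?w)\<bar> \<partial>sphere_measure)"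
    by (rule integral_abs_bound)
  also have "\<dots> \<le> (\<integral>u. (?z (u \<bullet> north) * ?z (u \<bullet> north) + ?z (u \<bullet> ?w) * ?z (u \<bullet> ?w)) / 2 \<partial>sphere_measure)"
  proof (rule integral_mono)
    fix u :: 'a
    show "\<bar>?z (u \<bullet> north) * ?z (u \<bullet> ?w)\<bar> \<le> (?z (u \<bullet> north) * ?z (u \<bullet> north) + ?z (u \<bullet> ?w) * ?z (u \<bullet> ?w)) / 2"
      using sum_squares_bound[of "\<bar>?z (u \<bullet> north)\<bar>" "\<bar>?z (u \<bullet> ?w)\<bar>"]
      by (simp add: abs_mult power2_eq_square)
  qed (auto intro!: int)
  also have "\<dots> = ((\<integral>u. ?z (u \<bullet> north) * ?z (u \<bullet> north) \<partial>sphere_measure) + (\<integral>u. ?z (u \<bullet> ?w) * ?z (u \<bullet> ?w) \<partial>sphere_measure)) / 2"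
    by (simp add: Bochner_Integration.integral_add int)
  also have "\<dots> = energy l"
    using assms by (simp add: reproducing dot_square_norm zonal_poly_1[OF M])
  finally show ?thesis using energy_pos[of l] by simp
qed

end

section \<open>An approximate identity\<close>

text \<open>
  On the sphere $|u - w|^2 = 2(1 - u \cdot w)$, so a modulus of continuity with a quadratic term is what the
  concentration estimate for the peaks can be applied to.
\<close>

lemma continuous_quadratic_modulus:
  fixes F :: "real \<Rightarrow> real"
  assumes F: "continuous_on UNIV F" and e: "e > 0"
  obtains C where "C \<ge> 0" "\<And>s t. s \<in> {-1..1} \<Longrightarrow> t \<in> {-1..1} \<Longrightarrow> \<bar>F s - F t\<bar> \<le> e + C * (s - t)\<^sup>2"
proof -
  have cont: "continuous_on {-1..1} F" by (rule continuous_on_subset[OF F]) simp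
  then have "uniformly_continuous_on {-1..1} F"
    by (intro compact_uniformly_continuous) auto
  then obtain d where d: "d > 0" "\<And>s t. s \<in> {-1..1} \<Longrightarrow> t \<in> {-1..1} \<Longrightarrow> \<bar>s - t\<bar> < d \<Longrightarrow> \<bar>F s - F t\<bar> < e"
    using e unfolding uniformly_continuous_on_def dist_real_def by metis
  have "compact (F ` {-1..1})" using cont by (intro compact_continuous_image) auto
  then obtain B where B: "\<And>s. s \<in> {-1..1} \<Longrightarrow> \<bar>F s\<bar> \<le> B"
    using compact_imp_bounded[THEN bounded_iff[THEN iffD1]] by fastforce
  have "B \<ge> 0" using B[of 0] by simp
  show thesis
  proof (rule that[of "2 * B / d\<^sup>2"])
    show "2 * B / d\<^sup>2 \<ge> 0" using \<open>B \<ge> 0\<close> by simp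
    fix s t :: real assume st: "s \<in> {-1..1}" "t \<in> {-1..1}"
    show "\<bar>F s - F t\<bar> \<le> e + 2 * B / d\<^sup>2 * (s - t)\<^sup>2"
    proof (cases "\<bar>s - t\<bar> < d")
      case True
      then show ?thesis using d(2)[OF st] \<open>B \<ge> 0\<close> by (smt (verit) mult_nonneg_nonneg divide_nonneg_nonneg zero_le_power2)
    next
      case False
      then have "1 \<le> (s - t)\<^sup>2 / d\<^sup>2"
        using d(1) by (simp add: le_divide_eq) (metis abs_le_square_iff abs_of_pos not_less)
      then have "2 * B * 1 \<le> 2 * B * ((s - t)\<^sup>2 / d\<^sup>2)"
        using \<open>B \<ge> 0\<close> by (intro mult_left_mono) auto
      moreover have "\<bar>F s - F t\<bar> \<le> 2 * B" using B[OF st(1)] B[OF st(2)] by linarith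
      ultimately show ?thesis using e by simp
    qed
  qed
qed

lemma tannery_sequence:
  fixes a :: "nat \<Rightarrow> nat \<Rightarrow> real"
  assumes lim: "\<And>k. (\<lambda>n. a n k) \<longlonglongrightarrow> b k" and bound: "\<And>n k. \<bar>a n k\<bar> \<le> B k" and B: "summable B"
  shows "(\<lambda>n. \<Sum>k. a n k) \<longlonglongrightarrow> (\<Sum>k. b k)"
proof -
  have "\<forall>\<^sub>F (k, n) in at_top \<times>\<^sub>F sequentially. norm (a n k) \<le> B k"
    using bound by (simp add: case_prod_unfold)
  from tannerys_theorem[where a = "\<lambda>k n. a n k", OF lim this B] show ?thesis by simp
qed

context zonal_sphere
begin

lemma pmean_monom_zonal_nonneg: "pmean (monom 1 n * Z l) \<ge> 0"
proof -
  obtain c where c: "\<And>k. c k \<ge> 0" "monom 1 n = (\<Sum>k\<le>n. smult (c k) (Z k))"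
    using monom_eq_sum_zonal_poly[OF M] by blast
  have "pmean (monom 1 n * Z l) = (\<Sum>k\<le>n. c k * pmean (Z k * Z l))"
    by (simp add: c(2) sum_distrib_right pmean_sum pmean_smult)
  also have "\<dots> \<ge> 0"
  proof (intro sum_nonneg mult_nonneg_nonneg c)
    show "pmean (Z k * Z l) \<ge> 0" for k
      using energy_pos[of l] zonal_poly_orthogonal[of k l] by (cases "k = l") (simp_all add: energy_def)
  qed
  finally show ?thesis .
qed

text \<open>
  The kernel $((1 + s)/2)^n$, up to a constant that makes its mean 1; it peaks at $s = 1$.
\<close>

definition peak :: "nat \<Rightarrow> real poly" where
  "peak n = smult (1 / pmean ([:1, 1:] ^ n)) ([:1, 1:] ^ n)"

lemma one_plus_power: "[:1, 1:] ^ n = (\<Sum>i\<le>n. smult (real (n choose i)) (monom 1 i))"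
proof (rule poly_ext)
  fix x :: real
  show "poly ([:1, 1:] ^ n) x = poly (\<Sum>i\<le>n. smult (real (n choose i)) (monom 1 i)) x"
    using binomial_ring[of x 1 n] by (simp add: poly_sum poly_monom add.commute)
qed

lemma one_plus_power_zonal_nonneg: "pmean ([:1, 1:] ^ n * Z l) \<ge> 0"
  unfolding one_plus_power sum_distrib_right mult_smult_left pmean_sum pmean_smult
  by (intro sum_nonneg mult_nonneg_nonneg pmean_monom_zonal_nonneg) simp

lemma pmean_one_plus_power_pos: "pmean ([:1, 1:] ^ n) > 0"
proof -
  have nonneg: "pmean (monom 1 i) \<ge> 0" for i
    using pmean_monom_zonal_nonneg[of i 0] by simp
  have "pmean ([:1, 1:] ^ n) = (\<Sum>i\<le>n. real (n choose i) * pmean (monom 1 i))"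
    by (simp only: one_plus_power pmean_sum pmean_smult)
  also have "\<dots> \<ge> (\<Sum>i\<in>{0}. real (n choose i) * pmean (monom 1 i))"
    by (rule sum_mono2) (auto simp: nonneg)
  finally show ?thesis by simp
qed

lemma pmean_peak: "pmean (peak n) = 1"
  using pmean_one_plus_power_pos[of n] by (simp add: peak_def pmean_smult)

lemma peak_nonneg: "s \<in> {-1..1} \<Longrightarrow> poly (peak n) s \<ge> 0"
  using pmean_one_plus_power_pos[of n] by (simp add: peak_def)

lemma peak_zonal_nonneg: "pmean (peak n * Z l) \<ge> 0"
  using pmean_one_plus_power_pos[of n] one_plus_power_zonal_nonneg[of n l]
  by (simp add: peak_def pmean_smult)

lemma degree_peak: "degree (peak n) \<le> n"
  unfolding peak_def
  by (rule order.trans[OF degree_smult_le], rule order.trans[OF degree_power_le]) simp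

text \<open>
  Integration by parts with $h = (1 + s)^n$ reads $n\,L((1 - s)(1 + s)^n) = M\,L(s (1 + s)^n)$, and the
  right-hand side is at most $M\,L((1 + s)^n)$.
\<close>

lemma peak_concentrates: "real n * pmean ([:1, -1:] * peak n) \<le> real M"
proof -
  define p where "p = ([:1, 1:] ^ n :: real poly)"
  have "[:1, 0, -1:] * pderiv p = smult (real n) ([:1, -1:] * p)"
  proof (cases n)
    case (Suc k)
    show ?thesis
      unfolding p_def Suc pderiv_power_Suc
      by (rule poly_ext) (simp add: pderiv_pCons algebra_simps)
  qed (simp add: p_def)
  then have "real n * pmean ([:1, -1:] * p) = real M * pmean ([:0, 1:] * p)"
    using stein[of p] by (simp only: pmean_smult)
  also have "\<dots> \<le> real M * pmean p"
  proof -
    have "0 \<le> poly p s" if "s \<in> {-1..1}" for s using that by (simp add: p_def)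
    then have "pmean ([:0, 1:] * p) \<le> pmean p"
      unfolding pmean_def
      by (intro zmean_mono continuous_poly) (simp, metis atLeastAtMost_iff mult_1 mult_right_mono)
    then show ?thesis by (simp add: mult_left_mono)
  qed
  finally have "real n * pmean ([:1, -1:] * p) / pmean p \<le> real M"
    using pmean_one_plus_power_pos[of n] by (simp add: p_def divide_le_eq)
  moreover have "[:1, -1:] * peak n = smult (1 / pmean p) ([:1, -1:] * p)"
    by (simp add: peak_def p_def)
  ultimately show ?thesis by (simp add: pmean_smult del: mult_pCons_left)
qed

lemma peak_expansion: "peak n = (\<Sum>l\<le>n. smult (pmean (peak n * Z l) / energy l) (Z l))"
proof -
  obtain c where c: "peak n = (\<Sum>l\<le>n. smult (c l) (Z l))"
    using poly_eq_sum_zonal_poly[OF M degree_peak] by blast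
  have "pmean (peak n * Z l) = c l * energy l" if "l \<le> n" for l
  proof -
    have "pmean (peak n * Z l) = (\<Sum>k\<le>n. c k * pmean (Z k * Z l))"
      by (simp add: c sum_distrib_right pmean_sum pmean_smult)
    also have "\<dots> = (\<Sum>k\<le>n. if k = l then c l * energy l else 0)"
      by (rule sum.cong) (auto simp: zonal_poly_orthogonal energy_def)
    finally show ?thesis using that by simp
  qed
  then have "(\<Sum>l\<le>n. smult (pmean (peak n * Z l) / energy l) (Z l)) = (\<Sum>l\<le>n. smult (c l) (Z l))"
    using energy_pos by (intro sum.cong) (auto simp: less_imp_neq[THEN not_sym])
  then show ?thesis using c by simp
qed

text \<open>
  The coefficient of \<open>F\<close> at $R_l$ in its orthogonal expansion.
\<close>

definition zcoeff :: "(real \<Rightarrow> real) \<Rightarrow> nat \<Rightarrow> real" where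
  "zcoeff F l = zmean (\<lambda>s. F s * poly (Z l) s) / energy l"

text \<open>
  The factor by which convolution with \<open>peak n\<close> multiplies the coefficient at $R_l$. The mean itself
  vanishes for $l > n$ by orthogonality.
\<close>

definition damping :: "nat \<Rightarrow> nat \<Rightarrow> real" where
  "damping n l = (if l \<le> n then pmean (peak n * Z l) else 0)"

lemma peak_convolution:
  fixes z w :: 'a
  assumes F: "continuous_on UNIV F" and zw: "norm z = 1" "norm w = 1"
  shows "(\<integral>u. F (u \<bullet> z) * poly (peak n) (u \<bullet> w) \<partial>sphere_measure)
     = (\<Sum>l. zcoeff F l * damping n l * poly (Z l) (z \<bullet> w))"
proof -
  have int: "integrable sphere_measure (\<lambda>u. F (u \<bullet> z) * poly (Z l) (u \<bullet> w))" for l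
    by (intro sphere_integrable_continuous continuous_pair_kernel F continuous_poly)
  have "poly (peak n) x = (\<Sum>l\<le>n. pmean (peak n * Z l) / energy l * poly (Z l) x)" for x
    by (subst (1) peak_expansion) (simp add: poly_sum)
  then have "(\<integral>u. F (u \<bullet> z) * poly (peak n) (u \<bullet> w) \<partial>sphere_measure)
     = (\<integral>u. (\<Sum>l\<le>n. pmean (peak n * Z l) / energy l * (F (u \<bullet> z) * poly (Z l) (u \<bullet> w))) \<partial>sphere_measure)"
    by (simp add: sum_distrib_left mult_ac)
  also have "\<dots> = (\<Sum>l\<le>n. pmean (peak n * Z l) / energy l * (zmean (\<lambda>s. F s * poly (Z l) s) * poly (Z l) (z \<bullet> w)))"
    by (subst Bochner_Integration.integral_sum)
       (intro integrable_mult_right int, simp add: funk_hecke[OF F zw] del: times_divide_eq_left)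
  also have "\<dots> = (\<Sum>l\<le>n. zcoeff F l * damping n l * poly (Z l) (z \<bullet> w))"
    by (simp add: zcoeff_def damping_def mult_ac)
  also have "\<dots> = (\<Sum>l. zcoeff F l * damping n l * poly (Z l) (z \<bullet> w))"
    by (rule suminf_finite[symmetric]) (auto simp: damping_def)
  finally show ?thesis .
qed

lemma peak_convolution_tendsto:
  fixes z w :: 'a
  assumes F: "continuous_on UNIV F" and zw: "norm z = 1" "norm w = 1"
  shows "(\<lambda>n. \<integral>u. F (u \<bullet> z) * poly (peak n) (u \<bullet> w) \<partial>sphere_measure) \<longlonglongrightarrow> F (z \<bullet> w)"
proof -
  define I where "I n = (\<integral>u. F (u \<bullet> z) * poly (peak n) (u \<bullet> w) \<partial>sphere_measure)" for n
  have est: "\<bar>I n - F (z \<bullet> w)\<bar> \<le> e + 2 * C * (real M / real n)"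
    if C: "C \<ge> 0" "\<And>s t. s \<in> {-1..1} \<Longrightarrow> t \<in> {-1..1} \<Longrightarrow> \<bar>F s - F t\<bar> \<le> e + C * (s - t)\<^sup>2"
      and n: "n > 0" for n C e
  proof -
    let ?P = "\<lambda>u. poly (peak n) (u \<bullet> w)"
    have int: "integrable sphere_measure (\<lambda>u. F (u \<bullet> z) * ?P u)" "integrable sphere_measure ?P"
      by (intro sphere_integrable_continuous continuous_pair_kernel F continuous_poly integrable_zonal)+
    have P1: "(\<integral>u. ?P u \<partial>sphere_measure) = 1"
      using zmean_eq[OF continuous_poly zw(2), of "peak n"] pmean_peak[of n] by (simp add: pmean_def)
    have "\<bar>I n - F (z \<bullet> w)\<bar> = \<bar>\<integral>u. F (u \<bullet> z) * ?P u - F (z \<bullet> w) * ?P u \<partial>sphere_measure\<bar>"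
      by (subst Bochner_Integration.integral_diff) (simp_all add: int I_def P1)
    also have "\<dots> \<le> (\<integral>u. \<bar>F (u \<bullet> z) * ?P u - F (z \<bullet> w) * ?P u\<bar> \<partial>sphere_measure)"
      by (rule integral_abs_bound)
    also have "\<dots> \<le> (\<integral>u. poly (smult e (peak n) + smult (2 * C) ([:1, -1:] * peak n)) (u \<bullet> w) \<partial>sphere_measure)"
    proof (rule integral_mono_AE)
      show "AE u in sphere_measure. \<bar>F (u \<bullet> z) * ?P u - F (z \<bullet> w) * ?P u\<bar> \<le>
          poly (smult e (peak n) + smult (2 * C) ([:1, -1:] * peak n)) (u \<bullet> w)"
        using AE_sphere_measure
      proof eventually_elim
        case (elim u)
        have bnd: "a \<bullet> b \<in> {-1..1}" if "norm a = 1" "norm b = 1" for a b :: 'a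
          using Cauchy_Schwarz_ineq2[of a b] that by auto
        have P: "?P u \<ge> 0" by (rule peak_nonneg[OF bnd[OF elim zw(2)]])
        \<comment> \<open>The quadratic term of the modulus becomes the linear function $1 - u \cdot w$ of the peak variable.\<close>
        have "\<bar>(u - w) \<bullet> z\<bar> \<le> norm (u - w)"
          using Cauchy_Schwarz_ineq2[of "u - w" z] zw by simp
        then have "((u - w) \<bullet> z)\<^sup>2 \<le> (norm (u - w))\<^sup>2"
          by (metis abs_le_square_iff abs_norm_cancel)
        then have "(u \<bullet> z - w \<bullet> z)\<^sup>2 \<le> 2 * (1 - u \<bullet> w)"
          using norm_diff_unit_sphere[of u w] elim zw by (simp add: inner_diff_left)
        from mult_left_mono[OF this C(1)] have "C * (u \<bullet> z - w \<bullet> z)\<^sup>2 \<le> 2 * C * (1 - u \<bullet> w)"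
          by (simp only: mult.assoc mult.left_commute)
        then have "\<bar>F (u \<bullet> z) - F (w \<bullet> z)\<bar> \<le> e + 2 * C * (1 - u \<bullet> w)"
          using C(2)[OF bnd[OF elim zw(1)] bnd[OF zw(2,1)]] by linarith
        then have "\<bar>F (u \<bullet> z) - F (z \<bullet> w)\<bar> * ?P u \<le> (e + 2 * C * (1 - u \<bullet> w)) * ?P u"
          using P by (intro mult_right_mono) (simp_all add: inner_commute)
        moreover have "\<bar>F (u \<bullet> z) * ?P u - F (z \<bullet> w) * ?P u\<bar> = \<bar>F (u \<bullet> z) - F (z \<bullet> w)\<bar> * ?P u"
          using P by (simp add: abs_mult flip: left_diff_distrib)
        ultimately show ?case by (simp add: algebra_simps)
      qed
    qed (intro integrable_abs Bochner_Integration.integrable_diff integrable_mult_right int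
        integrable_zonal continuous_poly)+
    also have "\<dots> = e + 2 * C * pmean ([:1, -1:] * peak n)"
      by (simp only: zmean_eq[OF continuous_poly zw(2)] pmean_def[symmetric] pmean_add pmean_smult pmean_peak mult_1_right)
    also have "\<dots> \<le> e + 2 * C * (real M / real n)"
      using peak_concentrates[of n] n C(1)
      by (intro add_left_mono mult_left_mono) (simp_all add: le_divide_eq mult.commute del: mult_pCons_left)
    finally show ?thesis .
  qed
  have "I \<longlonglongrightarrow> F (z \<bullet> w)"
  proof (rule LIMSEQ_I)
    fix r :: real assume r: "r > 0"
    then obtain C where C: "C \<ge> 0" "\<And>s t. s \<in> {-1..1} \<Longrightarrow> t \<in> {-1..1} \<Longrightarrow> \<bar>F s - F t\<bar> \<le> r / 2 + C * (s - t)\<^sup>2"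
      using continuous_quadratic_modulus[OF F, of "r / 2"] by auto
    have "(\<lambda>n. r / 2 + 2 * C * (real M / real n)) \<longlonglongrightarrow> r / 2 + 2 * C * 0"
      by (intro tendsto_intros lim_const_over_n)
    from order_tendstoD(2)[OF this, of r]
    have "\<forall>\<^sub>F n in sequentially. r / 2 + 2 * C * (real M / real n) < r"
      using r by simp
    then have "\<forall>\<^sub>F n in sequentially. norm (I n - F (z \<bullet> w)) < r"
      using eventually_gt_at_top[of 0]
    proof eventually_elim
      case (elim n)
      then show ?case using est[OF C, of n] by simp
    qed
    then show "\<exists>N. \<forall>n\<ge>N. norm (I n - F (z \<bullet> w)) < r"
      by (simp add: eventually_sequentially)
  qed
  then show ?thesis by (simp add: I_def[abs_def])
qed

lemma damping_nonneg: "damping n l \<ge> 0"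
  by (simp add: damping_def peak_zonal_nonneg)

lemma damping_le_1: "damping n l \<le> 1"
proof -
  have "pmean (peak n * Z l) \<le> pmean (peak n)"
    unfolding pmean_def
  proof (intro zmean_mono continuous_poly)
    fix s :: real assume s: "s \<in> {-1..1}"
    then show "poly (peak n * Z l) s \<le> poly (peak n) s"
      using mult_left_mono[OF _ peak_nonneg[OF s, of n], of "poly (Z l) s" 1] abs_zonal_poly_le_1[OF s, of l]
      by simp
  qed
  then show ?thesis by (simp add: damping_def pmean_peak)
qed

text \<open>
  The factor is the value at the pole of the convolution of $R_l$ with the peak, and $R_l(1) = 1$.
\<close>

lemma damping_tendsto: "(\<lambda>n. damping n l) \<longlonglongrightarrow> 1"
proof -
  have "(\<lambda>n. \<integral>u. poly (Z l) (u \<bullet> north) * poly (peak n) (u \<bullet> north) \<partial>sphere_measure) \<longlonglongrightarrow> poly (Z l) (north \<bullet> north)"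
    by (rule peak_convolution_tendsto[OF continuous_poly]) simp_all
  then have "(\<lambda>n. pmean (peak n * Z l)) \<longlonglongrightarrow> 1"
    by (simp add: pmean_def zmean_def zonal_poly_1[OF M] mult.commute)
  moreover have "\<forall>\<^sub>F n in sequentially. pmean (peak n * Z l) = damping n l"
    using eventually_ge_at_top[of l] by eventually_elim (simp add: damping_def)
  ultimately show ?thesis by (rule Lim_transform_eventually)
qed

text \<open>
  At the pole, the convolution of \<open>F\<close> with the peaks is the sum of the damped coefficients and tends to
  \<open>F 1\<close>. Since all terms are nonnegative, \<open>F 1\<close> bounds every partial sum of the coefficients.
\<close>

lemma zcoeff_summable:
  assumes F: "continuous_on UNIV F" and nonneg: "\<And>l. zcoeff F l \<ge> 0"
  shows "summable (zcoeff F)"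
proof (rule bounded_imp_summable)
  show "zcoeff F l \<ge> 0" for l by (rule nonneg)
  fix L
  have "(\<lambda>n. \<Sum>l\<le>L. zcoeff F l * damping n l) \<longlonglongrightarrow> (\<Sum>l\<le>L. zcoeff F l * 1)"
    by (intro tendsto_intros damping_tendsto)
  moreover have "(\<lambda>n. \<integral>u. F (u \<bullet> north) * poly (peak n) (u \<bullet> north) \<partial>sphere_measure) \<longlonglongrightarrow> F (north \<bullet> north)"
    by (rule peak_convolution_tendsto[OF F]) simp_all
  moreover have "(\<Sum>l\<le>L. zcoeff F l * damping n l) \<le> (\<integral>u. F (u \<bullet> north) * poly (peak n) (u \<bullet> north) \<partial>sphere_measure)" for n
  proof -
    have "(\<Sum>l\<le>L. zcoeff F l * damping n l) \<le> (\<Sum>l. zcoeff F l * damping n l)"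
      by (intro sum_le_suminf summable_finite[of "{..n}"]) (auto simp: damping_def nonneg peak_zonal_nonneg)
    then show ?thesis
      using peak_convolution[OF F, of north north n] by (simp add: zonal_poly_1[OF M])
  qed
  ultimately show "(\<Sum>l\<le>L. zcoeff F l) \<le> F 1"
    by (auto intro: LIMSEQ_le)
qed

text \<open>
  Both sides are limits of the convolutions with the peaks: the left-hand side because the peaks form an
  approximate identity, the right-hand side by dominated convergence of the series.
\<close>

lemma zonal_expansion:
  assumes F: "continuous_on UNIV F" and A: "summable A" "\<And>l. \<bar>zcoeff F l\<bar> \<le> A l" and s: "s \<in> {-1..1}"
  shows "F s = (\<Sum>l. zcoeff F l * poly (Z l) s)"
proof -
  have "(\<lambda>n. \<Sum>l. zcoeff F l * damping n l * poly (Z l) s) \<longlonglongrightarrow> (\<Sum>l. zcoeff F l * poly (Z l) s)"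
  proof (rule tannery_sequence[OF _ _ A(1)])
    show "(\<lambda>n. zcoeff F l * damping n l * poly (Z l) s) \<longlonglongrightarrow> zcoeff F l * poly (Z l) s" for l
      using tendsto_mult[OF tendsto_mult[OF tendsto_const damping_tendsto] tendsto_const] by fastforce
    show "\<bar>zcoeff F l * damping n l * poly (Z l) s\<bar> \<le> A l" for l n
    proof -
      have "\<bar>zcoeff F l\<bar> * \<bar>damping n l\<bar> * \<bar>poly (Z l) s\<bar> \<le> A l * 1 * 1"
        using A(2)[of l] damping_nonneg[of n l] damping_le_1[of n l] abs_zonal_poly_le_1[OF s, of l]
        by (intro mult_mono) auto
      then show ?thesis by (simp add: abs_mult)
    qed
  qed
  moreover have "(\<lambda>n. \<Sum>l. zcoeff F l * damping n l * poly (Z l) s) \<longlonglongrightarrow> F s"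
    using peak_convolution_tendsto[OF F, of north "meridian s"] peak_convolution[OF F, of north "meridian s"] s
    by simp
  ultimately show ?thesis by (rule LIMSEQ_unique[OF _ _, THEN sym])
qed

end

section \<open>Positive definite kernels\<close>

lemma pos_def_kernel_cong:
  assumes "\<And>x y. x \<in> X \<Longrightarrow> y \<in> X \<Longrightarrow> K x y = K' x y"
  shows "pos_def_kernel X K \<longleftrightarrow> pos_def_kernel X K'"
proof -
  have "(\<Sum>\<mu>=1..n. \<Sum>\<nu>=1..n. c \<mu> * c \<nu> * K (x \<mu>) (x \<nu>)) = (\<Sum>\<mu>=1..n. \<Sum>\<nu>=1..n. c \<mu> * c \<nu> * K' (x \<mu>) (x \<nu>))"
    if "x \<in> {1..n} \<rightarrow> X" for n x and c :: "nat \<Rightarrow> real"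
    using that by (intro sum.cong refl arg_cong2[where f = times] assms) auto
  then show ?thesis by (auto simp: pos_def_kernel_def)
qed

text \<open>
  The points of a family may coincide, whereas the definition asks for distinct points; the coefficients
  of equal points are added up.
\<close>

lemma pos_def_kernel_family:
  assumes K: "pos_def_kernel X K" and I: "finite I" and x: "x \<in> I \<rightarrow> X"
  shows "0 \<le> (\<Sum>i\<in>I. \<Sum>j\<in>I. c i * c j * K (x i) (x j))"
proof -
  define d where "d p = (\<Sum>i | i \<in> I \<and> x i = p. c i)" for p
  let ?S = "x ` I"
  have collect: "(\<Sum>i\<in>I. c i * h (x i)) = (\<Sum>p\<in>?S. d p * h p)" for h
    by (subst sum.image_gen[OF I, of _ x]) (simp add: d_def sum_distrib_right cong: sum.cong_simp)
  have "(\<Sum>i\<in>I. \<Sum>j\<in>I. c i * c j * K (x i) (x j)) = (\<Sum>i\<in>I. c i * (\<Sum>q\<in>?S. d q * K (x i) q))"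
    by (simp add: mult.assoc flip: sum_distrib_left collect[of "K (x _)"])
  also have "\<dots> = (\<Sum>p\<in>?S. d p * (\<Sum>q\<in>?S. d q * K p q))"
    by (rule collect)
  also have "\<dots> = (\<Sum>p\<in>?S. \<Sum>q\<in>?S. d p * d q * K p q)"
    by (simp add: sum_distrib_left mult.assoc)
  also have "\<dots> \<ge> 0"
  proof (cases "?S = {}")
    case False
    obtain h where h: "bij_betw h {1..card ?S} ?S"
      using ex_bij_betw_nat_finite_1[of ?S] I by auto
    have "card ?S \<ge> 1" using False I by (metis One_nat_def Suc_leI card_gt_0_iff finite_imageI)
    moreover have img: "h ` {1..card ?S} = ?S" and "inj_on h {1..card ?S}"
      using h by (simp_all only: bij_betw_def)
    moreover have "h \<in> {1..card ?S} \<rightarrow> X"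
      using img x unfolding image_subset_iff_funcset[symmetric] by simp
    ultimately have "0 \<le> (\<Sum>\<mu>=1..card ?S. \<Sum>\<nu>=1..card ?S. d (h \<mu>) * d (h \<nu>) * K (h \<mu>) (h \<nu>))"
      using K[unfolded pos_def_kernel_def, rule_format, of "card ?S" h "\<lambda>i. d (h i)"] by blast
    also have "\<dots> = (\<Sum>\<mu>=1..card ?S. \<Sum>q\<in>?S. d (h \<mu>) * d q * K (h \<mu>) q)"
      by (rule sum.cong[OF refl]) (rule sum.reindex_bij_betw[OF h])
    also have "\<dots> = (\<Sum>p\<in>?S. \<Sum>q\<in>?S. d p * d q * K p q)"
      by (rule sum.reindex_bij_betw[OF h])
    finally show ?thesis .
  qed auto
  finally show ?thesis .
qed

lemma ell2_inner_sums: "(\<lambda>m. ell2_nth x m * ell2_nth y m) sums (x \<bullet> y)"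
  unfolding inner_ell2_def by (rule summable_sums[OF ell2_summable_mult])

text \<open>
  Induction on the exponent: one factor $x_i \cdot x_j = \sum_m x_{i,m} x_{j,m}$ is absorbed into the
  coefficients, separately for every \<open>m\<close>.
\<close>

lemma gram_power_nonneg:
  fixes x :: "'i \<Rightarrow> ell2"
  shows "0 \<le> (\<Sum>i\<in>I. \<Sum>j\<in>I. c i * c j * (x i \<bullet> x j) ^ k)"
proof (induction k arbitrary: c)
  case 0
  have "(\<Sum>i\<in>I. \<Sum>j\<in>I. c i * c j) = (\<Sum>i\<in>I. c i) * (\<Sum>j\<in>I. c j)"
    by (simp add: sum_product)
  then show ?case by simp
next
  case (Suc k)
  let ?t = "\<lambda>m. \<Sum>i\<in>I. \<Sum>j\<in>I. (c i * ell2_nth (x i) m) * (c j * ell2_nth (x j) m) * (x i \<bullet> x j) ^ k"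
  have "?t m = (\<Sum>i\<in>I. \<Sum>j\<in>I. c i * c j * (x i \<bullet> x j) ^ k * (ell2_nth (x i) m * ell2_nth (x j) m))" for m
    by (simp add: mult_ac)
  then have "?t sums (\<Sum>i\<in>I. \<Sum>j\<in>I. c i * c j * (x i \<bullet> x j) ^ k * (x i \<bullet> x j))"
    by (simp only:) (intro sums_sum sums_mult ell2_inner_sums)
  moreover have "0 \<le> ?t m" for m by (rule Suc)
  ultimately have "0 \<le> (\<Sum>i\<in>I. \<Sum>j\<in>I. c i * c j * (x i \<bullet> x j) ^ k * (x i \<bullet> x j))"
    using sums_le[of "\<lambda>_. 0" ?t 0] by (auto intro: sums_zero)
  then show ?case by (simp add: mult_ac)
qed

section \<open>Schoenberg's theorem on the sphere of the Hilbert space\<close>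

text \<open>
  Vertices of the cube $\{-1,1\}^N$ are encoded by the set of coordinates where they are negative. The
  pointwise product of two vertices then corresponds to the symmetric difference.
\<close>

definition cube_sign :: "nat set \<Rightarrow> nat \<Rightarrow> real" where
  "cube_sign A i = (if i \<in> A then -1 else 1)"

definition cube_mean :: "nat \<Rightarrow> nat set \<Rightarrow> real" where
  "cube_mean N A = (\<Sum>i<N. cube_sign A i) / real N"

definition cube_point :: "nat \<Rightarrow> nat set \<Rightarrow> ell2" where
  "cube_point N A = Abs_ell2 (\<lambda>i. if i < N then cube_sign A i / sqrt (real N) else 0)"

lemma cube_sign_sym_diff: "cube_sign A i * cube_sign B i = cube_sign (sym_diff A B) i"
  by (auto simp: cube_sign_def)

lemma cube_point_nth: "ell2_nth (cube_point N A) i = (if i < N then cube_sign A i / sqrt (real N) else 0)"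
proof -
  have "summable (\<lambda>i. (if i < N then cube_sign A i / sqrt (real N) else 0)\<^sup>2)"
    by (rule summable_finite[of "{..<N}"]) auto
  then show ?thesis by (simp add: cube_point_def Abs_ell2_inverse)
qed

lemma inner_cube_point: "cube_point N A \<bullet> cube_point N B = cube_mean N (sym_diff A B)"
proof -
  have "cube_point N A \<bullet> cube_point N B = (\<Sum>i<N. ell2_nth (cube_point N A) i * ell2_nth (cube_point N B) i)"
    unfolding inner_ell2_def by (rule suminf_finite) (auto simp: cube_point_nth)
  also have "\<dots> = (\<Sum>i<N. cube_sign (sym_diff A B) i / real N)"
    by (rule sum.cong) (simp_all add: cube_point_nth flip: cube_sign_sym_diff)
  finally show ?thesis by (simp add: cube_mean_def sum_divide_distrib)
qed

lemma cube_mean_card: "A \<subseteq> {..<N} \<Longrightarrow> N > 0 \<Longrightarrow> cube_mean N A = 1 - 2 * (real (card A) / real N)"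
proof -
  assume A: "A \<subseteq> {..<N}" and N: "N > 0"
  have "(\<Sum>i<N. cube_sign A i) = (\<Sum>i<N. 1 - (if i \<in> A then 2 else 0))"
    by (rule sum.cong) (auto simp: cube_sign_def)
  also have "\<dots> = real N - 2 * real (card ({..<N} \<inter> A))"
    by (simp add: sum_subtractf sum.If_cases Int_def)
  finally show ?thesis
    using A N by (simp add: cube_mean_def Int_absorb1 diff_divide_distrib)
qed

lemma norm_cube_point: "N > 0 \<Longrightarrow> norm (cube_point N A) = 1"
  using inner_cube_point[of N A A] cube_mean_card[of "{}" N] by (simp add: norm_eq_1)

text \<open>
  The average over all pairs of vertices $A$, $B$ of $\chi_T(A) \chi_T(B)\,g(A \cdot B / N)$ is nonnegative.
  The summand depends only on the product of the vertices, so one of the two sums is redundant.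
\<close>

lemma cube_fourier_nonneg:
  assumes g: "pos_def_kernel (unit_sphere :: ell2 set) (\<lambda>x y. g (x \<bullet> y))" and N: "N > 0"
  shows "0 \<le> (\<Sum>A\<in>Pow {..<N}. (\<Prod>i\<in>T. cube_sign A i) * g (cube_mean N A))"
proof -
  let ?P = "Pow {..<N}" and ?\<chi> = "\<lambda>A. \<Prod>i\<in>T. cube_sign A i"
  define h where "h C = ?\<chi> C * g (cube_mean N C)" for C
  have "0 \<le> (\<Sum>A\<in>?P. \<Sum>B\<in>?P. ?\<chi> A * ?\<chi> B * g (cube_point N A \<bullet> cube_point N B))"
    by (rule pos_def_kernel_family[OF g]) (auto simp: norm_cube_point[OF N])
  also have "\<dots> = (\<Sum>A\<in>?P. \<Sum>B\<in>?P. h (sym_diff A B))"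
    by (simp add: h_def inner_cube_point flip: prod.distrib cube_sign_sym_diff)
  also have "\<dots> = (\<Sum>A\<in>?P. \<Sum>C\<in>?P. h C)"
  \<comment> \<open>For fixed $A$, the map $B \mapsto A \triangle B$ permutes the vertices.\<close>
  proof (rule sum.cong[OF refl])
    fix A assume "A \<in> ?P"
    then show "(\<Sum>B\<in>?P. h (sym_diff A B)) = (\<Sum>C\<in>?P. h C)"
      by (intro sum.reindex_bij_witness[of _ "sym_diff A" "sym_diff A"]) auto
  qed
  also have "\<dots> = 2 ^ N * (\<Sum>C\<in>?P. h C)"
    by (simp add: card_Pow)
  finally show ?thesis
    using zero_less_power[of "2::real" N] by (simp add: h_def zero_le_mult_iff del: zero_less_power)
qed

text \<open>
  The Bernstein polynomial of $y \mapsto g(1 - 2y)$ at $(1-t)/2$ is the expectation of \<open>g\<close> at the mean of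
  \<open>N\<close> independent signs of mean \<open>t\<close>. The probability of the vertex $\varepsilon$ is the product of the
  factors $(1 + t \varepsilon_i)/2$; expanding it gives the powers $t^{|T|}$ with the Fourier
  coefficients of the preceding lemma.
\<close>

lemma bernstein_nonneg_coeffs:
  assumes g: "pos_def_kernel (unit_sphere :: ell2 set) (\<lambda>x y. g (x \<bullet> y))" and N: "N > 0"
  shows "\<exists>a. (\<forall>n. a n \<ge> 0) \<and> (\<forall>n>N. a n = 0) \<and>
    (\<forall>t. (\<Sum>k\<le>N. g (1 - 2 * (real k / real N)) * Bernstein N k ((1 - t) / 2)) = (\<Sum>n\<le>N. a n * t ^ n))"
proof -
  let ?P = "Pow {..<N}" and ?\<chi> = "\<lambda>T A. \<Prod>i\<in>T. cube_sign A i"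
  define e where "e T = (\<Sum>A\<in>?P. ?\<chi> T A * g (cube_mean N A)) / 2 ^ N" for T
  define a where "a n = (\<Sum>T | T \<in> ?P \<and> card T = n. e T)" for n
  have e: "e T \<ge> 0" for T
    using cube_fourier_nonneg[OF g N, of T] by (simp add: e_def)
  have card_le: "card T \<le> N" if "T \<in> ?P" for T
    using that card_mono[of "{..<N}" T] by auto
  have "(\<Sum>k\<le>N. g (1 - 2 * (real k / real N)) * Bernstein N k ((1 - t) / 2)) = (\<Sum>n\<le>N. a n * t ^ n)" for t
  proof -
    define \<phi> where "\<phi> k = g (1 - 2 * (real k / real N)) * (((1 - t) / 2) ^ k * ((1 + t) / 2) ^ (N - k))" for k
    have by_card: "(\<Sum>A\<in>?P. h A) = (\<Sum>k\<le>N. \<Sum>A | A \<in> ?P \<and> card A = k. h A)" for h :: "nat set \<Rightarrow> real"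
      by (rule sum.group[symmetric]) (auto intro: card_le)
    have "(\<Sum>k\<le>N. g (1 - 2 * (real k / real N)) * Bernstein N k ((1 - t) / 2)) = (\<Sum>k\<le>N. real (N choose k) * \<phi> k)"
      by (rule sum.cong) (simp_all add: Bernstein_def \<phi>_def mult_ac add_divide_distrib diff_divide_distrib)
    also have "\<dots> = (\<Sum>k\<le>N. \<Sum>A | A \<in> ?P \<and> card A = k. \<phi> (card A))"
      using n_subsets[of "{..<N}"] by simp
    also have "\<dots> = (\<Sum>A\<in>?P. \<phi> (card A))"
      by (rule by_card[symmetric])
    also have "\<dots> = (\<Sum>A\<in>?P. g (cube_mean N A) * (\<Prod>i<N. (t * cube_sign A i + 1) / 2))"
    proof (rule sum.cong[OF refl])
      fix A assume A: "A \<in> ?P"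
      have "(\<Prod>i<N. (t * cube_sign A i + 1) / 2) = (\<Prod>i\<in>{..<N}. if i \<in> A then (1 - t) / 2 else (1 + t) / 2)"
        by (rule prod.cong) (auto simp: cube_sign_def)
      also have "\<dots> = ((1 - t) / 2) ^ card ({..<N} \<inter> A) * ((1 + t) / 2) ^ card ({..<N} \<inter> - A)"
        by (simp add: prod.If_cases Int_def)
      also have "card ({..<N} \<inter> - A) = N - card A"
        using A card_Diff_subset[of A "{..<N}"] by (simp add: Diff_eq finite_subset)
      also have "{..<N} \<inter> A = A" using A by auto
      finally show "\<phi> (card A) = g (cube_mean N A) * (\<Prod>i<N. (t * cube_sign A i + 1) / 2)"
        using A N by (simp add: \<phi>_def cube_mean_card)
    qed
    also have "\<dots> = (\<Sum>A\<in>?P. \<Sum>T\<in>?P. t ^ card T * (?\<chi> T A * g (cube_mean N A) / 2 ^ N))"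
    proof (rule sum.cong[OF refl])
      fix A
      have "(\<Prod>i<N. (t * cube_sign A i + 1) / 2) = (\<Prod>i<N. t * cube_sign A i + 1) / 2 ^ N"
        by (simp add: prod_dividef)
      also have "(\<Prod>i<N. t * cube_sign A i + 1) = (\<Sum>T\<in>?P. t ^ card T * ?\<chi> T A)"
        by (subst prod_add) (simp_all add: prod.distrib)
      finally show "g (cube_mean N A) * (\<Prod>i<N. (t * cube_sign A i + 1) / 2)
         = (\<Sum>T\<in>?P. t ^ card T * (?\<chi> T A * g (cube_mean N A) / 2 ^ N))"
        by (simp add: sum_divide_distrib sum_distrib_left mult_ac)
    qed
    also have "\<dots> = (\<Sum>T\<in>?P. e T * t ^ card T)"
      by (subst sum.swap) (simp add: e_def sum_distrib_left sum_distrib_right sum_divide_distrib mult_ac)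
    also have "\<dots> = (\<Sum>n\<le>N. a n * t ^ n)"
      by (simp add: by_card a_def sum_distrib_right)
    finally show ?thesis .
  qed
  moreover have "a n \<ge> 0" for n unfolding a_def by (intro sum_nonneg e)
  moreover have "a n = 0" if "n > N" for n
    unfolding a_def using card_le that by (intro sum.neutral) (auto simp: not_less dest: leD)
  ultimately show ?thesis by blast
qed

text \<open>
  The values at $t = 1$ bound all coefficients uniformly, so a diagonal subsequence makes every
  coefficient converge. For $|t| < 1$ the series are dominated by a geometric one, which identifies the
  limit. The limit coefficients are summable, so both sides are continuous up to $t = \pm 1$.
\<close>

lemma nonneg_power_series_limit:
  fixes g :: "real \<Rightarrow> real" and a :: "nat \<Rightarrow> nat \<Rightarrow> real"
  assumes g: "continuous_on {-1..1} g" and a: "\<And>N n. a N n \<ge> 0" and fin: "\<And>N. \<exists>m. \<forall>n>m. a N n = 0"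
    and lim: "\<And>t. t \<in> {-1..1} \<Longrightarrow> (\<lambda>N. \<Sum>n. a N n * t ^ n) \<longlonglongrightarrow> g t"
  shows "\<exists>b. (\<forall>n. b n \<ge> 0) \<and> summable b \<and> (\<forall>t\<in>{-1..1}. (\<lambda>n. b n * t ^ n) sums g t)"
proof -
  have summ: "summable (a N)" for N
  proof -
    obtain m where "\<forall>n>m. a N n = 0" using fin by blast
    then show ?thesis by (intro summable_finite[of "{..m}"]) (auto simp: not_le)
  qed
  have total: "(\<lambda>N. \<Sum>n. a N n) \<longlonglongrightarrow> g 1" using lim[of 1] by simp
  then obtain C where C: "\<And>N. \<bar>\<Sum>n. a N n\<bar> \<le> C"
    using convergent_imp_Bseq[THEN BseqD] by (metis convergentI real_norm_def)
  have partial: "(\<Sum>n\<in>F. a N n) \<le> C" if "finite F" for F N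
  proof -
    have "(\<Sum>n\<in>F. a N n) \<le> (\<Sum>n. a N n)" using that by (intro sum_le_suminf summ) (auto simp: a)
    then show ?thesis using C[of N] by linarith
  qed
  have a_le: "a N n \<le> C" for N n using partial[of "{n}" N] by simp
  interpret diag: subseqs "\<lambda>n s. convergent (\<lambda>N. a (s N) n)"
  proof
    fix n and s :: "nat \<Rightarrow> nat"
    have "bounded (range (\<lambda>N. a (s N) n))"
      using a a_le by (intro boundedI[of _ C]) auto
    then obtain l r where "strict_mono r" "((\<lambda>N. a (s N) n) \<circ> r) \<longlonglongrightarrow> l"
      using bounded_imp_convergent_subsequence by blast
    then show "\<exists>r. strict_mono r \<and> convergent (\<lambda>N. a ((s \<circ> r) N) n)"
      by (auto simp: o_def convergent_def)
  qed
  define r where "r = diag.diagseq"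
  have r: "strict_mono r" unfolding r_def by (rule diag.subseq_diagseq)
  have "convergent (\<lambda>N. a (r N) n)" for n
  proof -
    have "convergent (\<lambda>N. a ((r \<circ> (+) (Suc n)) N) n)"
      unfolding r_def
    proof (rule diag.diagseq_holds)
      fix r s :: "nat \<Rightarrow> nat" and n
      assume "strict_mono r" "convergent (\<lambda>N. a (s N) n)"
      then show "convergent (\<lambda>N. a ((s \<circ> r) N) n)"
        using convergent_subseq_convergent[of "\<lambda>N. a (s N) n" r] by (simp add: o_def)
    qed
    then have "convergent (\<lambda>N. a (r (N + Suc n)) n)" by (simp add: o_def add.commute)
    then show ?thesis by (subst (asm) convergent_ignore_initial_segment)
  qed
  then obtain b where b: "\<And>n. (\<lambda>N. a (r N) n) \<longlonglongrightarrow> b n"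
    unfolding convergent_def by metis
  have b0: "b n \<ge> 0" for n
    by (rule LIMSEQ_le_const[OF b]) (auto simp: a)
  have "summable b"
  proof (rule bounded_imp_summable[OF b0])
    fix L
    have "(\<lambda>N. \<Sum>n\<le>L. a (r N) n) \<longlonglongrightarrow> (\<Sum>n\<le>L. b n)"
      by (intro tendsto_sum b)
    then show "(\<Sum>n\<le>L. b n) \<le> C"
      by (rule LIMSEQ_le_const2) (auto intro: partial)
  qed
  \<comment> \<open>In the open interval the geometric series dominates; the endpoints follow by approximation from inside.\<close>
  have open_case: "(\<Sum>n. b n * t ^ n) = g t" if t: "\<bar>t\<bar> < 1" for t
  proof -
    have "(\<lambda>N. \<Sum>n. a (r N) n * t ^ n) \<longlonglongrightarrow> (\<Sum>n. b n * t ^ n)"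
    proof (rule tannery_sequence)
      show "(\<lambda>N. a (r N) n * t ^ n) \<longlonglongrightarrow> b n * t ^ n" for n
        by (intro tendsto_mult b tendsto_const)
      show "\<bar>a (r N) n * t ^ n\<bar> \<le> C * \<bar>t\<bar> ^ n" for N n
        using a a_le by (simp add: abs_mult power_abs mult_right_mono)
      show "summable (\<lambda>n. C * \<bar>t\<bar> ^ n)"
        using t by (intro summable_mult summable_geometric) simp
    qed
    moreover have "(\<lambda>N. \<Sum>n. a (r N) n * t ^ n) \<longlonglongrightarrow> g t"
      using LIMSEQ_subseq_LIMSEQ[OF lim[of t] r] t by (simp add: o_def abs_less_iff less_imp_le)
    ultimately show ?thesis by (rule LIMSEQ_unique)
  qed
  have pow_le: "\<bar>b n * t ^ n\<bar> \<le> b n" if "t \<in> {-1..1}" for t n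
    using that b0[of n] power_le_one[of "\<bar>t\<bar>" n]
    by (simp add: abs_mult power_abs mult_left_le abs_le_iff)
  have "(\<lambda>n. b n * t ^ n) sums g t" if t: "t \<in> {-1..1}" for t
  proof -
    \<comment> \<open>Points of the open interval that tend to \<open>t\<close>.\<close>
    define y where "y k = t * (1 - 1 / real (Suc (Suc k)))" for k
    have y_bound: "\<bar>y k\<bar> < 1" for k
    proof -
      have "\<bar>y k\<bar> = \<bar>t\<bar> * (1 - 1 / real (Suc (Suc k)))"
        by (simp add: y_def abs_mult)
      also have "\<dots> \<le> 1 * (1 - 1 / real (Suc (Suc k)))"
        using t by (intro mult_right_mono) auto
      also have "\<dots> < 1" by simp
      finally show ?thesis .
    qed
    have "(\<lambda>k. 1 / real (Suc (Suc k))) \<longlonglongrightarrow> 0"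
      using LIMSEQ_Suc[OF LIMSEQ_inverse_real_of_nat] by (simp only: inverse_eq_divide)
    then have "y \<longlonglongrightarrow> t * (1 - 0)"
      unfolding y_def by (intro tendsto_intros)
    then have y: "y \<longlonglongrightarrow> t" by simp
    have "(\<lambda>k. g (y k)) \<longlonglongrightarrow> g t"
      by (rule continuous_on_tendsto_compose[OF g y t])
         (use y_bound in \<open>auto simp: abs_less_iff less_imp_le intro!: always_eventually\<close>)
    moreover have "(\<lambda>k. \<Sum>n. b n * y k ^ n) \<longlonglongrightarrow> (\<Sum>n. b n * t ^ n)"
    proof (rule tannery_sequence[OF _ _ \<open>summable b\<close>])
      show "(\<lambda>k. b n * y k ^ n) \<longlonglongrightarrow> b n * t ^ n" for n
        by (intro tendsto_intros y)
      show "\<bar>b n * y k ^ n\<bar> \<le> b n" for k n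
        using y_bound[of k] by (intro pow_le) (auto simp: abs_less_iff)
    qed
    ultimately have "(\<Sum>n. b n * t ^ n) = g t"
      using open_case[OF y_bound] by (auto intro: LIMSEQ_unique)
    moreover have "summable (\<lambda>n. b n * t ^ n)"
      by (rule summable_comparison_test'[OF \<open>summable b\<close>, of 0]) (use pow_le[OF t] in auto)
    ultimately show ?thesis by (simp add: sums_iff)
  qed
  then show ?thesis using b0 \<open>summable b\<close> by blast
qed

text \<open>
  The Bernstein polynomials converge to \<open>g\<close> by Weierstrass, and as polynomials in \<open>t\<close> they have
  nonnegative coefficients.
\<close>

theorem schoenberg_hilbert_sphere:
  assumes cont: "continuous_on {-1..1} g"
    and g: "pos_def_kernel (unit_sphere :: ell2 set) (\<lambda>x y. g (x \<bullet> y))"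
  shows "\<exists>b. (\<forall>n. b n \<ge> 0) \<and> summable b \<and> (\<forall>t\<in>{-1..1}. (\<lambda>n. b n * t ^ n) sums g t)"
proof -
  have "\<forall>N. \<exists>a. (\<forall>n. a n \<ge> 0) \<and> (\<forall>n>Suc N. a n = 0) \<and>
    (\<forall>t. (\<Sum>k\<le>Suc N. g (1 - 2 * (real k / real (Suc N))) * Bernstein (Suc N) k ((1 - t) / 2)) = (\<Sum>n\<le>Suc N. a n * t ^ n))"
    using bernstein_nonneg_coeffs[OF g] by blast
  then obtain a where a: "\<And>N n. a N n \<ge> 0" "\<And>N n. n > Suc N \<Longrightarrow> a N n = 0"
    "\<And>N t. (\<Sum>k\<le>Suc N. g (1 - 2 * (real k / real (Suc N))) * Bernstein (Suc N) k ((1 - t) / 2)) = (\<Sum>n\<le>Suc N. a N n * t ^ n)"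
    by metis
  show ?thesis
  proof (rule nonneg_power_series_limit[OF cont a(1)])
    show "\<exists>m. \<forall>n>m. a N n = 0" for N using a(2) by blast
    fix t :: real assume t: "t \<in> {-1..1}"
    define p where "p = (1 - t) / 2"
    have p: "p \<in> {0..1}" "1 - 2 * p = t" using t by (auto simp: p_def field_simps)
    define h where "h y = g (1 - 2 * y)" for y
    have h: "continuous_on {0..1} h"
      unfolding h_def by (rule continuous_on_compose2[OF cont]) (auto intro!: continuous_intros)
    have eq: "(\<Sum>n. a N n * t ^ n) = (\<Sum>k\<le>Suc N. h (real k / real (Suc N)) * Bernstein (Suc N) k p)" for N
    proof -
      have "(\<Sum>n. a N n * t ^ n) = (\<Sum>n\<le>Suc N. a N n * t ^ n)"
        by (rule suminf_finite) (auto simp: a(2) not_le)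
      then show ?thesis by (simp only: a(3)[symmetric] h_def p_def)
    qed
    show "(\<lambda>N. \<Sum>n. a N n * t ^ n) \<longlonglongrightarrow> g t"
    proof (rule LIMSEQ_I)
      fix e :: real assume "e > 0"
      then obtain N where N: "\<And>n x. N \<le> n \<Longrightarrow> x \<in> {0..1} \<Longrightarrow> \<bar>h x - (\<Sum>k\<le>n. h (real k / real n) * Bernstein n k x)\<bar> < e"
        using Bernstein_Weierstrass[OF h] by metis
      have "norm ((\<Sum>n. a n' n * t ^ n) - g t) < e" if "n' \<ge> N" for n'
        using N[of "Suc n'" p] p that by (simp only: eq) (simp add: h_def abs_minus_commute)
      then show "\<exists>no. \<forall>n\<ge>no. norm ((\<Sum>k. a n k * t ^ k) - g t) < e" by blast
    qed
  qed
qed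

section \<open>Kernels on the product of the spheres\<close>

text \<open>
  Every pair of inner products in $[-1,1]^2$ is realised by a fixed point of the product of the spheres and
  a point that moves along great circles.
\<close>

lemma isotropic_part_continuous:
  fixes K :: "'a::real_inner \<times> 'b::real_inner \<Rightarrow> 'a \<times> 'b \<Rightarrow> real" and p q :: 'a and p' q' :: 'b
  assumes K: "continuous_kernel (prod_topology sphere_topology sphere_topology) K" "has_isotropic_part K f"
    and pq: "norm p = 1" "norm q = 1" "p \<bullet> q = 0" and pq': "norm p' = 1" "norm q' = 1" "p' \<bullet> q' = 0"
  shows "continuous_on ({-1..1} \<times> {-1..1}) (\<lambda>a. f (fst a) (snd a))"
proof -
  have "continuous_on ((unit_sphere \<times> unit_sphere) \<times> (unit_sphere \<times> unit_sphere)) (\<lambda>(P, Q). K P Q)"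
    using K(1) by (simp add: continuous_kernel_def sphere_topology_eq)
  then have "continuous_on ({-1..1} \<times> {-1..1})
     (\<lambda>a. (\<lambda>(P, Q). K P Q) ((p, p'), (arc p q (fst a), arc p' q' (snd a))))"
    by (rule continuous_on_compose2)
       (auto simp: pq pq' norm_arc intro!: continuous_intros continuous_on_compose2[OF continuous_arc[of UNIV]])
  then show ?thesis
  proof (rule continuous_on_eq)
    fix a :: "real \<times> real" assume a: "a \<in> {-1..1} \<times> {-1..1}"
    then have "K (p, p') (arc p q (fst a), arc p' q' (snd a)) = f (p \<bullet> arc p q (fst a)) (p' \<bullet> arc p' q' (snd a))"
      using K(2) pq pq' by (auto simp: has_isotropic_part_def norm_arc)
    then show "(\<lambda>(P, Q). K P Q) ((p, p'), (arc p q (fst a), arc p' q' (snd a))) = f (fst a) (snd a)"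
      by (simp add: inner_arc pq pq')
  qed
qed

text \<open>
  Composition with this retraction extends functions on $[-1,1]^2$ continuously to the plane.
\<close>

definition unit_clamp :: "real \<Rightarrow> real" where
  "unit_clamp t = max (-1) (min 1 t)"

lemma unit_clamp_bounds: "unit_clamp t \<in> {-1..1}"
  by (simp add: unit_clamp_def)

lemma unit_clamp_id: "t \<in> {-1..1} \<Longrightarrow> unit_clamp t = t"
  by (simp add: unit_clamp_def)

lemma continuous_unit_clamp [continuous_intros]:
  "continuous_on A g \<Longrightarrow> continuous_on A (\<lambda>x. unit_clamp (g x))"
  unfolding unit_clamp_def by (intro continuous_intros)

lemma sums_nonneg_has_sum:
  fixes g h :: "nat \<Rightarrow> real"
  assumes "h sums S" "summable g" "\<And>n. \<bar>h n\<bar> \<le> g n"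
  shows "(h has_sum S) UNIV"
proof (rule norm_summable_imp_has_sum)
  show "summable (\<lambda>n. norm (h n))"
    by (rule summable_comparison_test'[OF assms(2), of 0]) (simp add: assms(3))
qed (rule assms(1))

lemma has_sum_finite_sum:
  fixes f :: "'i \<Rightarrow> 'a \<Rightarrow> real"
  assumes "\<And>i. i \<in> I \<Longrightarrow> (f i has_sum S i) A"
  shows "((\<lambda>p. \<Sum>i\<in>I. f i p) has_sum (\<Sum>i\<in>I. S i)) A"
  using assms by (induction I rule: infinite_finite_induct) (auto intro: has_sum_add)

context zonal_sphere
begin

text \<open>
  Inserting the reproducing formula for $R_l$ and absorbing the factors $R_l(u \cdot z_i)$ into the
  coefficients leaves, for every \<open>u\<close>, a quadratic form as in \<open>gram_power_nonneg\<close>.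
\<close>

lemma gram_power_zonal_nonneg:
  fixes x :: "'i \<Rightarrow> ell2" and z :: "'i \<Rightarrow> 'a"
  assumes z: "\<And>i. i \<in> I \<Longrightarrow> norm (z i) = 1"
  shows "0 \<le> (\<Sum>i\<in>I. \<Sum>j\<in>I. c i * c j * ((x i \<bullet> x j) ^ k * poly (Z l) (z i \<bullet> z j)))"
proof -
  let ?Z = "poly (Z l)"
  have int: "integrable sphere_measure (\<lambda>u. ?Z (u \<bullet> a) * ?Z (u \<bullet> b))" for a b :: 'a
    by (intro sphere_integrable_continuous continuous_pair_kernel continuous_poly)
  have "energy l * (\<Sum>i\<in>I. \<Sum>j\<in>I. c i * c j * ((x i \<bullet> x j) ^ k * ?Z (z i \<bullet> z j)))
      = (\<Sum>i\<in>I. \<Sum>j\<in>I. c i * c j * (x i \<bullet> x j) ^ k * (energy l * ?Z (z i \<bullet> z j)))"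
    by (simp add: sum_distrib_left mult_ac)
  also have "\<dots> = (\<Sum>i\<in>I. \<Sum>j\<in>I. \<integral>u. c i * c j * (x i \<bullet> x j) ^ k * (?Z (u \<bullet> z i) * ?Z (u \<bullet> z j)) \<partial>sphere_measure)"
    by (intro sum.cong refl) (simp add: reproducing z)
  also have "\<dots> = (\<integral>u. (\<Sum>i\<in>I. \<Sum>j\<in>I. c i * c j * (x i \<bullet> x j) ^ k * (?Z (u \<bullet> z i) * ?Z (u \<bullet> z j))) \<partial>sphere_measure)"
    by (simp add: Bochner_Integration.integral_sum Bochner_Integration.integrable_sum int)
  also have "\<dots> = (\<integral>u. (\<Sum>i\<in>I. \<Sum>j\<in>I. (c i * ?Z (u \<bullet> z i)) * (c j * ?Z (u \<bullet> z j)) * (x i \<bullet> x j) ^ k) \<partial>sphere_measure)"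
    by (simp add: mult_ac)
  also have "\<dots> \<ge> 0"
    by (rule Bochner_Integration.integral_nonneg) (rule gram_power_nonneg)
  finally show ?thesis using energy_pos[of l] by (simp add: zero_le_mult_iff)
qed

text \<open>
  By the Funk-Hecke formula the coefficient of \<open>H x y\<close> is, up to the square of the energy, the double
  integral of $H_{x,y}(v \cdot u) R_l(u \cdot e) R_l(v \cdot e)$. This turns a quadratic form in the points
  \<open>x i\<close> into the double integral of a kernel on the sphere whose finite quadratic forms are quadratic
  forms of the given kernel on the product.
\<close>

lemma zcoeff_pos_def:
  fixes H :: "'b \<Rightarrow> 'b \<Rightarrow> real \<Rightarrow> real"
  assumes H: "\<And>x y. x \<in> X \<Longrightarrow> y \<in> X \<Longrightarrow> continuous_on UNIV (H x y)"
    and pd: "pos_def_kernel (X \<times> (unit_sphere :: 'a set)) (\<lambda>p q. H (fst p) (fst q) (snd p \<bullet> snd q))"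
  shows "pos_def_kernel X (\<lambda>x y. zcoeff (H x y) l)"
  unfolding pos_def_kernel_def
proof (intro allI impI)
  fix n and x :: "nat \<Rightarrow> 'b" and c :: "nat \<Rightarrow> real"
  assume x: "x \<in> {1..n} \<rightarrow> X"
  let ?I = "{1..n}" and ?Z = "poly (Z l)"
  define h where "h i j = H (x i) (x j)" for i j
  have h: "continuous_on UNIV (h i j)" if "i \<in> ?I" "j \<in> ?I" for i j
    unfolding h_def using x that by (intro H) auto
  define \<Phi> where "\<Phi> u v = (\<Sum>i\<in>?I. \<Sum>j\<in>?I. c i * c j * (?Z (u \<bullet> north) * (h i j (v \<bullet> u) * ?Z (v \<bullet> north))))" for u v
  have double: "(\<integral>u. ?Z (u \<bullet> north) * (\<integral>v. h i j (v \<bullet> u) * ?Z (v \<bullet> north) \<partial>sphere_measure) \<partial>sphere_measure)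
      = (energy l)\<^sup>2 * zcoeff (h i j) l"
    and inner_int: "integrable sphere_measure (\<lambda>u. ?Z (u \<bullet> north) * (\<integral>v. h i j (v \<bullet> u) * ?Z (v \<bullet> north) \<partial>sphere_measure))"
    if ij: "i \<in> ?I" "j \<in> ?I" for i j
  proof -
    let ?m = "zmean (\<lambda>s. h i j s * ?Z s)"
    have [measurable]: "h i j \<in> borel_measurable borel" "?Z \<in> borel_measurable borel"
      using h[OF ij] continuous_poly by (auto intro: borel_measurable_continuous_onI)
    have meas: "(\<lambda>u. ?Z (u \<bullet> north) * (\<integral>v. h i j (v \<bullet> u) * ?Z (v \<bullet> north) \<partial>sphere_measure)) \<in> borel_measurable sphere_measure"
      "(\<lambda>u. ?m * (?Z (u \<bullet> north) * ?Z (u \<bullet> north))) \<in> borel_measurable sphere_measure"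
      by measurable
    have ae: "AE u in sphere_measure. ?Z (u \<bullet> north) * (\<integral>v. h i j (v \<bullet> u) * ?Z (v \<bullet> north) \<partial>sphere_measure)
        = ?m * (?Z (u \<bullet> north) * ?Z (u \<bullet> north))"
      using AE_sphere_measure by eventually_elim (simp add: funk_hecke[OF h[OF ij]])
    have int: "integrable sphere_measure (\<lambda>u. ?m * (?Z (u \<bullet> north) * ?Z (u \<bullet> north)))"
      by (intro integrable_mult_right sphere_integrable_continuous continuous_pair_kernel continuous_poly)
    show "integrable sphere_measure (\<lambda>u. ?Z (u \<bullet> north) * (\<integral>v. h i j (v \<bullet> u) * ?Z (v \<bullet> north) \<partial>sphere_measure))"
      using integrable_cong_AE[OF meas ae] int by simp
    have "(\<integral>u. ?Z (u \<bullet> north) * (\<integral>v. h i j (v \<bullet> u) * ?Z (v \<bullet> north) \<partial>sphere_measure) \<partial>sphere_measure)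
       = ?m * energy l"
      using integral_cong_AE[OF meas ae] reproducing[of north north l] by (simp add: zonal_poly_1[OF M])
    then show "(\<integral>u. ?Z (u \<bullet> north) * (\<integral>v. h i j (v \<bullet> u) * ?Z (v \<bullet> north) \<partial>sphere_measure) \<partial>sphere_measure)
      = (energy l)\<^sup>2 * zcoeff (h i j) l"
      using energy_pos[of l] by (simp add: zcoeff_def power2_eq_square)
  qed
  have \<Phi>_inner: "(\<integral>v. \<Phi> u v \<partial>sphere_measure) =
     (\<Sum>i\<in>?I. \<Sum>j\<in>?I. c i * c j * (?Z (u \<bullet> north) * (\<integral>v. h i j (v \<bullet> u) * ?Z (v \<bullet> north) \<partial>sphere_measure)))" for u
  proof -
    have int: "integrable sphere_measure (\<lambda>v. c i * c j * (?Z (u \<bullet> north) * (h i j (v \<bullet> u) * ?Z (v \<bullet> north))))"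
      if "i \<in> ?I" "j \<in> ?I" for i j
      by (intro integrable_mult_right sphere_integrable_continuous continuous_pair_kernel continuous_poly h that)
    have "(\<integral>v. \<Phi> u v \<partial>sphere_measure) =
      (\<Sum>i\<in>?I. \<Sum>j\<in>?I. \<integral>v. c i * c j * (?Z (u \<bullet> north) * (h i j (v \<bullet> u) * ?Z (v \<bullet> north))) \<partial>sphere_measure)"
      unfolding \<Phi>_def
      by (subst Bochner_Integration.integral_sum;
          (intro Bochner_Integration.integrable_sum int sum.cong refl Bochner_Integration.integral_sum; assumption)?)
    then show ?thesis by simp
  qed
  have \<Phi>_int: "(\<integral>u. (\<integral>v. \<Phi> u v \<partial>sphere_measure) \<partial>sphere_measure) = (energy l)\<^sup>2 * (\<Sum>i\<in>?I. \<Sum>j\<in>?I. c i * c j * zcoeff (h i j) l)"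
  proof -
    have "(\<integral>u. (\<integral>v. \<Phi> u v \<partial>sphere_measure) \<partial>sphere_measure) =
      (\<Sum>i\<in>?I. \<Sum>j\<in>?I. \<integral>u. c i * c j * (?Z (u \<bullet> north) * (\<integral>v. h i j (v \<bullet> u) * ?Z (v \<bullet> north) \<partial>sphere_measure)) \<partial>sphere_measure)"
      unfolding \<Phi>_inner
      by (subst Bochner_Integration.integral_sum;
          (intro Bochner_Integration.integrable_sum integrable_mult_right inner_int sum.cong refl Bochner_Integration.integral_sum; assumption)?)
    also have "\<dots> = (\<Sum>i\<in>?I. \<Sum>j\<in>?I. c i * c j * ((energy l)\<^sup>2 * zcoeff (h i j) l))"
      by (intro sum.cong refl) (simp add: double)
    finally show ?thesis by (simp add: sum_distrib_left mult_ac)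
  qed
  have "0 \<le> (\<integral>u. (\<integral>v. \<Phi> u v \<partial>sphere_measure) \<partial>sphere_measure)"
  proof (rule sphere_double_integral_nonneg)
    have "continuous_on UNIV (\<lambda>p::'a \<times> 'a. h i j (snd p \<bullet> fst p))" if "i \<in> ?I" "j \<in> ?I" for i j
      by (rule continuous_on_compose2[OF h[OF that]]) (auto intro!: continuous_intros)
    then show "continuous_on UNIV (\<lambda>p. \<Phi> (fst p) (snd p))"
      unfolding \<Phi>_def by (intro continuous_intros) auto
    fix P :: "'a set" and d :: "'a \<Rightarrow> real" assume P: "finite P" "P \<subseteq> sphere 0 1"
    define e where "e = (\<lambda>(i, p). c i * (d p * ?Z (p \<bullet> north)))"
    define y where "y = (\<lambda>(i::nat, p::'a). (x i, p))"
    have cart: "(\<Sum>a\<in>?I \<times> P. g a) = (\<Sum>i\<in>?I. \<Sum>p\<in>P. g (i, p))" for g :: "nat \<times> 'a \<Rightarrow> real"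
      by (simp add: sum.cartesian_product)
    have "0 \<le> (\<Sum>a\<in>?I \<times> P. \<Sum>b\<in>?I \<times> P. e a * e b * H (fst (y a)) (fst (y b)) (snd (y a) \<bullet> snd (y b)))"
      by (rule pos_def_kernel_family[OF pd]) (use P x in \<open>auto simp: y_def\<close>)
    also have "\<dots> = (\<Sum>i\<in>?I. \<Sum>p\<in>P. \<Sum>j\<in>?I. \<Sum>q\<in>P. d p * d q * (c i * c j * (?Z (p \<bullet> north) * (h i j (q \<bullet> p) * ?Z (q \<bullet> north)))))"
      by (simp only: cart) (simp add: e_def y_def h_def inner_commute mult_ac)
    also have "\<dots> = (\<Sum>i\<in>?I. \<Sum>p\<in>P. \<Sum>q\<in>P. \<Sum>j\<in>?I. d p * d q * (c i * c j * (?Z (p \<bullet> north) * (h i j (q \<bullet> p) * ?Z (q \<bullet> north)))))"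
      by (intro sum.cong refl sum.swap)
    also have "\<dots> = (\<Sum>p\<in>P. \<Sum>i\<in>?I. \<Sum>q\<in>P. \<Sum>j\<in>?I. d p * d q * (c i * c j * (?Z (p \<bullet> north) * (h i j (q \<bullet> p) * ?Z (q \<bullet> north)))))"
      by (rule sum.swap)
    also have "\<dots> = (\<Sum>p\<in>P. \<Sum>q\<in>P. \<Sum>i\<in>?I. \<Sum>j\<in>?I. d p * d q * (c i * c j * (?Z (p \<bullet> north) * (h i j (q \<bullet> p) * ?Z (q \<bullet> north)))))"
      by (intro sum.cong refl sum.swap)
    also have "\<dots> = (\<Sum>p\<in>P. \<Sum>q\<in>P. d p * d q * \<Phi> p q)"
      by (simp only: \<Phi>_def sum_distrib_left)
    finally show "0 \<le> (\<Sum>p\<in>P. \<Sum>q\<in>P. d p * d q * \<Phi> p q)" .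
  qed
  then show "0 \<le> (\<Sum>\<mu>=1..n. \<Sum>\<nu>=1..n. c \<mu> * c \<nu> * zcoeff (H (x \<mu>) (x \<nu>)) l)"
    using energy_pos[of l] by (simp add: \<Phi>_int h_def zero_le_mult_iff)
qed

lemma continuous_zcoeff:
  fixes F :: "real \<Rightarrow> real \<Rightarrow> real"
  assumes F: "continuous_on UNIV (\<lambda>p. F (fst p) (snd p))" and B: "\<And>t s. \<bar>F t s\<bar> \<le> B"
  shows "continuous_on A (\<lambda>t. zcoeff (F t) l)"
proof -
  have Ft: "continuous_on UNIV (F t)" for t
    using continuous_on_compose2[OF F, of UNIV "\<lambda>s. (t, s)"] by (simp add: continuous_intros)
  have "continuous_on A (\<lambda>t. zmean (\<lambda>s. F t s * poly (Z l) s))"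
    unfolding continuous_on_sequentially o_def
  proof (intro allI ballI impI, elim conjE)
    fix u :: "nat \<Rightarrow> real" and t assume u: "u \<longlonglongrightarrow> t"
    show "(\<lambda>n. zmean (\<lambda>s. F (u n) s * poly (Z l) s)) \<longlonglongrightarrow> zmean (\<lambda>s. F t s * poly (Z l) s)"
      unfolding zmean_def
    proof (rule integral_dominated_convergence[where w = "\<lambda>_. B"])
      have "isCont (\<lambda>p. F (fst p) (snd p)) (t, s)" for s
        using F by (simp add: continuous_on_eq_continuous_at)
      from isCont_tendsto_compose[OF this tendsto_Pair[OF u tendsto_const]]
      have "(\<lambda>n. F (u n) s) \<longlonglongrightarrow> F t s" for s by simp
      then show "AE x in sphere_measure. (\<lambda>n. F (u n) (x \<bullet> north) * poly (Z l) (x \<bullet> north)) \<longlonglongrightarrow>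
          F t (x \<bullet> north) * poly (Z l) (x \<bullet> north)"
        by (intro always_eventually allI tendsto_mult tendsto_const) auto
      have meas: "(\<lambda>x::'a. F t (x \<bullet> north) * poly (Z l) (x \<bullet> north)) \<in> borel_measurable sphere_measure" for t
        by (intro borel_measurable_integrable sphere_integrable_continuous continuous_pair_kernel Ft continuous_poly)
      show "(\<lambda>x. F t (x \<bullet> north) * poly (Z l) (x \<bullet> north)) \<in> borel_measurable sphere_measure"
        "(\<lambda>x. F (u n) (x \<bullet> north) * poly (Z l) (x \<bullet> north)) \<in> borel_measurable sphere_measure" for n
        by (rule meas)+
      show "AE x in sphere_measure. norm (F (u n) (x \<bullet> north) * poly (Z l) (x \<bullet> north)) \<le> B" for n
        using AE_inner_bounds[OF frame(1)]
      proof eventually_elim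
        case (elim x)
        have "\<bar>F (u n) (x \<bullet> north)\<bar> * \<bar>poly (Z l) (x \<bullet> north)\<bar> \<le> B * 1"
          using B abs_zonal_poly_le_1[OF elim] by (intro mult_mono order.trans[OF abs_ge_zero B]) auto
        then show ?case by (simp add: abs_mult)
      qed
    qed simp
  qed
  then show ?thesis
    unfolding zcoeff_def using energy_pos[of l] by (intro continuous_on_divide continuous_on_const) auto
qed

text \<open>
  Expand in the second variable, apply Schoenberg's theorem to every coefficient, and combine the two
  series. The double series converges absolutely because the coefficients \<open>G l 1\<close> are summable and
  dominate their rows.
\<close>

theorem product_expansion:
  assumes cont: "continuous_on ({-1..1} \<times> {-1..1}) (\<lambda>a. f (fst a) (snd a))"
    and pd: "pos_def_kernel ((unit_sphere :: ell2 set) \<times> (unit_sphere :: 'a set))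
      (\<lambda>p q. f (fst p \<bullet> fst q) (snd p \<bullet> snd q))"
  shows "\<exists>a. (\<forall>k l. a k l \<ge> 0) \<and> (\<lambda>(k, l). a k l) summable_on UNIV \<and>
    (\<forall>t\<in>{-1..1}. \<forall>s\<in>{-1..1}. ((\<lambda>(k, l). a k l * t ^ k * poly (Z l) s) has_sum f t s) UNIV)"
proof -
  define F where "F t s = f (unit_clamp t) (unit_clamp s)" for t s
  have F_eq: "F t s = f t s" if "t \<in> {-1..1}" "s \<in> {-1..1}" for t s
    using that by (simp add: F_def unit_clamp_id)
  have F: "continuous_on UNIV (\<lambda>p. F (fst p) (snd p))"
  proof -
    have "continuous_on UNIV (\<lambda>p::real \<times> real. (unit_clamp (fst p), unit_clamp (snd p)))"
      by (intro continuous_intros)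
    moreover have "range (\<lambda>p::real \<times> real. (unit_clamp (fst p), unit_clamp (snd p))) \<subseteq> {-1..1} \<times> {-1..1}"
      using unit_clamp_bounds by blast
    ultimately show ?thesis
      using continuous_on_compose2[OF cont] by (fastforce simp: F_def)
  qed
  have Ft: "continuous_on UNIV (F t)" for t
    using continuous_on_compose2[OF F, of UNIV "\<lambda>s. (t, s)"] by (simp add: continuous_intros)
  have "compact ((\<lambda>a. f (fst a) (snd a)) ` ({-1..1} \<times> {-1..1}))"
    by (intro compact_continuous_image cont compact_Times) auto
  then obtain B where "\<And>a. a \<in> {-1..1} \<times> {-1..1} \<Longrightarrow> \<bar>f (fst a) (snd a)\<bar> \<le> B"
    using compact_imp_bounded[THEN bounded_iff[THEN iffD1]] by fastforce
  from this[of "(unit_clamp t, unit_clamp s)" for t s] have B: "\<bar>F t s\<bar> \<le> B" for t s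
    using unit_clamp_bounds by (simp add: F_def)
  have pdF: "pos_def_kernel ((unit_sphere :: ell2 set) \<times> (unit_sphere :: 'a set))
      (\<lambda>p q. F (fst p \<bullet> fst q) (snd p \<bullet> snd q))"
  proof (rule pos_def_kernel_cong[THEN iffD1, OF _ pd])
    fix p q :: "ell2 \<times> 'a" assume "p \<in> unit_sphere \<times> unit_sphere" "q \<in> unit_sphere \<times> unit_sphere"
    then show "f (fst p \<bullet> fst q) (snd p \<bullet> snd q) = F (fst p \<bullet> fst q) (snd p \<bullet> snd q)"
      by (intro F_eq[symmetric]) (auto simp del: mem_sphere_0 simp: unit_sphere_inner_bounds)
  qed
  define G where "G l t = zcoeff (F t) l" for l t
  have "\<exists>b. (\<forall>k. b k \<ge> 0) \<and> summable b \<and> (\<forall>t\<in>{-1..1}. (\<lambda>k. b k * t ^ k) sums G l t)" for l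
  proof (rule schoenberg_hilbert_sphere)
    show "continuous_on {-1..1} (G l)"
      unfolding G_def by (rule continuous_zcoeff[OF F B])
    show "pos_def_kernel (unit_sphere :: ell2 set) (\<lambda>x y. G l (x \<bullet> y))"
      unfolding G_def by (rule zcoeff_pos_def[OF Ft pdF])
  qed
  then obtain b where b: "\<And>l k. b l k \<ge> 0" "\<And>l. summable (b l)"
    "\<And>l t. t \<in> {-1..1} \<Longrightarrow> (\<lambda>k. b l k * t ^ k) sums G l t"
    by metis
  have power_bound: "\<bar>b l k * t ^ k\<bar> \<le> b l k" if "t \<in> {-1..1}" for l k t
    using that b(1)[of l k] power_le_one[of "\<bar>t\<bar>" k]
    by (simp add: abs_mult power_abs mult_left_le abs_le_iff)
  have row: "((\<lambda>k. b l k * t ^ k) has_sum G l t) UNIV" if "t \<in> {-1..1}" for l t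
    by (rule sums_nonneg_has_sum[OF b(3)[OF that] b(2)]) (rule power_bound[OF that])
  have row1: "(b l has_sum G l 1) UNIV" for l
    using row[of 1 l] by simp
  have G1: "G l 1 \<ge> 0" for l
    by (rule has_sum_nonneg[OF row1]) (simp add: b)
  have G_le: "\<bar>G l t\<bar> \<le> G l 1" if "t \<in> {-1..1}" for l t
  proof -
    have "b l k * t ^ k \<le> b l k" "-1 * (b l k * t ^ k) \<le> b l k" for k
      using power_bound[OF that, of l k] by auto
    then have "G l t \<le> G l 1" "-1 * G l t \<le> G l 1"
      by (intro has_sum_mono[OF row[OF that] row1] has_sum_mono[OF has_sum_cmult_right[OF row[OF that]] row1]; simp)+
    then show ?thesis by simp
  qed
  have G1_summable: "summable (\<lambda>l. G l 1)"
    using zcoeff_summable[OF Ft[of 1]] G1 by (simp add: G_def)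
  have "(\<lambda>l. G l 1) summable_on UNIV"
    using G1_summable G1 by (intro norm_summable_imp_summable_on) simp
  then have b_summable: "(\<lambda>p. b (fst p) (snd p)) summable_on UNIV \<times> UNIV"
    by (intro summable_on_SigmaI[where g = "\<lambda>l. G l 1"]) (simp_all add: row1 b)
  have total: "((\<lambda>p. b (fst p) (snd p) * t ^ snd p * poly (Z (fst p)) s) has_sum f t s) (UNIV \<times> UNIV)"
    if t: "t \<in> {-1..1}" and s: "s \<in> {-1..1}" for t s
  proof (rule has_sum_SigmaI)
    show "((\<lambda>k. b (fst (l, k)) (snd (l, k)) * t ^ snd (l, k) * poly (Z (fst (l, k))) s) has_sum G l t * poly (Z l) s) UNIV" for l
      using has_sum_cmult_left[OF row[OF t, of l], of "poly (Z l) s"] by simp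
    have bound: "\<bar>G l t * poly (Z l) s\<bar> \<le> G l 1" for l
      using mult_mono[OF G_le[OF t, of l] abs_zonal_poly_le_1[OF s, of l] G1] by (simp add: abs_mult)
    have "(\<lambda>l. G l t * poly (Z l) s) sums F t s"
    proof -
      have "F t s = (\<Sum>l. G l t * poly (Z l) s)"
        unfolding G_def
        by (rule zonal_expansion[OF Ft G1_summable _ s]) (use G_le[OF t] in \<open>simp add: G_def\<close>)
      moreover have "summable (\<lambda>l. G l t * poly (Z l) s)"
        by (rule summable_comparison_test'[OF G1_summable, of 0]) (use bound in simp)
      ultimately show ?thesis by (simp add: sums_iff)
    qed
    then show "((\<lambda>l. G l t * poly (Z l) s) has_sum f t s) UNIV"
      using F_eq[OF t s] by (intro sums_nonneg_has_sum[OF _ G1_summable bound]) simp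
    show "(\<lambda>p. b (fst p) (snd p) * t ^ snd p * poly (Z (fst p)) s) summable_on UNIV \<times> UNIV"
    proof (rule abs_summable_summable, rule summable_on_comparison_test[OF b_summable])
      fix p
      have "\<bar>b (fst p) (snd p) * t ^ snd p\<bar> * \<bar>poly (Z (fst p)) s\<bar> \<le> b (fst p) (snd p) * 1"
        by (rule mult_mono[OF power_bound[OF t] abs_zonal_poly_le_1[OF s] b(1)]) simp
      then show "norm (b (fst p) (snd p) * t ^ snd p * poly (Z (fst p)) s) \<le> b (fst p) (snd p)"
        by (simp add: abs_mult)
    qed simp
  qed
  show ?thesis
  proof (intro exI[of _ "\<lambda>k l. b l k"] conjI allI ballI)
    show "b l k \<ge> 0" for k l by (rule b(1))
    have "(\<lambda>(k, l). b l k) summable_on UNIV \<times> UNIV \<longleftrightarrow> (\<lambda>p. b (fst p) (snd p)) summable_on UNIV \<times> UNIV"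
      by (rule summable_on_reindex_bij_witness[of _ prod.swap prod.swap]) auto
    then show "(\<lambda>(k, l). b l k) summable_on UNIV" using b_summable by simp
    fix t s :: real assume ts: "t \<in> {-1..1}" "s \<in> {-1..1}"
    have "((\<lambda>(k, l). b l k * t ^ k * poly (Z l) s) has_sum f t s) (UNIV \<times> UNIV) \<longleftrightarrow>
       ((\<lambda>p. b (fst p) (snd p) * t ^ snd p * poly (Z (fst p)) s) has_sum f t s) (UNIV \<times> UNIV)"
      by (rule has_sum_reindex_bij_witness[of _ prod.swap prod.swap]) auto
    then show "((\<lambda>(k, l). b l k * t ^ k * poly (Z l) s) has_sum f t s) UNIV"
      using total[OF ts] by simp
  qed
qed

theorem product_expansion_pos_def:
  assumes a: "\<And>k l. a k l \<ge> 0"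
    and f: "\<And>t s. t \<in> {-1..1} \<Longrightarrow> s \<in> {-1..1} \<Longrightarrow> ((\<lambda>(k, l). a k l * t ^ k * poly (Z l) s) has_sum f t s) UNIV"
  shows "pos_def_kernel ((unit_sphere :: ell2 set) \<times> (unit_sphere :: 'a set))
      (\<lambda>p q. f (fst p \<bullet> fst q) (snd p \<bullet> snd q))"
  unfolding pos_def_kernel_def
proof (intro allI impI)
  fix n and x :: "nat \<Rightarrow> ell2 \<times> 'a" and c :: "nat \<Rightarrow> real"
  assume x: "x \<in> {1..n} \<rightarrow> unit_sphere \<times> unit_sphere"
  let ?t = "\<lambda>i j. fst (x i) \<bullet> fst (x j)" and ?s = "\<lambda>i j. snd (x i) \<bullet> snd (x j)"
  have x': "fst (x i) \<in> unit_sphere" "snd (x i) \<in> unit_sphere" if "i \<in> {1..n}" for i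
    using x that by (auto simp: Pi_iff mem_Times_iff simp del: mem_sphere_0)
  have bounds: "?t i j \<in> {-1..1}" "?s i j \<in> {-1..1}" if "i \<in> {1..n}" "j \<in> {1..n}" for i j
    using unit_sphere_inner_bounds[OF x'(1) x'(1), OF that] unit_sphere_inner_bounds[OF x'(2) x'(2), OF that] by auto
  have "((\<lambda>p. \<Sum>i=1..n. \<Sum>j=1..n. c i * c j * (\<lambda>(k, l). a k l * ?t i j ^ k * poly (Z l) (?s i j)) p)
      has_sum (\<Sum>i=1..n. \<Sum>j=1..n. c i * c j * f (?t i j) (?s i j))) UNIV"
    by (intro has_sum_finite_sum has_sum_cmult_right f bounds)
  moreover have "0 \<le> (\<Sum>i=1..n. \<Sum>j=1..n. c i * c j * (\<lambda>(k, l). a k l * ?t i j ^ k * poly (Z l) (?s i j)) p)" for p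
  proof -
    have "(\<Sum>i=1..n. \<Sum>j=1..n. c i * c j * (\<lambda>(k, l). a k l * ?t i j ^ k * poly (Z l) (?s i j)) p)
      = a (fst p) (snd p) * (\<Sum>i=1..n. \<Sum>j=1..n. c i * c j * (?t i j ^ fst p * poly (Z (snd p)) (?s i j)))"
      by (simp add: case_prod_unfold sum_distrib_left mult_ac)
    also have "\<dots> \<ge> 0"
      using x'(2) by (intro mult_nonneg_nonneg a gram_power_zonal_nonneg) auto
    finally show ?thesis .
  qed
  ultimately show "0 \<le> (\<Sum>\<mu>=1..n. \<Sum>\<nu>=1..n. c \<mu> * c \<nu> * f (?t \<mu> \<nu>) (?s \<mu> \<nu>))"
    by (rule has_sum_nonneg)
qed

end

theorem theorem3p4:
  fixes M :: nat
    and K :: "ell2 \<times> (real ^ 'n) \<Rightarrow> ell2 \<times> (real ^ 'n) \<Rightarrow> real"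
    and f :: "real \<Rightarrow> real \<Rightarrow> real"
  assumes "M \<ge> 1"
    and "CARD('n) = M + 1"
    and "continuous_kernel (prod_topology sphere_topology sphere_topology) K"
    and "has_isotropic_part K f"
  shows "pos_def_kernel (unit_sphere \<times> unit_sphere) K \<longleftrightarrow>
    (\<exists>a :: nat \<Rightarrow> nat \<Rightarrow> real.
       (\<forall>k l. a k l \<ge> 0) \<and>
       (\<lambda>(k, l). a k l) summable_on UNIV \<and>
       (\<forall>t\<in>{-1..1}. \<forall>s\<in>{-1..1}.
          ((\<lambda>(k, l). a k l * t ^ k * normalized_sphere_poly M l s) has_sum f t s) UNIV))"
proof -
  obtain i j :: 'n where "i \<noteq> j"
    using assms(1,2) card_le_Suc0_iff_eq[of "UNIV :: 'n set"] by fastforce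
  then interpret zonal_sphere M "axis i 1 :: real ^ 'n" "axis j 1"
    by unfold_locales (use assms(1,2) in \<open>auto simp: axis_in_Basis_iff axis_eq_axis\<close>)
  \<comment> \<open>The vertices of the square give the orthonormal vectors $(1,1)/\sqrt 2$ and $(1,-1)/\sqrt 2$.\<close>
  have "cube_mean 2 {1} = 0"
    by (simp add: cube_mean_def cube_sign_def numeral_2_eq_2)
  then have cont: "continuous_on ({-1..1} \<times> {-1..1}) (\<lambda>a. f (fst a) (snd a))"
    by (intro isotropic_part_continuous[OF assms(3,4), of "cube_point 2 {}" "cube_point 2 {1}" "axis i 1" "axis j 1"])
       (simp_all add: norm_cube_point inner_cube_point)
  have kernel: "pos_def_kernel (unit_sphere \<times> unit_sphere) K \<longleftrightarrow>
      pos_def_kernel ((unit_sphere :: ell2 set) \<times> (unit_sphere :: (real ^ 'n) set))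
        (\<lambda>p q. f (fst p \<bullet> fst q) (snd p \<bullet> snd q))"
    using assms(4) by (intro pos_def_kernel_cong) (auto simp: has_isotropic_part_def)
  show ?thesis
    unfolding kernel poly_zonal_poly[symmetric]
    using product_expansion[OF cont] product_expansion_pos_def[of _ f] by blast
qed

end
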